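(* Let $n\ge 3$ and let $Q=(q_{ij})_{1\le i,j\le n,\ i\ne j}$ be a collection of nonzero rational numbers. Let $\Gamma(Q)=\langle E_{ij}(q_{ij}) : i\neq j\rangle\le \mathrm{SL}(n,\mathbb R)$. Then there exist an explicitly computable (nonzero) integer $N$ and an explicitly computable diagonal matrix $g\in \mathrm{GL}(n,\mathbb Q)$ such that $g\,\Gamma(Q)\,g^{-1}$ is a finite-index subgroup of $\mathrm{SL}\left(n,\mathbb Z\left[\tfrac1N\right]\right)$. In particular, $\Gamma(Q)$ is $S$-arithmetic for some finite set $S$ of places of $\mathbb Q$ containing the Archimedean place.
   Context: For $i\ne j$, $E_{ij}(t)=I_n+t e_{ij}$, where $e_{ij}$ is the matrix unit with $1$ in position $(i,j)$ and $0$ elsewhere. For a finite set $S$ of places of $\mathbb Q$ containing the Archimedean place, let $\mathbb Z_S=\{x\in\mathbb Q : v_p(x)\ge 0 \text{ for all primes } p\notin S\}$. A subgroup $\Lambda\le \mathrm{SL}(n,\mathbb Q)$ is $S$-arithmetic if $\Lambda\cap \mathrm{SL}(n,\mathbb Z_S)$ has finite index in both $\Lambda$ and $\mathrm{SL}(n,\mathbb Z_S)$. *)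

theory Defs
  imports
    "HOL-Algebra.Generated_Groups"
    "HOL-Library.Nat_Bijection"
    "Jordan_Normal_Form.Determinant"
begin

section \<open>Linear groups\<close>

text \<open>Matrices are those of \<^verbatim>\<open>Jordan_Normal_Form\<close>, so that the size \<open>n\<close> is an ordinary
  natural number; rows and columns are numbered \<open>0, ..., n - 1\<close>.\<close>

definition GL :: "nat \<Rightarrow> 'a :: field mat monoid" where
  "GL n = \<lparr>carrier = {A \<in> carrier_mat n n. invertible_mat A}, monoid.mult = (*), one = 1\<^sub>m n\<rparr>"

text \<open>For a subring \<open>R\<close> of the reals, \<open>SL n R\<close> is \<open>SL(n, R)\<close>, viewed inside \<open>SL(n, \<real>) = SL n UNIV\<close>.\<close>

definition SL :: "nat \<Rightarrow> real set \<Rightarrow> real mat monoid" where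
  "SL n R = \<lparr>carrier = {A \<in> carrier_mat n n. (\<forall>i<n. \<forall>j<n. A $$ (i, j) \<in> R) \<and> det A = 1},
             monoid.mult = (*), one = 1\<^sub>m n\<rparr>"

definition matrix_unit :: "nat \<Rightarrow> nat \<Rightarrow> nat \<Rightarrow> real mat" where
  "matrix_unit n i j = mat n n (\<lambda>(k, l). if k = i \<and> l = j then 1 else 0)"

definition elem_mat :: "nat \<Rightarrow> nat \<Rightarrow> nat \<Rightarrow> real \<Rightarrow> real mat" where
  "elem_mat n i j t = 1\<^sub>m n + t \<cdot>\<^sub>m matrix_unit n i j"

text \<open>Only the values \<open>Q i j\<close> with \<open>i, j < n\<close> and \<open>i \<noteq> j\<close> are used.\<close>

definition Gamma :: "nat \<Rightarrow> (nat \<Rightarrow> nat \<Rightarrow> rat) \<Rightarrow> real mat set" where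
  "Gamma n Q = generate (SL n UNIV)
     {elem_mat n i j (of_rat (Q i j)) | i j. i < n \<and> j < n \<and> i \<noteq> j}"

definition conjugate_set :: "('a, 'b) monoid_scheme \<Rightarrow> 'a \<Rightarrow> 'a set \<Rightarrow> 'a set" where
  "conjugate_set G g H = (\<lambda>x. g \<otimes>\<^bsub>G\<^esub> x \<otimes>\<^bsub>G\<^esub> inv\<^bsub>G\<^esub> g) ` H"

definition finite_index_subgroup :: "'a set \<Rightarrow> ('a, 'b) monoid_scheme \<Rightarrow> bool" where
  "finite_index_subgroup H G \<longleftrightarrow> subgroup H G \<and> finite (rcosets\<^bsub>G\<^esub> H)"

text \<open>The ring obtained from the integers by adjoining \<open>1 / N\<close>, for \<open>N \<noteq> 0\<close>.\<close>

definition Z_inv :: "int \<Rightarrow> real set" where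
  "Z_inv N = {of_int a / of_int N ^ k | a k. True}"


section \<open>Places and S-arithmetic groups\<close>

text \<open>The places of the field of rational numbers are given by the Archimedean one and the primes.\<close>

datatype place = Archimedean | Finite nat

definition rat_places :: "place set" where
  "rat_places = insert Archimedean (Finite ` {p. prime p})"

text \<open>The \<open>p\<close>-adic valuation of a nonzero rational number.\<close>

definition padic_val :: "nat \<Rightarrow> rat \<Rightarrow> int" where
  "padic_val p x = int (multiplicity (int p) (fst (quotient_of x)))
                 - int (multiplicity (int p) (snd (quotient_of x)))"

definition S_integers :: "place set \<Rightarrow> real set" where
  "S_integers S = of_rat ` {x. x = 0 \<or> (\<forall>p. prime p \<and> Finite p \<notin> S \<longrightarrow> padic_val p x \<ge> 0)}"

definition S_arithmetic :: "nat \<Rightarrow> place set \<Rightarrow> real mat set \<Rightarrow> bool" where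
  "S_arithmetic n S L \<longleftrightarrow>
     subgroup L (SL n \<rat>) \<and>
     finite_index_subgroup (L \<inter> carrier (SL n (S_integers S))) ((SL n \<rat>)\<lparr>carrier := L\<rparr>) \<and>
     finite_index_subgroup (L \<inter> carrier (SL n (S_integers S))) (SL n (S_integers S))"


section \<open>Computability\<close>

text \<open>The total recursive functions in one argument, several arguments being packed into one
  by the pairing function \<^const>\<open>prod_encode\<close>. Minimisation is restricted to regular functions,
  which by Kleene's normal form theorem yields exactly the total computable functions.\<close>

inductive recursive_fun :: "(nat \<Rightarrow> nat) \<Rightarrow> bool" where
  zero: "recursive_fun (\<lambda>x. 0)"
| suc: "recursive_fun Suc"
| left: "recursive_fun (\<lambda>x. fst (prod_decode x))"
| right: "recursive_fun (\<lambda>x. snd (prod_decode x))"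
| pair: "recursive_fun f \<Longrightarrow> recursive_fun g \<Longrightarrow> recursive_fun (\<lambda>x. prod_encode (f x, g x))"
| comp: "recursive_fun f \<Longrightarrow> recursive_fun g \<Longrightarrow> recursive_fun (\<lambda>x. f (g x))"
| prim_rec: "recursive_fun f \<Longrightarrow> recursive_fun g \<Longrightarrow>
    recursive_fun (\<lambda>z. case prod_decode z of (x, k) \<Rightarrow>
      rec_nat (f x) (\<lambda>m r. g (prod_encode (x, prod_encode (m, r)))) k)"
| minimise: "recursive_fun f \<Longrightarrow> (\<And>x. \<exists>k. f (prod_encode (x, k)) = 0) \<Longrightarrow>
    recursive_fun (\<lambda>x. LEAST k. f (prod_encode (x, k)) = 0)"

definition encode_rat :: "rat \<Rightarrow> nat" where
  "encode_rat x = (case quotient_of x of (a, b) \<Rightarrow> prod_encode (int_encode a, int_encode b))"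

text \<open>The input of the algorithm: the size and the off-diagonal entries, row by row.\<close>

definition encode_input :: "nat \<Rightarrow> (nat \<Rightarrow> nat \<Rightarrow> rat) \<Rightarrow> nat" where
  "encode_input n Q = prod_encode (n,
     list_encode [encode_rat (Q i j). i \<leftarrow> [0..<n], j \<leftarrow> [0..<n], i \<noteq> j])"

text \<open>The output of the algorithm: an integer and a diagonal matrix, given by its diagonal.\<close>

definition encode_output :: "int \<Rightarrow> rat mat \<Rightarrow> nat" where
  "encode_output N g = prod_encode (int_encode N, list_encode (map encode_rat (diag_mat g)))"

end

theory Submission
  imports Defs "HOL-Number_Theory.Number_Theory"
begin

text \<open>Write \<open>A = \<int>[1/N]\<close>. Conjugation by \<open>diag(d\<^sub>1, ..., d\<^sub>n)\<close> turns \<open>E\<^sub>i\<^sub>j(q)\<close> into \<open>E\<^sub>i\<^sub>j(d\<^sub>i q / d\<^sub>j)\<close>.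
  The theorem follows from two facts: \<open>N\<close> and \<open>d\<close> can be computed such that the conjugated generators lie
  in \<open>SL(n, A)\<close> while \<open>\<Gamma>(Q)\<close> contains all \<open>E\<^sub>i\<^sub>j(t A)\<close> for some integer \<open>t \<noteq> 0\<close>; and a subgroup \<open>H\<close> of \<open>SL(n, \<real>)\<close>
  that contains all \<open>E\<^sub>i\<^sub>j(t A)\<close> meets \<open>SL(n, A)\<close> in a subgroup of finite index.

  \<^bold>\<open>Finite index.\<close> Put \<open>s = t\<^sup>2\<close> and let \<open>K\<close> be generated by all \<open>I + s u v\<^sup>T\<close> with \<open>u\<close> unimodular
  and \<open>v \<bullet> u = 0\<close>. It is visibly normal in \<open>SL(n, A)\<close>, and Suslin's decomposition of \<open>v\<close> into Koszul vectors shows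
  \<open>K \<subseteq> H\<close>, because for \<open>n \<ge> 3\<close> each factor becomes a commutator of products of elements \<open>E\<^sub>i\<^sub>j(t a)\<close>
  (\<open>unimodular_transvection_mem\<close>). A matrix \<open>g \<equiv> I\<close> modulo \<open>s\<close> commutes with every elementary matrix modulo \<open>K\<close>
  (\<open>congruence_commutes_elem_mat\<close>). Since \<open>SL(n, A)\<close> is generated by elementary matrices
  (\<open>SL_Z_inv_elementary\<close>), which are commutators, \<open>SL(n, A) / K\<close> is perfect and its centre, which contains the image of the
  principal congruence subgroup of level \<open>s\<close>, has finite index. By Schur's theorem a perfect group whose centre has
  finite index is finite (\<open>finite_if_perfect_and_centre_finite_index\<close>). So \<open>K\<close>, and with it \<open>H \<inter> SL(n, A)\<close>,
  has finite index.

  \<^bold>\<open>The prime divisors of N.\<close> Let \<open>I\<^sub>i\<^sub>j\<close> be the additive group of all rational \<open>x\<close> with \<open>E\<^sub>i\<^sub>j(x) \<in> \<Gamma>(Q)\<close>; the commutator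
  relations give \<open>I\<^sub>i\<^sub>j I\<^sub>j\<^sub>k \<subseteq> I\<^sub>i\<^sub>k\<close>. Call a prime \<open>p\<close> bad if the \<open>p\<close>-adic valuation is unbounded below on \<open>I\<^sub>1\<^sub>2\<close>,
  equivalently on every \<open>I\<^sub>i\<^sub>j\<close>. If \<open>N\<close> is the product of the bad primes, then every \<open>I\<^sub>i\<^sub>j\<close>
  contains \<open>t A\<close> for a common \<open>t\<close> (\<open>divisible_by_bad_primes\<close>). At a good prime the least valuations \<open>u\<^sub>j\<close> on \<open>I\<^sub>1\<^sub>j\<close> satisfy
  \<open>u\<^sub>j \<le> u\<^sub>i + v\<^sub>p(q\<^sub>i\<^sub>j)\<close> (\<open>potential_exists\<close>), so \<open>d\<^sub>j = \<Prod>p\<^bsup>u\<^sub>j\<^esup>\<close>, up to a common factor, makes all \<open>d\<^sub>i q\<^sub>i\<^sub>j / d\<^sub>j\<close>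
  integral at the good primes.

  \<^bold>\<open>Computability.\<close> The bad primes are defined through the infinite group \<open>\<Gamma>(Q)\<close>, but \<open>N\<close> is also the least positive integer
  for which some positive integers \<open>d\<^sub>j\<close> below a computable bound make all \<open>d\<^sub>i q\<^sub>i\<^sub>j / d\<^sub>j\<close> elements of \<open>\<int>[1/N]\<close>:
  the product of the bad primes admits such \<open>d\<^sub>j\<close> (\<open>bad_primes_scaling\<close>), and any \<open>N\<close> that admits them is divisible by
  every bad prime (\<open>bad_prime_dvd\<close>). Thus a bounded search finds \<open>N\<close> and then \<open>d\<close>.

  \<^bold>\<open>S-arithmeticity.\<close> For \<open>S\<close> consisting of the Archimedean place and the prime divisors of \<open>N\<close>, the fact on finite index
  applies to \<open>\<Gamma> \<inter> SL(n, A)\<close> directly, and to its conjugate inside \<open>g \<Gamma> g\<^sup>-\<^sup>1 \<subseteq> SL(n, A)\<close>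
  (\<open>Gamma_arithmetic\<close>).\<close>

section \<open>Perfect groups with centre of finite index\<close>

context group begin

lemma inv_cancel:
  assumes "y \<in> carrier G" "z \<in> carrier G"
  shows "inv y \<otimes> (y \<otimes> z) = z" "y \<otimes> (inv y \<otimes> z) = z"
  using assms by (simp_all add: m_assoc[symmetric])

primrec list_prod :: "'a list \<Rightarrow> 'a" where
  "list_prod [] = \<one>"
| "list_prod (x # xs) = x \<otimes> list_prod xs"

lemma list_prod_closed: "set xs \<subseteq> carrier G \<Longrightarrow> list_prod xs \<in> carrier G"
  by (induction xs) auto

lemma list_prod_append:
  "set xs \<subseteq> carrier G \<Longrightarrow> set ys \<subseteq> carrier G \<Longrightarrow> list_prod (xs @ ys) = list_prod xs \<otimes> list_prod ys"
  by (induction xs) (auto simp: m_assoc list_prod_closed)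

lemma generate_list_prod:
  assumes "S \<subseteq> carrier G" "\<And>s. s \<in> S \<Longrightarrow> inv s \<in> S" "x \<in> generate G S"
  shows "\<exists>xs. set xs \<subseteq> S \<and> list_prod xs = x"
  using assms(3)
proof (induction rule: generate.induct)
  case one
  show ?case by (rule exI[of _ "[]"]) simp
next
  case (incl h)
  then show ?case using assms(1) by (intro exI[of _ "[h]"]) auto
next
  case (inv h)
  then show ?case using assms(1) assms(2)[of h] by (intro exI[of _ "[inv h]"]) auto
next
  case (eng h1 h2)
  then obtain xs ys where "set xs \<subseteq> S" "list_prod xs = h1" "set ys \<subseteq> S" "list_prod ys = h2" by blast
  then show ?case using assms(1) by (intro exI[of _ "xs @ ys"]) (auto simp: list_prod_append)
qed

text \<open>A set of generators that is closed under conjugation lets chosen factors be moved to the front of a product: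
  the factors that they pass are replaced by conjugates, so the length does not grow.\<close>

lemma list_prod_collect:
  assumes S: "S \<subseteq> carrier G" and conj: "\<And>s g. s \<in> S \<Longrightarrow> g \<in> carrier G \<Longrightarrow> inv g \<otimes> s \<otimes> g \<in> S"
    and "set xs \<subseteq> S" and "c \<in> S" and "k \<le> count_list xs c"
  shows "\<exists>ys. set ys \<subseteq> S \<and> length ys + k = length xs \<and> list_prod xs = c [^] k \<otimes> list_prod ys"
  using assms(3,5)
proof (induction xs arbitrary: k)
  case Nil
  then show ?case by auto
next
  case (Cons x xs)
  have cG: "c \<in> carrier G" and xG: "x \<in> carrier G" and xsG: "set xs \<subseteq> carrier G"
    using S \<open>c \<in> S\<close> Cons.prems by auto
  show ?case
  proof (cases "k \<le> count_list xs c")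
    case True
    then obtain ys where ys: "set ys \<subseteq> S" "length ys + k = length xs" "list_prod xs = c [^] k \<otimes> list_prod ys"
      using Cons.IH[OF _ True] Cons.prems by auto
    define y where "y = inv (c [^] k) \<otimes> x \<otimes> (c [^] k)"
    have yS: "y \<in> S" unfolding y_def using conj Cons.prems cG by auto
    have ysG: "list_prod ys \<in> carrier G" using ys S by (intro list_prod_closed) auto
    have "x \<otimes> list_prod xs = c [^] k \<otimes> list_prod (y # ys)"
      using cG xG ysG ys by (simp add: y_def m_assoc inv_cancel)
    then show ?thesis using yS ys by (intro exI[of _ "y # ys"]) auto
  next
    case False
    then have xc: "x = c" "k = Suc (count_list xs c)" using Cons.prems by (auto split: if_splits)
    then obtain ys where ys: "set ys \<subseteq> S" "length ys + (k - 1) = length xs"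
       "list_prod xs = c [^] (k - 1) \<otimes> list_prod ys"
      using Cons.IH[of "k - 1"] Cons.prems by auto
    have ysG: "list_prod ys \<in> carrier G" using ys S by (intro list_prod_closed) auto
    have "x \<otimes> list_prod xs = c [^] k \<otimes> list_prod ys"
      using xc cG ysG ys(3) nat_pow_Suc2[OF cG, of "k - 1"] by (simp add: m_assoc[symmetric])
    then show ?thesis using ys xc by (intro exI[of _ ys]) auto
  qed
qed

text \<open>The step in Schur's theorem that shortens products: if \<open>c\<^sup>m\<close> is central, then \<open>c\<^bsup>m+1\<^esup>\<close>, a product of \<open>m + 1\<close>
  commutators, is already a product of \<open>m\<close> of them. Indeed \<open>c\<^bsup>m+1\<^esup> = (x y x\<^sup>-\<^sup>1) c\<^sup>m y\<^sup>-\<^sup>1\<close> by centrality, and the first two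
  factors \<open>c\<close> in it combine to \<open>[x, y\<^sup>2]\<close>.\<close>

lemma commutator_pow_Suc:
  assumes x: "x \<in> carrier G" and y: "y \<in> carrier G"
    and c: "c = x \<otimes> y \<otimes> inv x \<otimes> inv y"
    and m: "m > 0" and central: "\<And>g. g \<in> carrier G \<Longrightarrow> c [^] m \<otimes> g = g \<otimes> c [^] (m::nat)"
  shows "c [^] Suc m =
     (x \<otimes> (y \<otimes> y) \<otimes> inv x \<otimes> inv (y \<otimes> y)) \<otimes> (y \<otimes> c \<otimes> inv y) [^] (m - 1)"
proof -
  have cG: "c \<in> carrier G" using x y c by auto
  have pow: "(y \<otimes> c \<otimes> inv y) [^] k = y \<otimes> c [^] k \<otimes> inv y" for k :: nat
  proof (induction k)
    case (Suc k)
    have "(y \<otimes> c [^] k \<otimes> inv y) \<otimes> (y \<otimes> c \<otimes> inv y) = y \<otimes> c [^] k \<otimes> (inv y \<otimes> y) \<otimes> c \<otimes> inv y"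
      using cG y by (simp add: m_assoc inv_cancel)
    then show ?case using Suc cG y by (simp add: m_assoc inv_cancel)
  qed (use y in auto)
  have "c [^] Suc m = c [^] m \<otimes> (x \<otimes> y \<otimes> inv x \<otimes> inv y)" by (simp add: c)
  also have "\<dots> = c [^] m \<otimes> (x \<otimes> y \<otimes> inv x) \<otimes> inv y"
    using cG x y by (simp add: m_assoc)
  also have "\<dots> = (x \<otimes> y \<otimes> inv x) \<otimes> c [^] m \<otimes> inv y"
    using central[of "x \<otimes> y \<otimes> inv x"] x y by force
  also have "c [^] m = c \<otimes> c [^] (m - 1)"
    using m nat_pow_Suc2[OF cG, of "m - 1"] by simp
  also have "(x \<otimes> y \<otimes> inv x) \<otimes> (c \<otimes> c [^] (m - 1)) \<otimes> inv y
     = (x \<otimes> y \<otimes> inv x) \<otimes> (x \<otimes> y \<otimes> inv x \<otimes> inv y) \<otimes> inv y \<otimes> (y \<otimes> c [^] (m - 1) \<otimes> inv y)"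
  proof -
    have "x \<otimes> y \<otimes> inv x \<otimes> inv y \<otimes> inv y \<otimes> (y \<otimes> c [^] (m - 1) \<otimes> inv y) = c \<otimes> inv y \<otimes> (y \<otimes> c [^] (m - 1) \<otimes> inv y)"
      by (simp only: c)
    also have "\<dots> = c \<otimes> c [^] (m - 1) \<otimes> inv y"
      using x y cG by (simp add: m_assoc inv_cancel)
    finally show ?thesis using x y cG by (simp add: m_assoc)
  qed
  also have "(x \<otimes> y \<otimes> inv x) \<otimes> (x \<otimes> y \<otimes> inv x \<otimes> inv y) \<otimes> inv y
     = x \<otimes> (y \<otimes> y) \<otimes> inv x \<otimes> inv (y \<otimes> y)"
    using x y by (simp add: m_assoc inv_mult_group inv_cancel)
  finally show ?thesis by (simp add: pow)
qed

text \<open>Schur's theorem in the form needed. Commutators depend only on the cosets of the centre, so there are finitely many;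
  and in a product with too many factors one commutator occurs more than \<open>m\<close> times, where \<open>m\<close>-th powers are central, so that
  the product can be shortened. Hence the group consists of the products of bounded length from a finite set.
  The set \<open>T\<close> represents the cosets of the centre.\<close>

lemma finite_if_perfect_and_centre_finite_index:
  assumes perfect: "derived G (carrier G) = carrier G"
    and T: "finite T" "T \<subseteq> carrier G"
    and cover: "\<And>g. g \<in> carrier G \<Longrightarrow> \<exists>t\<in>T. \<exists>z\<in>carrier G.
        g = t \<otimes> z \<and> (\<forall>h\<in>carrier G. z \<otimes> h = h \<otimes> z)"
  shows "finite (carrier G)"
proof -
  define S where "S = derived_set G (carrier G)"
  have SG: "S \<subseteq> carrier G" by (auto simp: S_def)
  have memS: "x \<otimes> y \<otimes> inv x \<otimes> inv y \<in> S" if "x \<in> carrier G" "y \<in> carrier G" for x y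
    using that by (auto simp: S_def)
  have commE: "\<exists>t\<in>T. \<exists>s\<in>T. c = t \<otimes> s \<otimes> inv t \<otimes> inv s" if "c \<in> S" for c
  proof -
    from that obtain x y where xy: "x \<in> carrier G" "y \<in> carrier G" "c = x \<otimes> y \<otimes> inv x \<otimes> inv y"
      by (auto simp: S_def)
    obtain t z where t: "t \<in> T" "z \<in> carrier G" "x = t \<otimes> z" "\<forall>h\<in>carrier G. z \<otimes> h = h \<otimes> z"
      using cover xy by blast
    obtain s w where s: "s \<in> T" "w \<in> carrier G" "y = s \<otimes> w" "\<forall>h\<in>carrier G. w \<otimes> h = h \<otimes> w"
      using cover xy by blast
    have tG: "t \<in> carrier G" and sG: "s \<in> carrier G" using t(1) s(1) T by auto
    have "x \<otimes> y = (t \<otimes> s \<otimes> inv t \<otimes> inv s) \<otimes> (y \<otimes> x)"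
    proof -
      have zs: "z \<otimes> s = s \<otimes> z" and wt: "w \<otimes> t = t \<otimes> w" and wz: "w \<otimes> z = z \<otimes> w"
        using t(2,4) s(2,4) tG sG by blast+
      have "x \<otimes> y = t \<otimes> (z \<otimes> s) \<otimes> w" using t(2,3) s(2,3) tG sG by (simp add: m_assoc)
      also have "\<dots> = t \<otimes> s \<otimes> (z \<otimes> w)" unfolding zs using t(2) s(2) tG sG by (simp add: m_assoc)
      finally have 1: "x \<otimes> y = t \<otimes> s \<otimes> (z \<otimes> w)" .
      have "y \<otimes> x = s \<otimes> (w \<otimes> t) \<otimes> z" using t(2,3) s(2,3) tG sG by (simp add: m_assoc)
      also have "\<dots> = s \<otimes> t \<otimes> (w \<otimes> z)" unfolding wt using t(2) s(2) tG sG by (simp add: m_assoc)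
      finally have 2: "y \<otimes> x = s \<otimes> t \<otimes> (z \<otimes> w)" unfolding wz .
      show ?thesis unfolding 1 2 using t(2) s(2) tG sG
        by (simp add: m_assoc inv_cancel)
    qed
    then have "c = t \<otimes> s \<otimes> inv t \<otimes> inv s"
      (is "c = ?d")
    proof -
      assume eq: "x \<otimes> y = ?d \<otimes> (y \<otimes> x)"
      have "c = (x \<otimes> y) \<otimes> inv (y \<otimes> x)" using xy by (simp add: m_assoc inv_mult_group)
      also have "\<dots> = ?d \<otimes> ((y \<otimes> x) \<otimes> inv (y \<otimes> x))"
        unfolding eq using xy tG sG by (intro m_assoc) auto
      finally show ?thesis using xy tG sG by simp
    qed
    then show ?thesis using t s by blast
  qed
  have finS: "finite S"
  proof (rule finite_subset)
    show "S \<subseteq> (\<lambda>(t, s). t \<otimes> s \<otimes> inv t \<otimes> inv s) ` (T \<times> T)" using commE by force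
  qed (use T in auto)
  have conjS: "g \<otimes> c \<otimes> inv g \<in> S" if c: "c \<in> S" and g: "g \<in> carrier G" for c g
  proof -
    from c obtain x y where xy: "x \<in> carrier G" "y \<in> carrier G" "c = x \<otimes> y \<otimes> inv x \<otimes> inv y"
      by (auto simp: S_def)
    have "g \<otimes> c \<otimes> inv g = (g \<otimes> x \<otimes> inv g) \<otimes> (g \<otimes> y \<otimes> inv g) \<otimes> inv (g \<otimes> x \<otimes> inv g) \<otimes> inv (g \<otimes> y \<otimes> inv g)"
      using xy g by (simp add: m_assoc inv_mult_group inv_cancel)
    then show ?thesis using memS xy g by auto
  qed
  have conjS': "inv g \<otimes> c \<otimes> g \<in> S" if c: "c \<in> S" and g: "g \<in> carrier G" for c g
    using conjS[OF c, of "inv g"] g by simp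
  \<comment> \<open>Two of the powers \<open>c\<^sup>0, ..., c\<^bsup>card T\<^esup>\<close> lie in the same coset of the centre, and \<open>m\<close> is a multiple of every possible gap.\<close>
  define m where "m = (fact (card T) :: nat)"
  have m0: "m > 0" by (simp add: m_def)
  have central: "c [^] m \<otimes> g = g \<otimes> c [^] m" if c: "c \<in> carrier G" and g: "g \<in> carrier G" for c g
  proof -
    define f where "f k = (SOME t. t \<in> T \<and> (\<exists>z\<in>carrier G. c [^] k = t \<otimes> z \<and> (\<forall>h\<in>carrier G. z \<otimes> h = h \<otimes> z)))"
      for k :: nat
    have f: "f k \<in> T \<and> (\<exists>z\<in>carrier G. c [^] k = f k \<otimes> z \<and> (\<forall>h\<in>carrier G. z \<otimes> h = h \<otimes> z))" for k
      unfolding f_def by (rule someI_ex) (use cover[of "c [^] k"] c in blast)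
    have "\<not> inj_on f {0..card T}"
    proof
      assume "inj_on f {0..card T}"
      then have "card {0..card T} \<le> card T" using f T by (intro card_inj_on_le) auto
      then show False by simp
    qed
    then obtain i j where ij: "f i = f j" "i \<le> card T" "j \<le> card T" "i < j"
      unfolding inj_on_def by (metis atLeastAtMost_iff linorder_neqE_nat)
    obtain z where z: "z \<in> carrier G" "c [^] i = f i \<otimes> z" "\<forall>h\<in>carrier G. z \<otimes> h = h \<otimes> z"
      using f by blast
    obtain w where w: "w \<in> carrier G" "c [^] j = f i \<otimes> w" "\<forall>h\<in>carrier G. w \<otimes> h = h \<otimes> w"
      using f ij by metis
    have fG: "f i \<in> carrier G" using f T by blast
    have d: "c [^] (j - i) = inv z \<otimes> w"
    proof -
      have "c [^] i \<otimes> c [^] (j - i) = c [^] j" using c ij by (simp add: nat_pow_mult)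
      then have "f i \<otimes> (z \<otimes> c [^] (j - i)) = f i \<otimes> w" using z w fG c by (simp add: m_assoc)
      then have "z \<otimes> c [^] (j - i) = w" using fG z w c by simp
      then show ?thesis using z c by (metis inv_solve_left nat_pow_closed w(1))
    qed
    have comm: "c [^] (j - i) \<otimes> h = h \<otimes> c [^] (j - i)" if h: "h \<in> carrier G" for h
    proof -
      have "inv z \<otimes> h = h \<otimes> inv z"
        using z h by (metis inv_closed inv_solve_left inv_solve_right m_assoc m_closed)
      then show ?thesis unfolding d using z w h
        by (metis inv_closed m_assoc)
    qed
    obtain e where e: "m = (j - i) * e"
    proof -
      have "(j - i) dvd m" unfolding m_def by (rule dvd_fact) (use ij in auto)
      then show thesis using that by (auto simp: dvd_def)
    qed
    have "(c [^] (j - i)) [^] e \<otimes> g = g \<otimes> (c [^] (j - i)) [^] e"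
      using comm[OF g] g c by (induction e) (simp_all add: m_assoc, metis m_assoc nat_pow_closed)
    then show ?thesis using c by (simp add: e nat_pow_pow)
  qed
  have shorten: "\<exists>ys. set ys \<subseteq> S \<and> length ys < length xs \<and> list_prod ys = list_prod xs"
    if xs: "set xs \<subseteq> S" "length xs > card S * m" for xs
  proof -
    have "\<exists>c\<in>S. count_list xs c > m"
    proof (rule ccontr)
      assume "\<not> ?thesis"
      then have "sum (count_list xs) S \<le> (\<Sum>c\<in>S. m)" by (intro sum_mono) (auto simp: not_less)
      moreover have "sum (count_list xs) S = length xs"
        using xs finS by (metis sum_count_set)
      ultimately show False using xs by simp
    qed
    then obtain c where c: "c \<in> S" "Suc m \<le> count_list xs c" by auto
    obtain ys where ys: "set ys \<subseteq> S" "length ys + Suc m = length xs" "list_prod xs = c [^] Suc m \<otimes> list_prod ys"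
      using list_prod_collect[OF SG conjS' xs(1) c] by blast
    obtain x y where xy: "x \<in> carrier G" "y \<in> carrier G" "c = x \<otimes> y \<otimes> inv x \<otimes> inv y"
      using c by (auto simp: S_def)
    define a where "a = x \<otimes> (y \<otimes> y) \<otimes> inv x \<otimes> inv (y \<otimes> y)"
    define b where "b = y \<otimes> c \<otimes> inv y"
    have aS: "a \<in> S" unfolding a_def using memS xy by auto
    have bS: "b \<in> S" unfolding b_def using conjS xy c by auto
    have cG: "c \<in> carrier G" using c SG by auto
    have eq: "c [^] Suc m = a \<otimes> b [^] (m - 1)"
      unfolding a_def b_def by (rule commutator_pow_Suc[OF xy m0 central[OF cG]])
    have rep: "list_prod (replicate k b @ ys) = b [^] k \<otimes> list_prod ys" for k
    proof (induction k)
      case (Suc k)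
      have "list_prod ys \<in> carrier G" using ys SG by (intro list_prod_closed) auto
      then show ?case using Suc bS SG nat_pow_Suc2[of b k]
        by (simp add: m_assoc subset_iff)
    qed (use list_prod_closed[of ys] ys SG in auto)
    have "list_prod (a # replicate (m - 1) b @ ys) = list_prod xs"
      using ys eq rep aS bS SG by (simp add: m_assoc subset_iff list_prod_closed)
    moreover have "length (a # replicate (m - 1) b @ ys) < length xs" using ys m0 by simp
    moreover have "set (a # replicate (m - 1) b @ ys) \<subseteq> S" using ys aS bS by auto
    ultimately show ?thesis by blast
  qed
  have short: "\<exists>ys. set ys \<subseteq> S \<and> length ys \<le> card S * m \<and> list_prod ys = list_prod xs" if "set xs \<subseteq> S" for xs
    using that
  proof (induction "length xs" arbitrary: xs rule: less_induct)
    case less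
    show ?case
    proof (cases "length xs \<le> card S * m")
      case False
      then obtain zs where "set zs \<subseteq> S" "length zs < length xs" "list_prod zs = list_prod xs"
        using shorten less.prems by (metis not_le)
      then show ?thesis using less.hyps by metis
    qed (use less in auto)
  qed
  have invS: "inv s \<in> S" if s: "s \<in> S" for s
  proof -
    from s obtain x y where xy: "x \<in> carrier G" "y \<in> carrier G" "s = x \<otimes> y \<otimes> inv x \<otimes> inv y"
      by (auto simp: S_def)
    then have "inv s = y \<otimes> x \<otimes> inv y \<otimes> inv x" by (simp add: inv_mult_group m_assoc)
    then show ?thesis using memS xy by auto
  qed
  have "carrier G \<subseteq> list_prod ` {ys. set ys \<subseteq> S \<and> length ys \<le> card S * m}"
  proof
    fix g assume "g \<in> carrier G"
    then have "g \<in> generate G S" using perfect by (simp add: derived_def S_def)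
    then obtain xs where "set xs \<subseteq> S" "list_prod xs = g" using generate_list_prod[OF SG invS] by blast
    moreover obtain ys where "set ys \<subseteq> S" "length ys \<le> card S * m" "list_prod ys = list_prod xs"
      using short[OF calculation(1)] by blast
    ultimately show "g \<in> list_prod ` {ys. set ys \<subseteq> S \<and> length ys \<le> card S * m}"
      by (intro image_eqI[of _ _ ys]) auto
  qed
  then show ?thesis using finite_lists_length_le[OF finS] finite_surj by blast
qed

lemma commutator_solve:
  assumes G: "a \<in> carrier G" "b \<in> carrier G" "e \<in> carrier G" and eq: "a \<otimes> b = e \<otimes> (b \<otimes> a)"
  shows "e = a \<otimes> b \<otimes> inv a \<otimes> inv b"
proof -
  have "a \<otimes> b \<otimes> inv a \<otimes> inv b = e \<otimes> (b \<otimes> a) \<otimes> inv (b \<otimes> a)"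
    using G by (simp add: eq[symmetric] inv_mult_group m_assoc)
  also have "\<dots> = e" using G by (simp add: m_assoc[of e])
  finally show ?thesis ..
qed

text \<open>The finiteness of an index will always be witnessed by a map with finite image whose fibres lie in single cosets:
  unlike a set of representatives, it restricts to subgroups and pulls back along homomorphisms.\<close>

lemma finite_rcosetsI:
  assumes H: "subgroup H G" and fin: "finite (\<phi> ` carrier G)"
    and sep: "\<And>x y. x \<in> carrier G \<Longrightarrow> y \<in> carrier G \<Longrightarrow> \<phi> x = \<phi> y \<Longrightarrow> x \<otimes> inv y \<in> H"
  shows "finite (rcosets H)"
proof -
  define r where "r a = (SOME x. x \<in> carrier G \<and> \<phi> x = a)" for a
  have "rcosets H \<subseteq> (\<lambda>a. H #> r a) ` (\<phi> ` carrier G)"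
  proof
    fix C assume "C \<in> rcosets H"
    then obtain x where x: "x \<in> carrier G" "C = H #> x" by (auto simp: RCOSETS_def)
    have "r (\<phi> x) \<in> carrier G \<and> \<phi> (r (\<phi> x)) = \<phi> x"
      unfolding r_def by (rule someI[of _ x]) (use x in auto)
    then have "H #> x = H #> r (\<phi> x)"
      using sep[of "r (\<phi> x)" x] x H
      by (intro repr_independence subgroup.rcos_module_rev[OF H is_group]) auto
    then show "C \<in> (\<lambda>a. H #> r a) ` (\<phi> ` carrier G)" using x by auto
  qed
  then show ?thesis using fin finite_subset by blast
qed

end

section \<open>Special linear groups over subrings of the reals\<close>

locale real_subring =
  fixes A :: "real set"
  assumes one_mem [simp]: "1 \<in> A"
    and add_mem: "x \<in> A \<Longrightarrow> y \<in> A \<Longrightarrow> x + y \<in> A"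
    and mult_mem: "x \<in> A \<Longrightarrow> y \<in> A \<Longrightarrow> x * y \<in> A"
    and minus_mem: "x \<in> A \<Longrightarrow> - x \<in> A"
begin

lemma zero_mem [simp]: "0 \<in> A"
  using add_mem[OF one_mem minus_mem[OF one_mem]] by simp

lemma diff_mem: "x \<in> A \<Longrightarrow> y \<in> A \<Longrightarrow> x - y \<in> A"
  using add_mem[OF _ minus_mem, of x y] by simp

lemma of_bool_mem: "of_bool b \<in> A"
  by (cases b) auto

lemma sum_mem: "(\<And>i. i \<in> I \<Longrightarrow> f i \<in> A) \<Longrightarrow> sum f I \<in> A"
  by (induction I rule: infinite_finite_induct) (auto intro: add_mem)

lemma prod_mem: "(\<And>i. i \<in> I \<Longrightarrow> f i \<in> A) \<Longrightarrow> prod f I \<in> A"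
  by (induction I rule: infinite_finite_induct) (auto intro: mult_mem)

lemma power_mem: "x \<in> A \<Longrightarrow> x ^ k \<in> A"
  by (induction k) (auto intro: mult_mem)

lemmas ring_mem = add_mem mult_mem minus_mem diff_mem of_bool_mem sum_mem prod_mem power_mem

lemma of_nat_mem: "of_nat k \<in> A"
  by (induction k) (auto intro: add_mem)

lemma of_int_mem: "of_int k \<in> A"
  by (cases k) (simp_all add: of_nat_mem minus_mem diff_mem)

lemma det_mem:
  assumes "M \<in> carrier_mat m m" "\<And>i j. i < m \<Longrightarrow> j < m \<Longrightarrow> M $$ (i, j) \<in> A"
  shows "det M \<in> A"
proof -
  have "(\<Prod>i = 0..<m. M $$ (i, p i)) \<in> A" if "p permutes {0..<m}" for p
    using assms that by (intro prod_mem) (auto simp: permutes_in_image)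
  then show ?thesis using assms(1)
    by (auto simp: det_def intro!: sum_mem mult_mem of_int_mem)
qed

end

lemma real_subring_UNIV: "real_subring UNIV"
  by unfold_locales auto

lemma SL_simps [simp]:
  "x \<otimes>\<^bsub>SL n R\<^esub> y = x * y" "\<one>\<^bsub>SL n R\<^esub> = 1\<^sub>m n"
  by (simp_all add: SL_def)

lemma SL_carrier:
  "M \<in> carrier (SL n R) \<longleftrightarrow>
     M \<in> carrier_mat n n \<and> (\<forall>i<n. \<forall>j<n. M $$ (i, j) \<in> R) \<and> det M = 1"
  by (auto simp: SL_def)

lemma SL_carrier_mat [dest]: "M \<in> carrier (SL n R) \<Longrightarrow> M \<in> carrier_mat n n"
  by (simp add: SL_carrier)

lemma mat_mult_index:
  assumes "M \<in> carrier_mat n n" "M' \<in> carrier_mat n n" "i < n" "j < n"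
  shows "(M * M') $$ (i, j) = (\<Sum>k = 0..<n. M $$ (i, k) * M' $$ (k, j))"
  using assms by (auto simp: scalar_prod_def)

context real_subring
begin

lemma adj_mat_SL:
  assumes "M \<in> carrier (SL n A)"
  shows "adj_mat M \<in> carrier (SL n A)" "adj_mat M * M = 1\<^sub>m n" "M * adj_mat M = 1\<^sub>m n"
proof -
  have M: "M \<in> carrier_mat n n" "det M = 1" "\<And>i j. i < n \<Longrightarrow> j < n \<Longrightarrow> M $$ (i, j) \<in> A"
    using assms by (auto simp: SL_carrier)
  note adj = adj_mat[OF M(1), unfolded M(2)]
  show l: "adj_mat M * M = 1\<^sub>m n" and "M * adj_mat M = 1\<^sub>m n" using adj by auto
  have "det (adj_mat M) * det M = 1"
    using l det_mult[OF adj(1) M(1)] by simp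
  then have "det (adj_mat M) = 1" using M by simp
  moreover have "adj_mat M $$ (i, j) \<in> A" if "i < n" "j < n" for i j
  proof -
    have "det (mat_delete M j i) \<in> A"
    proof (rule det_mem)
      show "mat_delete M j i \<in> carrier_mat (n - 1) (n - 1)" using M by (intro mat_delete_carrier) auto
    qed (use M that in \<open>auto simp: mat_delete_def\<close>)
    then show ?thesis using that M
      by (auto simp: adj_mat_def cofactor_def intro!: mult_mem power_mem minus_mem)
  qed
  ultimately show "adj_mat M \<in> carrier (SL n A)" using adj by (auto simp: SL_carrier)
qed

lemma group_SL: "group (SL n A)"
proof (rule groupI)
  fix x y assume xy: "x \<in> carrier (SL n A)" "y \<in> carrier (SL n A)"
  then have c: "x \<in> carrier_mat n n" "y \<in> carrier_mat n n" by auto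
  show "x \<otimes>\<^bsub>SL n A\<^esub> y \<in> carrier (SL n A)"
    unfolding SL_carrier
  proof (intro conjI allI impI)
    fix i j assume "i < n" "j < n"
    then show "(x \<otimes>\<^bsub>SL n A\<^esub> y) $$ (i, j) \<in> A"
      unfolding SL_simps mat_mult_index[OF c \<open>i < n\<close> \<open>j < n\<close>]
      using xy by (intro sum_mem mult_mem) (auto simp: SL_carrier)
  qed (use xy c in \<open>auto simp: SL_carrier det_mult\<close>)
next
  fix x assume "x \<in> carrier (SL n A)"
  then show "\<exists>y\<in>carrier (SL n A). y \<otimes>\<^bsub>SL n A\<^esub> x = \<one>\<^bsub>SL n A\<^esub>"
    using adj_mat_SL(1,2) by (intro bexI[of _ "adj_mat x"]) simp_all
next
  fix x y z assume "x \<in> carrier (SL n A)" "y \<in> carrier (SL n A)" "z \<in> carrier (SL n A)"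
  then show "x \<otimes>\<^bsub>SL n A\<^esub> y \<otimes>\<^bsub>SL n A\<^esub> z = x \<otimes>\<^bsub>SL n A\<^esub> (y \<otimes>\<^bsub>SL n A\<^esub> z)"
    by (auto simp: SL_carrier)
qed (auto simp: SL_carrier)

lemma inv_SL: "M \<in> carrier (SL n A) \<Longrightarrow> inv\<^bsub>SL n A\<^esub> M = adj_mat M"
  using group.inv_equality[OF group_SL] adj_mat_SL(1,2) by simp

lemma inv_SL_eq: "M \<in> carrier (SL n A) \<Longrightarrow> inv\<^bsub>SL n A\<^esub> M = inv\<^bsub>SL n UNIV\<^esub> M"
  using real_subring.inv_SL[OF real_subring_UNIV, of M n] by (auto simp: inv_SL SL_carrier)

lemma SL_subgroup: "subgroup (carrier (SL n A)) (SL n UNIV)"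
proof -
  interpret U: group "SL n UNIV" by (rule real_subring.group_SL[OF real_subring_UNIV])
  interpret S: group "SL n A" by (rule group_SL)
  show ?thesis
  proof (rule U.subgroupI)
    show "carrier (SL n A) \<noteq> {}" using S.one_closed by blast
    fix a b assume a: "a \<in> carrier (SL n A)" and b: "b \<in> carrier (SL n A)"
    show "inv\<^bsub>SL n UNIV\<^esub> a \<in> carrier (SL n A)" using S.inv_closed[OF a] inv_SL_eq[OF a] by simp
    show "a \<otimes>\<^bsub>SL n UNIV\<^esub> b \<in> carrier (SL n A)" using S.m_closed[OF a b] by simp
  qed (auto simp: SL_carrier)
qed

end

lemma SL_UNIV_group: "group (SL n UNIV)"
  by (rule real_subring.group_SL[OF real_subring_UNIV])

lemma SL_carrier_update: "SL n R = (SL n UNIV)\<lparr>carrier := carrier (SL n R)\<rparr>"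
  by (simp add: SL_def)

lemma (in real_subring) subgroup_SL_UNIV: "subgroup H (SL n A) \<Longrightarrow> subgroup H (SL n UNIV)"
  using group.incl_subgroup[OF SL_UNIV_group SL_subgroup] SL_carrier_update[of n A] by metis

section \<open>Transvections\<close>

text \<open>The matrix \<open>I + u v\<^sup>T\<close>. Vectors are functions on the natural numbers of which only the values below \<open>n\<close> matter.\<close>

definition transvection :: "nat \<Rightarrow> (nat \<Rightarrow> real) \<Rightarrow> (nat \<Rightarrow> real) \<Rightarrow> real mat" where
  "transvection n u v = mat n n (\<lambda>(i, j). of_bool (i = j) + u i * v j)"

abbreviation unit_fun :: "nat \<Rightarrow> nat \<Rightarrow> real" where
  "unit_fun k \<equiv> \<lambda>i. of_bool (i = k)"

definition dot :: "nat \<Rightarrow> (nat \<Rightarrow> real) \<Rightarrow> (nat \<Rightarrow> real) \<Rightarrow> real" where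
  "dot n v u = (\<Sum>k = 0..<n. v k * u k)"

lemma transvection_carrier [simp]: "transvection n u v \<in> carrier_mat n n"
  and transvection_dim [simp]: "dim_row (transvection n u v) = n" "dim_col (transvection n u v) = n"
  and transvection_index [simp]:
    "i < n \<Longrightarrow> j < n \<Longrightarrow> transvection n u v $$ (i, j) = of_bool (i = j) + u i * v j"
  by (simp_all add: transvection_def)

lemma transvection_cong:
  assumes "\<And>i j. i < n \<Longrightarrow> j < n \<Longrightarrow> u i * v j = u' i * v' j"
  shows "transvection n u v = transvection n u' v'"
  by (rule eq_matI) (use assms in auto)

lemma elem_mat_transvection:
  assumes "i < n" "j < n"
  shows "elem_mat n i j t = transvection n (unit_fun i) (\<lambda>l. t * unit_fun j l)"
    "elem_mat n i j t = transvection n (\<lambda>k. t * unit_fun i k) (unit_fun j)"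
  by (rule eq_matI; use assms in \<open>auto simp: elem_mat_def matrix_unit_def\<close>)+

lemma dot_unit_fun [simp]:
  "k < n \<Longrightarrow> dot n (unit_fun k) u = u k" "k < n \<Longrightarrow> dot n v (unit_fun k) = v k"
proof -
  assume "k < n"
  then have "{0..<n} \<inter> {i. i = k} = {k}" by auto
  then show "dot n (unit_fun k) u = u k" "dot n v (unit_fun k) = v k"
    by (simp_all add: dot_def sum_of_bool_mult_eq sum_mult_of_bool_eq)
qed

lemma transvection_mult_index:
  assumes "i < n" "j < n"
  shows "(transvection n u v * transvection n u' v') $$ (i, j) =
    of_bool (i = j) + u i * v j + u' i * v' j + u i * dot n v u' * v' j"
proof -
  have "(transvection n u v * transvection n u' v') $$ (i, j) =
    (\<Sum>k = 0..<n. (of_bool (i = k) + u i * v k) * (of_bool (k = j) + u' k * v' j))"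
    using assms by (subst mat_mult_index[of _ n]) auto
  also have "\<dots> = (\<Sum>k = 0..<n. of_bool (k = i) * (of_bool (k = j) + u' k * v' j))
     + (\<Sum>k = 0..<n. of_bool (k = j) * (u i * v k)) + (\<Sum>k = 0..<n. u i * (v k * u' k) * v' j)"
    unfolding sum.distrib[symmetric] by (intro sum.cong refl) (auto simp: of_bool_def algebra_simps)
  also have "(\<Sum>k = 0..<n. of_bool (k = i) * (of_bool (k = j) + u' k * v' j)) =
      of_bool (i = j) + u' i * v' j"
    using assms by (simp add: dot_unit_fun(1)[of i n "\<lambda>k. of_bool (k = j) + u' k * v' j", unfolded dot_def])
  also have "(\<Sum>k = 0..<n. of_bool (k = j) * (u i * v k)) = u i * v j"
    using assms by (simp add: dot_unit_fun(1)[of j n "\<lambda>k. u i * v k", unfolded dot_def])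
  also have "(\<Sum>k = 0..<n. u i * (v k * u' k) * v' j) = u i * dot n v u' * v' j"
    by (simp add: dot_def sum_distrib_left sum_distrib_right)
  finally show ?thesis by simp
qed

lemma transvection_mult_same_left:
  assumes "dot n v u = 0"
  shows "transvection n u v * transvection n u v' = transvection n u (\<lambda>j. v j + v' j)"
  by (rule eq_matI) (use assms in \<open>auto simp: transvection_mult_index distrib_left distrib_right simp del: index_mult_mat(1)\<close>)

lemma transvection_mult_same_right:
  assumes "dot n v u' = 0"
  shows "transvection n u v * transvection n u' v = transvection n (\<lambda>i. u i + u' i) v"
  by (rule eq_matI) (use assms in \<open>auto simp: transvection_mult_index distrib_left distrib_right simp del: index_mult_mat(1)\<close>)

lemma transvection_zero: "(\<And>i j. i < n \<Longrightarrow> j < n \<Longrightarrow> u i * v j = 0) \<Longrightarrow> transvection n u v = 1\<^sub>m n"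
  by (rule eq_matI) auto

text \<open>Written without inverses: \<open>I + u v\<^sup>T\<close> is the commutator of \<open>I + u e\<^sub>k\<^sup>T\<close> and \<open>I + e\<^sub>k v\<^sup>T\<close> when \<open>u\<close> and \<open>v\<close> are
  orthogonal and vanish at \<open>k\<close>.\<close>

lemma transvection_commutator:
  assumes k: "k < n" and "u k = 0" "v k = 0" "dot n v u = 0"
  shows "transvection n u (unit_fun k) * transvection n (unit_fun k) v =
    transvection n u v * (transvection n (unit_fun k) v * transvection n u (unit_fun k))"
proof -
  have "transvection n u v * (transvection n (unit_fun k) v * transvection n u (unit_fun k))
     = (transvection n u v * transvection n (unit_fun k) v) * transvection n u (unit_fun k)"
    by (rule assoc_mult_mat[symmetric]) auto
  also have "transvection n u v * transvection n (unit_fun k) v = transvection n (\<lambda>i. u i + unit_fun k i) v"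
    using assms by (intro transvection_mult_same_right) simp
  also have "\<dots> * transvection n u (unit_fun k) =
     transvection n u (unit_fun k) * transvection n (unit_fun k) v"
    by (rule eq_matI) (use assms in \<open>auto simp: transvection_mult_index distrib_left distrib_right simp del: index_mult_mat(1)\<close>)
  finally show ?thesis ..
qed

lemma transvection_conj:
  assumes g: "g \<in> carrier_mat n n" "h \<in> carrier_mat n n" "g * h = 1\<^sub>m n"
  shows "g * transvection n u v * h =
    transvection n (\<lambda>i. \<Sum>k = 0..<n. g $$ (i, k) * u k) (\<lambda>j. \<Sum>k = 0..<n. v k * h $$ (k, j))"
proof (rule eq_matI)
  fix i j assume "i < dim_row (transvection n (\<lambda>i. \<Sum>k = 0..<n. g $$ (i, k) * u k) (\<lambda>j. \<Sum>k = 0..<n. v k * h $$ (k, j)))"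
    "j < dim_col (transvection n (\<lambda>i. \<Sum>k = 0..<n. g $$ (i, k) * u k) (\<lambda>j. \<Sum>k = 0..<n. v k * h $$ (k, j)))"
  then have ij: "i < n" "j < n" by auto
  let ?U = "\<lambda>i. \<Sum>k = 0..<n. g $$ (i, k) * u k"
  have gt: "(g * transvection n u v) $$ (i, l) = g $$ (i, l) + ?U i * v l" if "l < n" for l
  proof -
    have "(g * transvection n u v) $$ (i, l) = (\<Sum>k = 0..<n. g $$ (i, k) * (of_bool (k = l) + u k * v l))"
      using g ij that by (subst mat_mult_index[of _ n]) auto
    also have "\<dots> = dot n (\<lambda>k. g $$ (i, k)) (unit_fun l) + ?U i * v l"
      by (simp only: dot_def distrib_left sum.distrib sum_distrib_right mult.assoc)
    finally show ?thesis using that by simp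
  qed
  have "(g * transvection n u v * h) $$ (i, j) = (\<Sum>l = 0..<n. (g * transvection n u v) $$ (i, l) * h $$ (l, j))"
    using g ij by (subst mat_mult_index[of _ n]) auto
  also have "\<dots> = (\<Sum>l = 0..<n. g $$ (i, l) * h $$ (l, j)) + ?U i * (\<Sum>l = 0..<n. v l * h $$ (l, j))"
    by (simp add: gt distrib_right sum.distrib sum_distrib_left mult.assoc)
  also have "(\<Sum>l = 0..<n. g $$ (i, l) * h $$ (l, j)) = (g * h) $$ (i, j)"
    using g ij by (subst mat_mult_index[of _ n]) auto
  finally show "(g * transvection n u v * h) $$ (i, j) =
      transvection n ?U (\<lambda>j. \<Sum>k = 0..<n. v k * h $$ (k, j)) $$ (i, j)"
    using ij g by simp
qed (use g in auto)

lemma elem_mat_SL: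
  assumes "i < n" "j < n" "i \<noteq> j"
  shows "elem_mat n i j t \<in> carrier (SL n UNIV)"
proof -
  have tri: "det (elem_mat n i j t) = 1" if "i < j" "i < n" "j < n" for i j
  proof -
    have "upper_triangular (elem_mat n i j t)"
      using that by (auto simp: elem_mat_def matrix_unit_def upper_triangular_def)
    then have "det (elem_mat n i j t) = prod_list (diag_mat (elem_mat n i j t))"
      by (rule det_upper_triangular) (auto simp: elem_mat_def matrix_unit_def)
    also have "diag_mat (elem_mat n i j t) = map (\<lambda>i. 1) [0..<n]"
      using that by (auto simp: diag_mat_def elem_mat_def matrix_unit_def)
    finally show ?thesis by (simp add: map_replicate_const)
  qed
  have "det (elem_mat n i j t) = 1"
  proof (cases "i < j")
    case False
    have "transpose_mat (elem_mat n i j t) = elem_mat n j i t"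
      by (rule eq_matI) (auto simp: elem_mat_def matrix_unit_def)
    then show ?thesis using tri[of j i] False assms
      by (metis det_transpose linorder_neqE_nat elem_mat_transvection(1) transvection_carrier)
  qed (use tri assms in auto)
  then show ?thesis using assms by (auto simp: SL_carrier elem_mat_transvection)
qed

lemma (in real_subring) elem_mat_SL_ring:
  assumes "i < n" "j < n" "i \<noteq> j" "t \<in> A"
  shows "elem_mat n i j t \<in> carrier (SL n A)"
  using elem_mat_SL[OF assms(1-3), of t] assms
  by (auto simp: SL_carrier elem_mat_transvection intro!: ring_mem)

lemma elem_mat_mult:
  assumes "i < n" "j < n" "i \<noteq> j"
  shows "elem_mat n i j s * elem_mat n i j t = elem_mat n i j (s + t)"
  unfolding elem_mat_transvection[OF assms(1,2)]
  by (subst transvection_mult_same_left) (use assms in \<open>auto simp: algebra_simps intro: transvection_cong\<close>)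

text \<open>With \<open>X Y = Z (Y X)\<close> the matrix \<open>Z\<close> is the commutator of \<open>X\<close> and \<open>Y\<close>. In particular its determinant is \<open>1\<close>;
  this is how transvections are seen to lie in the special linear group.\<close>

lemma SL_commutator_mem:
  assumes H: "subgroup H (SL n UNIV)" and "X \<in> H" "Y \<in> H" and Z: "Z \<in> carrier_mat n n"
    and eq: "X * Y = Z * (Y * X)"
  shows "Z \<in> H"
proof -
  interpret U: group "SL n UNIV" by (rule SL_UNIV_group)
  interpret H: subgroup H "SL n UNIV" by (rule H)
  have YX: "Y * X \<in> H" using H.m_closed assms by auto
  then have c: "Y * X \<in> carrier (SL n UNIV)" by auto
  have i: "inv\<^bsub>SL n UNIV\<^esub> (Y * X) \<in> carrier (SL n UNIV)" using c by simp
  have "X * Y * inv\<^bsub>SL n UNIV\<^esub> (Y * X) = Z * ((Y * X) * inv\<^bsub>SL n UNIV\<^esub> (Y * X))"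
    unfolding eq using Z SL_carrier_mat[OF c] SL_carrier_mat[OF i] by (intro assoc_mult_mat)
  also have "(Y * X) * inv\<^bsub>SL n UNIV\<^esub> (Y * X) = 1\<^sub>m n" using U.r_inv[OF c] by simp
  finally have "Z = X * Y * inv\<^bsub>SL n UNIV\<^esub> (Y * X)" using Z by simp
  then show ?thesis
    using H.m_closed[OF H.m_closed[OF assms(2,3)] H.m_inv_closed[OF YX]] by simp
qed

lemma elem_mat_commutator:
  assumes "i < n" "j < n" "k < n" "i \<noteq> j" "i \<noteq> k" "j \<noteq> k"
  shows "elem_mat n i k s * elem_mat n k j t =
     elem_mat n i j (s * t) * (elem_mat n k j t * elem_mat n i k s)"
proof -
  have "elem_mat n i j (s * t) = transvection n (\<lambda>l. s * unit_fun i l) (\<lambda>l. t * unit_fun j l)"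
    unfolding elem_mat_transvection(1)[OF assms(1,2)] by (rule transvection_cong) simp
  moreover have "dot n (\<lambda>l. t * unit_fun j l) (\<lambda>l. s * unit_fun i l) = 0"
    using assms unfolding dot_def by (intro sum.neutral) auto
  ultimately show ?thesis
    using transvection_commutator[of k n "\<lambda>l. s * unit_fun i l" "\<lambda>l. t * unit_fun j l"] assms
    by (simp add: elem_mat_transvection(2)[of i n k] elem_mat_transvection(1)[of k n j])
qed

lemma third_index: "3 \<le> (n :: nat) \<Longrightarrow> \<exists>m<n. m \<noteq> i \<and> m \<noteq> j"
  by (intro exI[of _ "if i \<noteq> 0 \<and> j \<noteq> 0 then 0 else if i \<noteq> 1 \<and> j \<noteq> 1 then 1 else 2"]) auto

lemma row_transvection_mem:
  assumes H: "subgroup H (SL n UNIV)" and k: "k < n" and vk: "v k = 0"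
    and E: "\<And>l. l < n \<Longrightarrow> l \<noteq> k \<Longrightarrow> elem_mat n k l (v l) \<in> H"
  shows "transvection n (unit_fun k) v \<in> H"
proof -
  interpret H: subgroup H "SL n UNIV" by (rule H)
  have "m \<le> n \<Longrightarrow> transvection n (unit_fun k) (\<lambda>l. if l < m then v l else 0) \<in> H" for m
  proof (induction m)
    case 0
    have "transvection n (unit_fun k) (\<lambda>l. if l < 0 then v l else 0) = 1\<^sub>m n"
      by (rule transvection_zero) auto
    then show ?case using H.one_closed by simp
  next
    case (Suc m)
    let ?w = "\<lambda>m l. if l < m then v l else 0"
    have IH: "transvection n (unit_fun k) (?w m) \<in> H" using Suc by simp
    show ?case
    proof (cases "m = k")
      case True
      have "?w (Suc m) = ?w m" using True vk by (auto simp: less_Suc_eq)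
      then show ?thesis using IH by simp
    next
      case False
      have "transvection n (unit_fun k) (?w m) * elem_mat n k m (v m) =
          transvection n (unit_fun k) (\<lambda>l. ?w m l + v m * unit_fun m l)"
        using k vk Suc.prems
        by (subst elem_mat_transvection(1)) (auto intro!: transvection_mult_same_left)
      also have "(\<lambda>l. ?w m l + v m * unit_fun m l) = ?w (Suc m)" by (auto simp: less_Suc_eq)
      finally show ?thesis using H.m_closed[OF IH E[of m]] False Suc.prems by simp
    qed
  qed
  from this[of n] show ?thesis
    using transvection_cong[of n "unit_fun k" "\<lambda>l. if l < n then v l else 0" "unit_fun k" v] by simp
qed

lemma col_transvection_mem:
  assumes H: "subgroup H (SL n UNIV)" and k: "k < n" and uk: "u k = 0"
    and E: "\<And>l. l < n \<Longrightarrow> l \<noteq> k \<Longrightarrow> elem_mat n l k (u l) \<in> H"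
  shows "transvection n u (unit_fun k) \<in> H"
proof -
  interpret H: subgroup H "SL n UNIV" by (rule H)
  have "m \<le> n \<Longrightarrow> transvection n (\<lambda>l. if l < m then u l else 0) (unit_fun k) \<in> H" for m
  proof (induction m)
    case 0
    have "transvection n (\<lambda>l. if l < 0 then u l else 0) (unit_fun k) = 1\<^sub>m n"
      by (rule transvection_zero) auto
    then show ?case using H.one_closed by simp
  next
    case (Suc m)
    let ?w = "\<lambda>m l. if l < m then u l else 0"
    have IH: "transvection n (?w m) (unit_fun k) \<in> H" using Suc by simp
    show ?case
    proof (cases "m = k")
      case True
      have "?w (Suc m) = ?w m" using True uk by (auto simp: less_Suc_eq)
      then show ?thesis using IH by simp
    next
      case False
      have "transvection n (?w m) (unit_fun k) * elem_mat n m k (u m) =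
          transvection n (\<lambda>l. ?w m l + u m * unit_fun m l) (unit_fun k)"
        using k uk Suc.prems False
        by (subst elem_mat_transvection(2)) (auto intro!: transvection_mult_same_right)
      also have "(\<lambda>l. ?w m l + u m * unit_fun m l) = ?w (Suc m)" by (auto simp: less_Suc_eq)
      finally show ?thesis using H.m_closed[OF IH E[of m]] False Suc.prems by simp
    qed
  qed
  from this[of n] show ?thesis
    using transvection_cong[of n "\<lambda>l. if l < n then u l else 0" "unit_fun k" u "unit_fun k"] by simp
qed

section \<open>Transvections along unimodular columns\<close>

text \<open>If \<open>z\<close> is supported on two coordinates where \<open>w\<close> vanishes, then \<open>I + w z\<^sup>T\<close> is a product of elementary matrices,
  column by column.\<close>

lemma disjoint_support_transvection_mem:
  assumes H: "subgroup H (SL n UNIV)" and kl: "k < n" "l < n" "k \<noteq> l" and w: "w k = 0" "w l = 0"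
    and z: "\<And>j. j < n \<Longrightarrow> j \<noteq> k \<Longrightarrow> j \<noteq> l \<Longrightarrow> z j = 0"
    and E: "\<And>i j. i < n \<Longrightarrow> j < n \<Longrightarrow> i \<noteq> j \<Longrightarrow> j \<in> {k, l} \<Longrightarrow> elem_mat n i j (w i * z j) \<in> H"
  shows "transvection n w z \<in> H"
proof -
  interpret H: subgroup H "SL n UNIV" by (rule H)
  have "transvection n (\<lambda>i. w i * z k) (unit_fun k) * transvection n (\<lambda>i. w i * z l) (unit_fun l)
     = transvection n w z"
  proof (rule eq_matI)
    fix i j assume "i < dim_row (transvection n w z)" "j < dim_col (transvection n w z)"
    then have ij: "i < n" "j < n" by auto
    have "w i * z j = w i * z k * of_bool (j = k) + w i * z l * of_bool (j = l)"
      using z[of j] ij kl by auto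
    then show "(transvection n (\<lambda>i. w i * z k) (unit_fun k) * transvection n (\<lambda>i. w i * z l) (unit_fun l)) $$ (i, j)
        = transvection n w z $$ (i, j)"
      using ij kl w by (simp add: transvection_mult_index del: index_mult_mat(1))
  qed auto
  moreover have "transvection n (\<lambda>i. w i * z k) (unit_fun k) \<in> H"
    by (rule col_transvection_mem[OF H]) (use kl w E in auto)
  moreover have "transvection n (\<lambda>i. w i * z l) (unit_fun l) \<in> H"
    by (rule col_transvection_mem[OF H]) (use kl w E in auto)
  ultimately show ?thesis using H.m_closed by (metis SL_simps(1))
qed

lemma sum_transvection_mem:
  assumes H: "subgroup H (SL n UNIV)" and "finite F"
    and "\<And>p. p \<in> F \<Longrightarrow> dot n (z p) u = 0" "\<And>p. p \<in> F \<Longrightarrow> transvection n u (z p) \<in> H"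
  shows "transvection n u (\<lambda>j. \<Sum>p\<in>F. z p j) \<in> H"
  using assms(2-4)
proof (induction F rule: finite_induct)
  case empty
  have "transvection n u (\<lambda>j. \<Sum>p\<in>{}. z p j) = 1\<^sub>m n" by (rule transvection_zero) simp
  then show ?case using subgroup.one_closed[OF H] by simp
next
  case (insert p F)
  have "transvection n u (z p) * transvection n u (\<lambda>j. \<Sum>p\<in>F. z p j) =
     transvection n u (\<lambda>j. z p j + (\<Sum>p\<in>F. z p j))"
    using insert by (intro transvection_mult_same_left) auto
  moreover have "transvection n u (z p) * transvection n u (\<lambda>j. \<Sum>p\<in>F. z p j) \<in> H"
    using insert subgroup.m_closed[OF H, of "transvection n u (z p)"] by simp
  ultimately show ?case using insert by simp
qed

lemma dot_add: "dot n (\<lambda>j. v j + w j) u = dot n v u + dot n w u"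
  by (simp add: dot_def distrib_right sum.distrib)

lemma dot_scale: "dot n (\<lambda>j. c * v j) u = c * dot n v u" "dot n v (\<lambda>j. c * u j) = c * dot n v u"
  by (simp_all add: dot_def sum_distrib_left mult_ac)

text \<open>The Koszul vectors \<open>u\<^sub>k e\<^sub>l - u\<^sub>l e\<^sub>k\<close>: they are orthogonal to \<open>u\<close>, have only two nonzero coordinates, and, if \<open>u\<close> is
  unimodular, span all vectors orthogonal to \<open>u\<close>.\<close>

definition koszul :: "(nat \<Rightarrow> real) \<Rightarrow> nat \<Rightarrow> nat \<Rightarrow> nat \<Rightarrow> real" where
  "koszul u k l = (\<lambda>j. u k * unit_fun l j - u l * unit_fun k j)"

lemma dot_koszul: "k < n \<Longrightarrow> l < n \<Longrightarrow> dot n (koszul u k l) u = 0"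
proof -
  assume "k < n" "l < n"
  have "dot n (koszul u k l) u = dot n (\<lambda>j. u k * unit_fun l j) u + dot n (\<lambda>j. (- u l) * unit_fun k j) u"
    unfolding dot_add[symmetric] by (simp add: koszul_def)
  then show ?thesis using \<open>k < n\<close> \<open>l < n\<close> by (simp only: dot_scale dot_unit_fun) simp
qed

lemma koszul_decomposition:
  assumes "dot n w u = 1" "dot n v u = 0" "j < n"
  shows "v j = (\<Sum>(k, l)\<in>{0..<n} \<times> {0..<n}. w k * v l * koszul u k l j)"
proof -
  have "(\<Sum>(k, l)\<in>{0..<n} \<times> {0..<n}. w k * v l * koszul u k l j) =
      (\<Sum>k = 0..<n. \<Sum>l = 0..<n. w k * u k * (v l * unit_fun l j)) -
      (\<Sum>k = 0..<n. \<Sum>l = 0..<n. w k * unit_fun k j * (v l * u l))"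
    by (simp add: sum.cartesian_product koszul_def algebra_simps sum_subtractf split_def)
  also have "\<dots> = dot n w u * dot n v (unit_fun j) - dot n w (unit_fun j) * dot n v u"
    unfolding dot_def sum_product
    by (intro arg_cong2[where f = minus] sum.cong refl) (auto simp: of_bool_def)
  finally show ?thesis using assms by simp
qed

definition (in real_subring) ring_vector :: "nat \<Rightarrow> (nat \<Rightarrow> real) \<Rightarrow> bool" where
  "ring_vector n u \<longleftrightarrow> (\<forall>k<n. u k \<in> A)"

context real_subring
begin

text \<open>Suslin's argument. Split \<open>u\<close> into its part on the coordinates \<open>k, l\<close> and the rest. The rest and the Koszul vector
  have disjoint supports. For the first part the coordinate \<open>m\<close> is free, which is where \<open>n \<ge> 3\<close> enters, and the transvection is a
  commutator; both its entries carry a factor \<open>t\<close>, which explains the square.\<close>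

lemma koszul_transvection_mem:
  assumes H: "subgroup H (SL n UNIV)" and t: "t \<in> A"
    and E: "\<And>i j a. i < n \<Longrightarrow> j < n \<Longrightarrow> i \<noteq> j \<Longrightarrow> a \<in> A \<Longrightarrow> elem_mat n i j (t * a) \<in> H"
    and u: "ring_vector n u" and c: "c \<in> A"
    and klm: "k < n" "l < n" "m < n" "k \<noteq> l" "m \<noteq> k" "m \<noteq> l"
  shows "transvection n (\<lambda>i. t * t * u i) (\<lambda>j. c * koszul u k l j) \<in> H"
proof -
  interpret H: subgroup H "SL n UNIV" by (rule H)
  define z where "z = (\<lambda>j. c * koszul u k l j)"
  define u1 where "u1 = (\<lambda>i. if i = k \<or> i = l then u i else 0)"
  define u2 where "u2 = (\<lambda>i. if i = k \<or> i = l then 0 else u i)"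
  have uA: "u i \<in> A" if "i < n" for i using u that by (auto simp: ring_vector_def)
  have zA: "z j \<in> A" if "j < n" for j
    using uA klm c by (auto simp: z_def koszul_def intro!: ring_mem)
  have z0: "z j = 0" if "j \<noteq> k" "j \<noteq> l" for j using that by (simp add: z_def koszul_def)
  have zu: "dot n z u = 0" using klm by (simp add: z_def dot_scale dot_koszul)
  have zu1: "dot n z u1 = 0"
  proof -
    have "dot n z u1 = dot n z u"
      unfolding dot_def by (intro sum.cong refl) (use z0 in \<open>auto simp: u1_def\<close>)
    then show ?thesis using zu by simp
  qed
  have zu2: "dot n z u2 = 0"
    unfolding dot_def by (intro sum.neutral) (use z0 in \<open>auto simp: u2_def\<close>)
  have u1A: "u1 i \<in> A" "u2 i \<in> A" if "i < n" for i using uA that by (auto simp: u1_def u2_def)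
  have "transvection n (\<lambda>i. t * u1 i) (unit_fun m) \<in> H"
    by (rule col_transvection_mem[OF H]) (use klm E u1A in \<open>auto simp: u1_def\<close>)
  moreover have "transvection n (unit_fun m) (\<lambda>j. t * z j) \<in> H"
    by (rule row_transvection_mem[OF H]) (use klm E zA z0 in auto)
  ultimately have "transvection n (\<lambda>i. t * u1 i) (\<lambda>j. t * z j) \<in> H"
  proof (rule SL_commutator_mem[OF H])
    show "transvection n (\<lambda>i. t * u1 i) (unit_fun m) * transvection n (unit_fun m) (\<lambda>j. t * z j) =
      transvection n (\<lambda>i. t * u1 i) (\<lambda>j. t * z j) *
      (transvection n (unit_fun m) (\<lambda>j. t * z j) * transvection n (\<lambda>i. t * u1 i) (unit_fun m))"
      by (rule transvection_commutator) (use klm z0[of m] zu1 in \<open>simp_all add: dot_scale u1_def\<close>)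
  qed simp
  moreover have "transvection n (\<lambda>i. t * u1 i) (\<lambda>j. t * z j) = transvection n (\<lambda>i. t * t * u1 i) z"
    by (rule transvection_cong) simp
  moreover have "transvection n (\<lambda>i. t * t * u2 i) z \<in> H"
  proof (rule disjoint_support_transvection_mem[OF H klm(1,2,4)])
    fix i j assume "i < n" "j < n" "i \<noteq> j"
    then show "elem_mat n i j (t * t * u2 i * z j) \<in> H"
      using E[of i j "t * u2 i * z j"] mult_mem[OF mult_mem[OF t u1A(2)] zA, of i j]
      by (simp add: mult.assoc)
  qed (use z0 in \<open>auto simp: u2_def\<close>)
  moreover have "transvection n (\<lambda>i. t * t * u1 i) z * transvection n (\<lambda>i. t * t * u2 i) z =
      transvection n (\<lambda>i. t * t * u1 i + t * t * u2 i) z"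
    by (rule transvection_mult_same_right) (simp add: dot_scale zu2)
  moreover have "(\<lambda>i. t * t * u1 i + t * t * u2 i) = (\<lambda>i. t * t * u i)"
    by (auto simp: u1_def u2_def)
  ultimately show ?thesis unfolding z_def[symmetric] using H.m_closed by (metis SL_simps(1))
qed

lemma unimodular_transvection_mem:
  assumes n: "n \<ge> 3" and H: "subgroup H (SL n UNIV)" and t: "t \<in> A"
    and E: "\<And>i j a. i < n \<Longrightarrow> j < n \<Longrightarrow> i \<noteq> j \<Longrightarrow> a \<in> A \<Longrightarrow> elem_mat n i j (t * a) \<in> H"
    and u: "ring_vector n u" and v: "ring_vector n v" and w: "ring_vector n w" and wu: "dot n w u = 1" and vu: "dot n v u = 0"
  shows "transvection n (\<lambda>i. t * t * u i) v \<in> H"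
proof -
  let ?z = "\<lambda>(k, l) j. w k * v l * koszul u k l j"
  have "transvection n (\<lambda>i. t * t * u i) (\<lambda>j. \<Sum>p\<in>{0..<n} \<times> {0..<n}. ?z p j) \<in> H"
  proof (rule sum_transvection_mem[OF H])
    fix p assume "p \<in> {0..<n} \<times> {0..<n}"
    then obtain k l where p: "p = (k, l)" "k < n" "l < n" by auto
    show "dot n (?z p) (\<lambda>i. t * t * u i) = 0" using p by (simp add: dot_scale dot_koszul)
    show "transvection n (\<lambda>i. t * t * u i) (?z p) \<in> H"
    proof (cases "k = l")
      case True
      then have "transvection n (\<lambda>i. t * t * u i) (?z p) = 1\<^sub>m n"
        using p by (intro transvection_zero) (auto simp: koszul_def)
      then show ?thesis using subgroup.one_closed[OF H] by simp
    next
      case False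
      obtain m where "m < n" "m \<noteq> k" "m \<noteq> l" using third_index[OF n] by blast
      then show ?thesis
        using koszul_transvection_mem[OF H t E u, of "w k * v l" k l m] p v w False
        by (auto simp: ring_vector_def intro: mult_mem)
    qed
  qed simp
  moreover have "transvection n (\<lambda>i. t * t * u i) (\<lambda>j. \<Sum>p\<in>{0..<n} \<times> {0..<n}. ?z p j) =
     transvection n (\<lambda>i. t * t * u i) v"
    by (rule transvection_cong) (simp add: koszul_decomposition[OF wu vu] split_def)
  ultimately show ?thesis by simp
qed

text \<open>The columns of a matrix in \<open>SL(n, A)\<close> are unimodular, so this set contains all conjugates of the \<open>E\<^sub>i\<^sub>j(s a)\<close>. A description
  by vectors instead of conjugating matrices makes normality immediate and is what Suslin's argument works on.\<close>

definition transvection_gens :: "nat \<Rightarrow> real \<Rightarrow> real mat set" where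
  "transvection_gens n s = {transvection n (\<lambda>i. s * u i) v | u v.
     ring_vector n u \<and> ring_vector n v \<and> (\<exists>w. ring_vector n w \<and> dot n w u = 1) \<and> dot n v u = 0}"

definition transvection_group :: "nat \<Rightarrow> real \<Rightarrow> real mat set" where
  "transvection_group n s = generate (SL n A) (transvection_gens n s)"

lemma unimodular_transvection_SL:
  assumes n: "n \<ge> 3" and u: "ring_vector n u" and v: "ring_vector n v" and w: "ring_vector n w" "dot n w u = 1" "dot n v u = 0"
  shows "transvection n u v \<in> carrier (SL n A)"
  using unimodular_transvection_mem[OF n SL_subgroup one_mem _ u v w] elem_mat_SL_ring by simp

lemma transvection_gens_subset:
  assumes n: "n \<ge> 3" and s: "s \<in> A"
  shows "transvection_gens n s \<subseteq> carrier (SL n A)"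
proof
  fix X assume "X \<in> transvection_gens n s"
  then obtain u v w where X: "X = transvection n (\<lambda>i. s * u i) v" and uvw: "ring_vector n u" "ring_vector n v" "ring_vector n w"
     "dot n w u = 1" "dot n v u = 0" by (auto simp: transvection_gens_def)
  have "X = transvection n u (\<lambda>j. s * v j)" unfolding X by (rule transvection_cong) simp
  moreover have "ring_vector n (\<lambda>j. s * v j)" using uvw s by (auto simp: ring_vector_def intro: mult_mem)
  ultimately show "X \<in> carrier (SL n A)"
    using unimodular_transvection_SL[OF n uvw(1) _ uvw(3,4)] uvw(5) by (simp add: dot_scale)
qed

text \<open>This is what makes the finite index of \<open>transvection_group\<close> pass to \<open>H\<close>.\<close>

lemma transvection_group_subset:
  assumes n: "n \<ge> 3" and H: "subgroup H (SL n UNIV)" and t: "t \<in> A"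
    and E: "\<And>i j a. i < n \<Longrightarrow> j < n \<Longrightarrow> i \<noteq> j \<Longrightarrow> a \<in> A \<Longrightarrow> elem_mat n i j (t * a) \<in> H"
  shows "transvection_group n (t * t) \<subseteq> H"
proof
  interpret G: group "SL n A" by (rule group_SL)
  fix X assume "X \<in> transvection_group n (t * t)"
  then show "X \<in> H" unfolding transvection_group_def
  proof (induction rule: generate.induct)
    case (incl h)
    then show ?case using unimodular_transvection_mem[OF n H t E] by (auto simp: transvection_gens_def)
  next
    case (inv h)
    then have "h \<in> H" using unimodular_transvection_mem[OF n H t E] by (auto simp: transvection_gens_def)
    moreover have "h \<in> carrier (SL n A)" using inv transvection_gens_subset[OF n, of "t * t"] t
      by (auto intro: mult_mem)
    ultimately show ?case using subgroup.m_inv_closed[OF H] by (simp add: inv_SL_eq)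
  next
    case (eng h1 h2)
    then show ?case using subgroup.m_closed[OF H] by simp
  qed (use subgroup.one_closed[OF H] in simp)
qed

lemma transvection_group_normal:
  assumes n: "n \<ge> 3" and s: "s \<in> A"
  shows "transvection_group n s \<lhd> SL n A"
proof -
  interpret G: group "SL n A" by (rule group_SL)
  show ?thesis unfolding transvection_group_def
  proof (rule G.normal_generateI[OF transvection_gens_subset[OF n s]])
    fix X g assume X: "X \<in> transvection_gens n s" and g: "g \<in> carrier (SL n A)"
    define h where "h = inv\<^bsub>SL n A\<^esub> g"
    have h: "h \<in> carrier (SL n A)" using g by (simp add: h_def)
    have gh: "g * h = 1\<^sub>m n" "h * g = 1\<^sub>m n" using G.r_inv[OF g] G.l_inv[OF g] by (simp_all add: h_def)
    have gc: "g \<in> carrier_mat n n" and hc: "h \<in> carrier_mat n n" using g h by auto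
    obtain u v w where Xe: "X = transvection n (\<lambda>i. s * u i) v" and uvw: "ring_vector n u" "ring_vector n v" "ring_vector n w"
       "dot n w u = 1" "dot n v u = 0" using X by (auto simp: transvection_gens_def)
    define gu where "gu = (\<lambda>i. \<Sum>k = 0..<n. g $$ (i, k) * u k)"
    define mh where "mh = (\<lambda>v j. \<Sum>k = 0..<n. v k * h $$ (k, j))"
    have dots: "dot n (mh x) gu = dot n x u" for x
    proof -
      have "dot n (mh x) gu = (\<Sum>j = 0..<n. \<Sum>k = 0..<n. \<Sum>l = 0..<n. x k * h $$ (k, j) * (g $$ (j, l) * u l))"
        by (simp add: dot_def mh_def gu_def sum_product)
      also have "\<dots> = (\<Sum>k = 0..<n. \<Sum>j = 0..<n. \<Sum>l = 0..<n. x k * h $$ (k, j) * (g $$ (j, l) * u l))"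
        by (rule sum.swap)
      also have "\<dots> = (\<Sum>k = 0..<n. \<Sum>l = 0..<n. \<Sum>j = 0..<n. x k * h $$ (k, j) * (g $$ (j, l) * u l))"
        by (intro sum.cong refl sum.swap)
      also have "\<dots> = (\<Sum>k = 0..<n. \<Sum>l = 0..<n. x k * u l * (h * g) $$ (k, l))"
        by (intro sum.cong refl) (use mat_mult_index[OF hc gc] in \<open>simp add: sum_distrib_left mult_ac del: index_mult_mat(1)\<close>)
      also have "\<dots> = (\<Sum>k = 0..<n. x k * dot n u (unit_fun k))"
        unfolding gh dot_def sum_distrib_left
        by (intro sum.cong refl) (auto simp: of_bool_def)
      finally show ?thesis by (simp add: dot_def[of n x u])
    qed
    have gA: "g $$ (i, k) \<in> A" "h $$ (i, k) \<in> A" if "i < n" "k < n" for i k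
      using g h that by (simp_all add: SL_carrier)
    have "ring_vector n gu" "ring_vector n (mh v)" "ring_vector n (mh w)"
      unfolding ring_vector_def gu_def mh_def
      by (intro allI impI sum_mem mult_mem gA; use uvw(1-3) in \<open>simp add: ring_vector_def\<close>)+
    moreover have "g * X * h = transvection n (\<lambda>i. s * gu i) (mh v)"
      unfolding Xe transvection_conj[OF gc hc gh(1)] gu_def mh_def
      by (rule transvection_cong) (simp add: sum_distrib_left sum_distrib_right mult_ac)
    ultimately show "g \<otimes>\<^bsub>SL n A\<^esub> X \<otimes>\<^bsub>SL n A\<^esub> inv\<^bsub>SL n A\<^esub> g \<in> transvection_gens n s"
      unfolding h_def[symmetric] transvection_gens_def SL_simps
      using dots uvw(4,5) by (intro CollectI exI[of _ gu] exI[of _ "mh v"] conjI exI[of _ "mh w"]) simp_all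
  qed
qed

lemma transvection_group_subgroup_UNIV:
  assumes "n \<ge> 3" "s \<in> A"
  shows "subgroup (transvection_group n s) (SL n UNIV)"
  by (rule subgroup_SL_UNIV[OF normal_imp_subgroup[OF transvection_group_normal[OF assms]]])

lemma elem_mat_transvection_group:
  assumes "i < n" "j < n" "i \<noteq> j" "a \<in> A" "s \<in> A" "n \<ge> 3"
  shows "elem_mat n i j (s * a) \<in> transvection_group n s"
proof -
  have "elem_mat n i j (s * a) = transvection n (\<lambda>k. s * unit_fun i k) (\<lambda>l. a * unit_fun j l)"
    unfolding elem_mat_transvection(1)[OF assms(1,2)] by (rule transvection_cong) simp
  moreover have "ring_vector n (unit_fun i)" "ring_vector n (\<lambda>l. a * unit_fun j l)" "dot n (unit_fun i) (unit_fun i) = 1"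
    "dot n (\<lambda>l. a * unit_fun j l) (unit_fun i) = 0"
    using assms by (auto simp: ring_vector_def intro!: ring_mem)
  ultimately have "elem_mat n i j (s * a) \<in> transvection_gens n s"
    unfolding transvection_gens_def
    by (intro CollectI exI[of _ "unit_fun i"] exI[of _ "\<lambda>l. a * unit_fun j l"] conjI)
  then show ?thesis unfolding transvection_group_def by (rule generate.incl)
qed

end

section \<open>Principal congruence subgroups are central modulo transvections\<close>

context real_subring
begin

lemma transvection_group_coset_right_mult:
  assumes n: "n \<ge> 3" and s: "s \<in> A" and b: "b \<in> carrier (SL n A)" and k: "k \<in> transvection_group n s"
  shows "transvection_group n s #>\<^bsub>SL n A\<^esub> (b * k) = transvection_group n s #>\<^bsub>SL n A\<^esub> b"
proof -
  interpret G: group "SL n A" by (rule group_SL)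
  interpret K: normal "transvection_group n s" "SL n A" by (rule transvection_group_normal[OF n s])
  have kG: "k \<in> carrier (SL n A)" using k K.subset by auto
  define k' where "k' = b \<otimes>\<^bsub>SL n A\<^esub> k \<otimes>\<^bsub>SL n A\<^esub> inv\<^bsub>SL n A\<^esub> b"
  have k': "k' \<in> transvection_group n s" unfolding k'_def by (rule K.inv_op_closed2[OF b k])
  then have k'G: "k' \<in> carrier (SL n A)" using K.subset by auto
  have "b \<otimes>\<^bsub>SL n A\<^esub> k = k' \<otimes>\<^bsub>SL n A\<^esub> b"
    unfolding k'_def using b kG by (simp add: G.m_assoc del: SL_simps)
  then have "transvection_group n s #>\<^bsub>SL n A\<^esub> (b * k) = transvection_group n s #>\<^bsub>SL n A\<^esub> k' #>\<^bsub>SL n A\<^esub> b"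
    using G.coset_mult_assoc[OF K.subset k'G b] by simp
  then show ?thesis using G.coset_join2[OF k'G K.subgroup_axioms k'] by simp
qed

text \<open>The computation behind centrality. For \<open>u \<equiv> e\<^sub>i\<close> and \<open>v \<equiv> e\<^sub>j\<close> modulo \<open>s\<close>, the Koszul decomposition of \<open>v\<close> has a single term
  that does not vanish modulo \<open>s\<close>, the one of the pair \<open>(i, j)\<close>; all other terms together give an element of the
  transvection group. The remaining transvection is, up to another such element, a commutator \<open>Z = [X, Y]\<close> in which \<open>X\<close> and \<open>Y\<close> are
  congruent to \<open>E\<^sub>i\<^sub>m(1)\<close> and \<open>E\<^sub>m\<^sub>j(x)\<close>. The conclusion records \<open>X\<close>, \<open>Y\<close>, \<open>Z\<close>, so that the commutator can be
  compared with \<open>[E\<^sub>i\<^sub>m(1), E\<^sub>m\<^sub>j(x)] = E\<^sub>i\<^sub>j(x)\<close> in the quotient group.\<close>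

lemma congruent_transvection_coset:
  assumes n: "n \<ge> 3" and s: "s \<in> A" and ij: "i < n" "j < n" "i \<noteq> j" and x: "x \<in> A"
    and u: "\<And>k. k < n \<Longrightarrow> \<exists>a\<in>A. u k = unit_fun i k + s * a"
    and v: "\<And>k. k < n \<Longrightarrow> \<exists>a\<in>A. v k = unit_fun j k + s * a"
    and w: "\<And>k. k < n \<Longrightarrow> \<exists>a\<in>A. w k = unit_fun i k + s * a"
    and wu: "dot n w u = 1" and vu: "dot n v u = 0"
  shows "\<exists>X\<in>carrier (SL n A). \<exists>Y\<in>carrier (SL n A). \<exists>Z\<in>carrier (SL n A). \<exists>\<kappa>\<in>transvection_group n s. \<exists>m<n.
     transvection n (\<lambda>k. x * u k) v = Z * \<kappa> \<and> X * Y = Z * (Y * X) \<and> m \<noteq> i \<and> m \<noteq> j \<and>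
     transvection_group n s #>\<^bsub>SL n A\<^esub> X = transvection_group n s #>\<^bsub>SL n A\<^esub> (elem_mat n i m 1) \<and>
     transvection_group n s #>\<^bsub>SL n A\<^esub> Y = transvection_group n s #>\<^bsub>SL n A\<^esub> (elem_mat n m j x)"
proof -
  let ?K = "transvection_group n s"
  interpret G: group "SL n A" by (rule group_SL)
  interpret K: normal ?K "SL n A" by (rule transvection_group_normal[OF n s])
  note KU = transvection_group_subgroup_UNIV[OF n s]
  obtain \<alpha> where \<alpha>: "\<And>k. k < n \<Longrightarrow> \<alpha> k \<in> A" "\<And>k. k < n \<Longrightarrow> u k = unit_fun i k + s * \<alpha> k"
    using u by metis
  obtain \<beta> where \<beta>: "\<And>k. k < n \<Longrightarrow> \<beta> k \<in> A" "\<And>k. k < n \<Longrightarrow> v k = unit_fun j k + s * \<beta> k"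
    using v by metis
  obtain \<gamma> where \<gamma>: "\<And>k. k < n \<Longrightarrow> \<gamma> k \<in> A" "\<And>k. k < n \<Longrightarrow> w k = unit_fun i k + s * \<gamma> k"
    using w by metis
  have uA: "u k \<in> A" and vA: "v k \<in> A" and wA: "w k \<in> A" if "k < n" for k
    using \<alpha> \<beta> \<gamma> s that by (auto intro!: add_mem mult_mem of_bool_mem)
  have EK: "elem_mat n k l (s * a) \<in> ?K" if "k < n" "l < n" "k \<noteq> l" "a \<in> A" for k l a
    using elem_mat_transvection_group[OF that s n] .
  define c where "c = w i * v j"
  define z where "z = (\<lambda>l. c * koszul u i j l)"
  have cA: "c \<in> A" using wA vA ij by (simp add: c_def mult_mem)
  have zu: "dot n z u = 0" using ij by (simp add: z_def dot_scale dot_koszul)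
  have z0: "z l = 0" if "l \<noteq> i" "l \<noteq> j" for l using that by (simp add: z_def koszul_def)
  have zA: "z l \<in> A" if "l < n" for l
    using that cA uA ij by (auto simp: z_def koszul_def intro!: ring_mem)
  \<comment> \<open>\<open>c \<equiv> 1\<close> modulo \<open>s\<close>, and \<open>cc\<close>, \<open>zi\<close>, \<open>zj\<close> are the quotients by \<open>s\<close> in \<open>c \<equiv> 1\<close>, \<open>z\<^sub>i \<equiv> 0\<close> and \<open>z\<^sub>j \<equiv> 1\<close>.\<close>
  define cc where "cc = \<gamma> i + \<beta> j + s * \<gamma> i * \<beta> j"
  have cc: "c = 1 + s * cc" "cc \<in> A"
    using \<beta>(2)[of j] \<gamma>(2)[of i] \<beta>(1)[of j] \<gamma>(1)[of i] ij s
    by (auto simp: c_def cc_def algebra_simps intro!: ring_mem)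
  define zi where "zi = - c * \<alpha> j"
  define zj where "zj = \<alpha> i + cc + s * cc * \<alpha> i"
  have zi: "z i = s * zi" "zi \<in> A"
    using \<alpha>(2)[of j] \<alpha>(1)[of j] ij cA by (auto simp: z_def zi_def koszul_def intro!: ring_mem)
  have zj: "z j = 1 + s * zj" "zj \<in> A"
    using \<alpha>(2)[of i] \<alpha>(1)[of i] ij cA s cc by (auto simp: z_def zj_def koszul_def algebra_simps intro!: ring_mem)
  define y where "y = (\<lambda>l. \<beta> l - (if l = i then zi else if l = j then zj else 0))"
  have yA: "y l \<in> A" if "l < n" for l using that \<beta> zi zj by (auto simp: y_def intro!: ring_mem)
  have vy: "v l = z l + s * y l" if "l < n" for l
    using \<beta>(2)[OF that] zi zj z0[of l] ij by (auto simp: y_def algebra_simps)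
  have syu: "dot n (\<lambda>l. s * y l) u = 0"
  proof -
    have "dot n v u = dot n (\<lambda>l. z l + s * y l) u"
      unfolding dot_def by (intro sum.cong refl) (simp add: vy)
    then show ?thesis using vu zu by (simp only: dot_add)
  qed
  have r1: "transvection n (\<lambda>k. x * u k) (\<lambda>l. s * y l) \<in> ?K"
  proof (cases "s = 0")
    case True
    then have "transvection n (\<lambda>k. x * u k) (\<lambda>l. s * y l) = 1\<^sub>m n" by (intro transvection_zero) simp
    then show ?thesis using K.one_closed by simp
  next
    case False
    have "transvection n (\<lambda>k. x * u k) (\<lambda>l. s * y l) = transvection n (\<lambda>k. s * u k) (\<lambda>l. x * y l)"
      by (rule transvection_cong) simp
    also have "\<dots> \<in> transvection_gens n s"
      unfolding transvection_gens_def
      using uA yA wA x wu syu False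
      by (intro CollectI exI[of _ u] exI[of _ "\<lambda>l. x * y l"] conjI exI[of _ w])
         (simp_all add: ring_vector_def mult_mem dot_scale)
    finally show ?thesis unfolding transvection_group_def by (rule generate.incl)
  qed
  \<comment> \<open>As for Koszul vectors: \<open>u2\<close> is divisible by \<open>s\<close>, and \<open>u1\<close> leaves the coordinate \<open>m\<close> free.\<close>
  define u1 where "u1 = (\<lambda>k. if k = i \<or> k = j then u k else 0)"
  define u2 where "u2 = (\<lambda>k. if k = i \<or> k = j then 0 else u k)"
  have zu1: "dot n z u1 = 0"
  proof -
    have "dot n z u1 = dot n z u"
      unfolding dot_def by (intro sum.cong refl) (use z0 in \<open>auto simp: u1_def\<close>)
    then show ?thesis using zu by simp
  qed
  have zu2: "dot n z u2 = 0"
    unfolding dot_def by (intro sum.neutral) (use z0 in \<open>auto simp: u2_def\<close>)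
  have r2: "transvection n (\<lambda>k. x * u2 k) z \<in> ?K"
  proof (rule disjoint_support_transvection_mem[OF KU ij])
    fix k l assume kl: "k < n" "l < n" "k \<noteq> l"
    define a where "a = (if k = i \<or> k = j then 0 else x * \<alpha> k * z l)"
    have "a \<in> A" using kl x zA \<alpha> by (auto simp: a_def intro!: mult_mem)
    moreover have "x * u2 k * z l = s * a" using \<alpha>(2)[of k] kl by (auto simp: u2_def a_def)
    ultimately show "elem_mat n k l (x * u2 k * z l) \<in> ?K" using EK kl by simp
  qed (use z0 in \<open>auto simp: u2_def\<close>)
  define Z where "Z = transvection n (\<lambda>k. x * u1 k) z"
  define \<kappa> where "\<kappa> = transvection n (\<lambda>k. x * u2 k) z * transvection n (\<lambda>k. x * u k) (\<lambda>l. s * y l)"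
  have \<kappa>: "\<kappa> \<in> ?K" unfolding \<kappa>_def using K.m_closed[OF r2 r1] by simp
  have "Z * transvection n (\<lambda>k. x * u2 k) z = transvection n (\<lambda>k. x * u1 k + x * u2 k) z"
    unfolding Z_def by (rule transvection_mult_same_right) (simp add: dot_scale zu2)
  also have "(\<lambda>k. x * u1 k + x * u2 k) = (\<lambda>k. x * u k)" by (auto simp: u1_def u2_def)
  finally have "Z * transvection n (\<lambda>k. x * u2 k) z * transvection n (\<lambda>k. x * u k) (\<lambda>l. s * y l) =
     transvection n (\<lambda>k. x * u k) (\<lambda>l. z l + s * y l)"
    using transvection_mult_same_left[of n z "\<lambda>k. x * u k"] by (simp add: dot_scale zu)
  also have "\<dots> = transvection n (\<lambda>k. x * u k) v" by (rule transvection_cong) (simp add: vy)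
  finally have dec: "transvection n (\<lambda>k. x * u k) v = Z * \<kappa>"
    unfolding \<kappa>_def by (subst assoc_mult_mat[symmetric]) (auto simp: Z_def)
  obtain m where m: "m < n" "m \<noteq> i" "m \<noteq> j" using third_index[OF n] by blast
  define X where "X = transvection n u1 (unit_fun m)"
  define Y where "Y = transvection n (unit_fun m) (\<lambda>l. x * z l)"
  define \<kappa>1 where "\<kappa>1 = transvection n (\<lambda>k. if k = i \<or> k = j then s * \<alpha> k else 0) (unit_fun m)"
  define \<kappa>2 where "\<kappa>2 = transvection n (unit_fun m) (\<lambda>l. if l = i then x * (s * zi) else if l = j then x * (s * zj) else 0)"
  have \<kappa>1: "\<kappa>1 \<in> ?K" unfolding \<kappa>1_def
    by (rule col_transvection_mem[OF KU m(1)]) (use m EK[of _ m 0] EK[of _ m] \<alpha> in auto)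
  have \<kappa>2: "\<kappa>2 \<in> ?K" unfolding \<kappa>2_def
  proof (rule row_transvection_mem[OF KU m(1)])
    fix l assume l: "l < n" "l \<noteq> m"
    define a where "a = (if l = i then x * zi else if l = j then x * zj else 0)"
    have "a \<in> A" using x zi zj by (auto simp: a_def intro!: mult_mem)
    moreover have "(if l = i then x * (s * zi) else if l = j then x * (s * zj) else 0) = s * a"
      by (simp add: a_def)
    ultimately show "elem_mat n m l (if l = i then x * (s * zi) else if l = j then x * (s * zj) else 0) \<in> ?K"
      using EK[of m l a] l m by simp
  qed (use m in auto)
  have "elem_mat n i m 1 * \<kappa>1 = transvection n (\<lambda>k. 1 * unit_fun i k + (if k = i \<or> k = j then s * \<alpha> k else 0)) (unit_fun m)"
    unfolding elem_mat_transvection(2)[OF ij(1) m(1)] \<kappa>1_def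
    by (rule transvection_mult_same_right) (use m in simp)
  also have "\<dots> = X" unfolding X_def
    by (rule transvection_cong) (use \<alpha>(2) in \<open>auto simp: u1_def ij\<close>)
  finally have X: "X = elem_mat n i m 1 * \<kappa>1" ..
  have "elem_mat n m j x * \<kappa>2 = transvection n (unit_fun m)
      (\<lambda>l. x * unit_fun j l + (if l = i then x * (s * zi) else if l = j then x * (s * zj) else 0))"
    unfolding elem_mat_transvection(1)[OF m(1) ij(2)] \<kappa>2_def
    by (rule transvection_mult_same_left) (use m in \<open>simp add: dot_scale\<close>)
  also have "\<dots> = Y" unfolding Y_def
    by (rule transvection_cong) (use ij zi zj z0 in \<open>auto simp: algebra_simps\<close>)
  finally have Y: "Y = elem_mat n m j x * \<kappa>2" ..
  have E1: "elem_mat n i m 1 \<in> carrier (SL n A)" using elem_mat_SL_ring m ij by simp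
  have E2: "elem_mat n m j x \<in> carrier (SL n A)" using elem_mat_SL_ring m ij x by simp
  have XS: "X \<in> carrier (SL n A)" unfolding X using G.m_closed[OF E1] \<kappa>1 K.subset by auto
  have YS: "Y \<in> carrier (SL n A)" unfolding Y using G.m_closed[OF E2] \<kappa>2 K.subset by auto
  have XYZ: "X * Y = Z * (Y * X)"
  proof -
    have "Z = transvection n u1 (\<lambda>l. x * z l)" unfolding Z_def by (rule transvection_cong) simp
    moreover have "u1 m = 0" using m by (simp add: u1_def)
    ultimately show ?thesis unfolding X_def Y_def
      using transvection_commutator[of m n u1 "\<lambda>l. x * z l"] m z0[of m] zu1 by (simp add: dot_scale)
  qed
  have ZS: "Z \<in> carrier (SL n A)"
    by (rule SL_commutator_mem[OF SL_subgroup XS YS _ XYZ]) (simp add: Z_def)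
  show ?thesis
    using XS YS ZS \<kappa> m dec XYZ transvection_group_coset_right_mult[OF n s E1 \<kappa>1] transvection_group_coset_right_mult[OF n s E2 \<kappa>2]
    unfolding X Y by blast
qed

text \<open>Here \<open>g E\<^sub>i\<^sub>j(x) g\<^sup>-\<^sup>1 = I + x u v\<^sup>T\<close> with \<open>u\<close> the column \<open>i\<close> of \<open>g\<close> and \<open>v\<close> the row \<open>j\<close> of \<open>g\<^sup>-\<^sup>1\<close>, and the row \<open>i\<close> of
  \<open>g\<^sup>-\<^sup>1\<close> witnesses that \<open>u\<close> is unimodular.\<close>

lemma congruence_commutes_elem_mat:
  assumes n: "n \<ge> 3" and s: "s \<in> A" and ij: "i < n" "j < n" "i \<noteq> j" and x: "x \<in> A"
    and g: "g \<in> carrier (SL n A)"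
    and cong: "\<And>k l. k < n \<Longrightarrow> l < n \<Longrightarrow> \<exists>a\<in>A. g $$ (k, l) = of_bool (k = l) + s * a"
  shows "transvection_group n s #>\<^bsub>SL n A\<^esub> (g * elem_mat n i j x) = transvection_group n s #>\<^bsub>SL n A\<^esub> (elem_mat n i j x * g)"
proof -
  let ?K = "transvection_group n s"
  let ?Q = "SL n A Mod ?K"
  interpret G: group "SL n A" by (rule group_SL)
  interpret K: normal ?K "SL n A" by (rule transvection_group_normal[OF n s])
  interpret Q: group ?Q by (rule K.factorgroup_is_group)
  define \<pi> where "\<pi> = (\<lambda>a. ?K #>\<^bsub>SL n A\<^esub> a)"
  have hom: "\<pi> \<in> hom (SL n A) ?Q" unfolding \<pi>_def by (rule K.r_coset_hom_Mod)
  have \<pi>m: "\<pi> (a * b) = \<pi> a \<otimes>\<^bsub>?Q\<^esub> \<pi> b" if "a \<in> carrier (SL n A)" "b \<in> carrier (SL n A)" for a b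
    using hom_mult[OF hom that] by simp
  have \<pi>c: "\<pi> a \<in> carrier ?Q" if "a \<in> carrier (SL n A)" for a
    using hom_in_carrier[OF hom that] .
  define h where "h = inv\<^bsub>SL n A\<^esub> g"
  have h: "h \<in> carrier (SL n A)" using g by (simp add: h_def)
  have gh: "g * h = 1\<^sub>m n" "h * g = 1\<^sub>m n" using G.r_inv[OF g] G.l_inv[OF g] by (simp_all add: h_def)
  have gc: "g \<in> carrier_mat n n" and hc: "h \<in> carrier_mat n n" using g h by auto
  have hcong: "\<exists>a\<in>A. h $$ (k, l) = of_bool (k = l) + s * a" if kl: "k < n" "l < n" for k l
  proof -
    have "\<forall>m\<in>{..<n}. \<exists>a. a \<in> A \<and> g $$ (m, l) = of_bool (m = l) + s * a"
      using cong[OF _ kl(2)] by blast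
    then obtain a where a: "\<And>m. m < n \<Longrightarrow> a m \<in> A" "\<And>m. m < n \<Longrightarrow> g $$ (m, l) = of_bool (m = l) + s * a m"
      using bchoice[of "{..<n}"] by (metis lessThan_iff)
    have "of_bool (k = l) = (h * g) $$ (k, l)" using gh kl by simp
    also have "\<dots> = (\<Sum>m = 0..<n. h $$ (k, m) * g $$ (m, l))" by (rule mat_mult_index[OF hc gc kl])
    also have "\<dots> = dot n (\<lambda>m. h $$ (k, m)) (unit_fun l) + s * (\<Sum>m = 0..<n. h $$ (k, m) * a m)"
      unfolding dot_def by (simp add: a distrib_left sum.distrib sum_distrib_left mult_ac)
    finally have "h $$ (k, l) = of_bool (k = l) + s * - (\<Sum>m = 0..<n. h $$ (k, m) * a m)"
      using kl by simp
    moreover have "- (\<Sum>m = 0..<n. h $$ (k, m) * a m) \<in> A"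
      using h a kl by (intro minus_mem sum_mem mult_mem) (auto simp: SL_carrier)
    ultimately show ?thesis by blast
  qed
  define u where "u = (\<lambda>k. g $$ (k, i))"
  define v where "v = (\<lambda>k. h $$ (j, k))"
  define w where "w = (\<lambda>k. h $$ (i, k))"
  have wu: "dot n w u = 1"
    using mat_mult_index[OF hc gc ij(1) ij(1)] gh ij by (simp add: dot_def u_def w_def)
  have vu: "dot n v u = 0"
    using mat_mult_index[OF hc gc ij(2) ij(1)] gh ij by (simp add: dot_def u_def v_def)
  let ?E = "elem_mat n i j x"
  have ES: "?E \<in> carrier (SL n A)" using elem_mat_SL_ring ij x by simp
  have uu: "\<exists>a\<in>A. u k = unit_fun i k + s * a" if "k < n" for k using cong[OF that ij(1)] by (simp add: u_def)
  have vv: "\<exists>a\<in>A. v k = unit_fun j k + s * a" if "k < n" for k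
    using hcong[OF ij(2) that] by (simp add: v_def eq_commute[of j])
  have ww: "\<exists>a\<in>A. w k = unit_fun i k + s * a" if "k < n" for k
    using hcong[OF ij(1) that] by (simp add: w_def eq_commute[of i])
  have conj: "g * ?E * h = transvection n (\<lambda>k. x * u k) v"
    unfolding elem_mat_transvection(2)[OF ij(1,2)] transvection_conj[OF gc hc gh(1)]
  proof (rule transvection_cong)
    fix k l assume kl: "k < n" "l < n"
    have "(\<Sum>m = 0..<n. g $$ (k, m) * (x * unit_fun i m)) = x * dot n (\<lambda>m. g $$ (k, m)) (unit_fun i)"
      unfolding dot_def sum_distrib_left by (intro sum.cong refl) (simp only: mult_ac)
    moreover have "(\<Sum>m = 0..<n. unit_fun j m * h $$ (m, l)) = dot n (unit_fun j) (\<lambda>m. h $$ (m, l))"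
      by (simp add: dot_def)
    ultimately show "(\<Sum>m = 0..<n. g $$ (k, m) * (x * unit_fun i m)) * (\<Sum>m = 0..<n. unit_fun j m * h $$ (m, l))
      = x * u k * v l" using ij by (simp add: u_def v_def)
  qed
  obtain X Y Z \<kappa> m where XYZ: "X \<in> carrier (SL n A)" "Y \<in> carrier (SL n A)" "Z \<in> carrier (SL n A)"
      "\<kappa> \<in> ?K" "m < n" "transvection n (\<lambda>k. x * u k) v = Z * \<kappa>" "X * Y = Z * (Y * X)" "m \<noteq> i" "m \<noteq> j"
      "\<pi> X = \<pi> (elem_mat n i m 1)" "\<pi> Y = \<pi> (elem_mat n m j x)"
    using congruent_transvection_coset[OF n s ij x uu vv ww wu vu] unfolding \<pi>_def by blast
  have E1: "elem_mat n i m 1 \<in> carrier (SL n A)" using elem_mat_SL_ring XYZ ij by simp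
  have E2: "elem_mat n m j x \<in> carrier (SL n A)" using elem_mat_SL_ring XYZ ij x by simp
  have YX: "Y * X \<in> carrier (SL n A)" using G.m_closed[OF XYZ(2,1)] by simp
  have EE: "elem_mat n m j x * elem_mat n i m 1 \<in> carrier (SL n A)" using G.m_closed[OF E2 E1] by simp
  have p1: "\<pi> X \<otimes>\<^bsub>?Q\<^esub> \<pi> Y = \<pi> Z \<otimes>\<^bsub>?Q\<^esub> (\<pi> Y \<otimes>\<^bsub>?Q\<^esub> \<pi> X)"
    using XYZ(7) \<pi>m[OF XYZ(1,2)] \<pi>m[OF XYZ(3) YX] \<pi>m[OF XYZ(2,1)] by simp
  have "elem_mat n i m 1 * elem_mat n m j x = ?E * (elem_mat n m j x * elem_mat n i m 1)"
    using elem_mat_commutator[of i n j m 1 x] ij XYZ by simp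
  then have p2: "\<pi> X \<otimes>\<^bsub>?Q\<^esub> \<pi> Y = \<pi> ?E \<otimes>\<^bsub>?Q\<^esub> (\<pi> Y \<otimes>\<^bsub>?Q\<^esub> \<pi> X)"
    using \<pi>m[OF E1 E2] \<pi>m[OF ES EE] \<pi>m[OF E2 E1] XYZ(10,11) by simp
  have "\<pi> Z = \<pi> ?E"
    using p1 p2 \<pi>c XYZ(1-3) ES by (metis Q.m_closed Q.right_cancel)
  moreover have "\<pi> (g * ?E * h) = \<pi> Z"
    unfolding conj XYZ(6) unfolding \<pi>_def by (rule transvection_group_coset_right_mult[OF n s XYZ(3,4)])
  moreover have gE: "g * ?E \<in> carrier (SL n A)" using G.m_closed[OF g ES] by simp
  moreover have "g * ?E * h * g = g * ?E"
  proof -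
    have "g * ?E * h * g = g * ?E * (h * g)" by (rule assoc_mult_mat) (use gE hc gc in auto)
    then show ?thesis unfolding gh using right_mult_one_mat[OF SL_carrier_mat[OF gE]] by simp
  qed
  moreover have "g * ?E * h \<in> carrier (SL n A)" using G.m_closed[OF gE h] by simp
  ultimately show ?thesis
    using \<pi>m[of "g * ?E * h" g] \<pi>m[OF ES g] g unfolding \<pi>_def by metis
qed

text \<open>The quotient by the transvection group of level \<open>t\<^sup>2\<close> is perfect, and congruence modulo \<open>t\<^sup>2\<close> has finitely many
  classes, each contained in a coset of the centre. The map \<open>\<rho>\<close> separates the residue classes modulo \<open>t\<^sup>2\<close>.\<close>

theorem elementary_subgroup_finite_index:
  fixes \<rho> :: "real \<Rightarrow> 'c"
  assumes n: "n \<ge> 3" and t: "t \<in> A"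
    and gen: "carrier (SL n A) = generate (SL n A) {elem_mat n i j a | i j a. i < n \<and> j < n \<and> i \<noteq> j \<and> a \<in> A}"
    and fin: "finite (\<rho> ` A)"
    and \<rho>: "\<And>x y. x \<in> A \<Longrightarrow> y \<in> A \<Longrightarrow> \<rho> x = \<rho> y \<Longrightarrow> \<exists>a\<in>A. x - y = t * t * a"
    and H: "subgroup H (SL n UNIV)"
    and E: "\<And>i j a. i < n \<Longrightarrow> j < n \<Longrightarrow> i \<noteq> j \<Longrightarrow> a \<in> A \<Longrightarrow> elem_mat n i j (t * a) \<in> H"
  shows "\<exists>\<phi> :: real mat \<Rightarrow> real mat set. finite (\<phi> ` carrier (SL n A)) \<and>
     (\<forall>x\<in>carrier (SL n A). \<forall>y\<in>carrier (SL n A). \<phi> x = \<phi> y \<longrightarrow> x * inv\<^bsub>SL n UNIV\<^esub> y \<in> H)"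
proof -
  define s where "s = t * t"
  have s: "s \<in> A" using t by (simp add: s_def mult_mem)
  let ?K = "transvection_group n s"
  let ?Q = "SL n A Mod ?K"
  let ?E = "{elem_mat n i j a | i j a. i < n \<and> j < n \<and> i \<noteq> j \<and> a \<in> A}"
  interpret G: group "SL n A" by (rule group_SL)
  interpret K: normal ?K "SL n A" by (rule transvection_group_normal[OF n s])
  interpret Q: group ?Q by (rule K.factorgroup_is_group)
  define \<pi> where "\<pi> = (\<lambda>a. ?K #>\<^bsub>SL n A\<^esub> a)"
  have hom: "\<pi> \<in> hom (SL n A) ?Q" unfolding \<pi>_def by (rule K.r_coset_hom_Mod)
  interpret \<pi>: group_hom "SL n A" ?Q \<pi> by unfold_locales (rule hom)
  have \<pi>m: "\<pi> (a * b) = \<pi> a \<otimes>\<^bsub>?Q\<^esub> \<pi> b" if "a \<in> carrier (SL n A)" "b \<in> carrier (SL n A)" for a b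
    using hom_mult[OF hom that] by simp
  have Qc: "carrier ?Q = \<pi> ` carrier (SL n A)"
    by (auto simp: FactGroup_def RCOSETS_def \<pi>_def)
  have EG: "?E \<subseteq> carrier (SL n A)" using elem_mat_SL_ring by auto
  have ind: "P x" if "x \<in> carrier (SL n A)" and "P (\<one>\<^bsub>SL n A\<^esub>)" and "\<And>e. e \<in> ?E \<Longrightarrow> P e"
    and "\<And>e. e \<in> ?E \<Longrightarrow> P (inv\<^bsub>SL n A\<^esub> e)"
    and "\<And>a b. a \<in> carrier (SL n A) \<Longrightarrow> b \<in> carrier (SL n A) \<Longrightarrow> P a \<Longrightarrow> P b \<Longrightarrow> P (a \<otimes>\<^bsub>SL n A\<^esub> b)" for P x
  proof -
    from that(1) have "x \<in> generate (SL n A) ?E" using gen by simp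
    then show ?thesis
      by (induction rule: generate.induct) (use that gen in auto)
  qed
  have central: "\<pi> g \<otimes>\<^bsub>?Q\<^esub> q = q \<otimes>\<^bsub>?Q\<^esub> \<pi> g"
    if g: "g \<in> carrier (SL n A)" and q: "q \<in> carrier ?Q"
      and cong: "\<And>k l. k < n \<Longrightarrow> l < n \<Longrightarrow> \<exists>a\<in>A. g $$ (k, l) = of_bool (k = l) + s * a" for g q
  proof -
    have "\<pi> g \<otimes>\<^bsub>?Q\<^esub> \<pi> x = \<pi> x \<otimes>\<^bsub>?Q\<^esub> \<pi> g" if x: "x \<in> carrier (SL n A)" for x
    proof (rule ind[OF x])
      have comm: "\<pi> g \<otimes>\<^bsub>?Q\<^esub> \<pi> e = \<pi> e \<otimes>\<^bsub>?Q\<^esub> \<pi> g" if "e \<in> ?E" for e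
      proof -
        have eS: "e \<in> carrier (SL n A)" using that EG by blast
        from that obtain i j a where e: "e = elem_mat n i j a" "i < n" "j < n" "i \<noteq> j" "a \<in> A" by blast
        have "\<pi> (g * e) = \<pi> (e * g)"
          unfolding \<pi>_def e(1) by (rule congruence_commutes_elem_mat[OF n s e(2-5) g cong])
        then show ?thesis using \<pi>m[OF g eS] \<pi>m[OF eS g] by simp
      qed
      then show "\<pi> g \<otimes>\<^bsub>?Q\<^esub> \<pi> e = \<pi> e \<otimes>\<^bsub>?Q\<^esub> \<pi> g" if "e \<in> ?E" for e using that .
      show "\<pi> g \<otimes>\<^bsub>?Q\<^esub> \<pi> (inv\<^bsub>SL n A\<^esub> e) = \<pi> (inv\<^bsub>SL n A\<^esub> e) \<otimes>\<^bsub>?Q\<^esub> \<pi> g" if "e \<in> ?E" for e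
        using comm[OF that] EG that g \<pi>.hom_closed
        by (smt (verit, best) Q.inv_closed Q.inv_solve_left Q.inv_solve_right Q.m_assoc Q.m_closed \<pi>.hom_inv subsetD)
      show "\<pi> g \<otimes>\<^bsub>?Q\<^esub> \<pi> \<one>\<^bsub>SL n A\<^esub> = \<pi> \<one>\<^bsub>SL n A\<^esub> \<otimes>\<^bsub>?Q\<^esub> \<pi> g"
        by (simp only: \<pi>.hom_one Q.l_one Q.r_one \<pi>.hom_closed[OF g])
      fix a b assume "a \<in> carrier (SL n A)" "b \<in> carrier (SL n A)"
        "\<pi> g \<otimes>\<^bsub>?Q\<^esub> \<pi> a = \<pi> a \<otimes>\<^bsub>?Q\<^esub> \<pi> g" "\<pi> g \<otimes>\<^bsub>?Q\<^esub> \<pi> b = \<pi> b \<otimes>\<^bsub>?Q\<^esub> \<pi> g"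
      then show "\<pi> g \<otimes>\<^bsub>?Q\<^esub> \<pi> (a \<otimes>\<^bsub>SL n A\<^esub> b) = \<pi> (a \<otimes>\<^bsub>SL n A\<^esub> b) \<otimes>\<^bsub>?Q\<^esub> \<pi> g"
        using g \<pi>.hom_closed by (metis Q.m_assoc \<pi>.hom_mult)
    qed
    then show ?thesis using q Qc by auto
  qed
  have "derived ?Q (carrier ?Q) = carrier ?Q"
  proof
    interpret D: subgroup "derived ?Q (carrier ?Q)" ?Q by (rule Q.derived_is_subgroup) simp
    show "derived ?Q (carrier ?Q) \<subseteq> carrier ?Q" by (rule D.subset)
    have gens: "\<pi> e \<in> derived ?Q (carrier ?Q)" if "e \<in> ?E" for e
    proof -
      from that obtain i j a where e: "e = elem_mat n i j a" "i < n" "j < n" "i \<noteq> j" "a \<in> A" by blast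
      obtain m where m: "m < n" "m \<noteq> i" "m \<noteq> j" using third_index[OF n] by blast
      let ?x = "elem_mat n i m 1" and ?y = "elem_mat n m j a"
      have x: "?x \<in> carrier (SL n A)" using e m by (intro elem_mat_SL_ring) auto
      have y: "?y \<in> carrier (SL n A)" using e m by (intro elem_mat_SL_ring) auto
      have eS: "e \<in> carrier (SL n A)" using EG that by auto
      have "?x * ?y = e * (?y * ?x)" using elem_mat_commutator[of i n j m 1 a] e m by simp
      then have eq: "\<pi> ?x \<otimes>\<^bsub>?Q\<^esub> \<pi> ?y = \<pi> e \<otimes>\<^bsub>?Q\<^esub> (\<pi> ?y \<otimes>\<^bsub>?Q\<^esub> \<pi> ?x)"
        using \<pi>m[OF x y] \<pi>m[OF y x] \<pi>m[OF eS, of "?y * ?x"] G.m_closed[OF y x] by simp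
      have "\<pi> e = \<pi> ?x \<otimes>\<^bsub>?Q\<^esub> \<pi> ?y \<otimes>\<^bsub>?Q\<^esub> inv\<^bsub>?Q\<^esub> \<pi> ?x \<otimes>\<^bsub>?Q\<^esub> inv\<^bsub>?Q\<^esub> \<pi> ?y"
        by (rule Q.commutator_solve[OF \<pi>.hom_closed[OF x] \<pi>.hom_closed[OF y] \<pi>.hom_closed[OF eS] eq])
      then show ?thesis
        unfolding derived_def using \<pi>.hom_closed[OF x] \<pi>.hom_closed[OF y] by (intro generate.incl) auto
    qed
    have "\<pi> x \<in> derived ?Q (carrier ?Q)" if x: "x \<in> carrier (SL n A)" for x
    proof (rule ind[OF x])
      show "\<pi> (inv\<^bsub>SL n A\<^esub> e) \<in> derived ?Q (carrier ?Q)" if "e \<in> ?E" for e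
        using D.m_inv_closed[OF gens[OF that]] \<pi>.hom_inv[OF subsetD[OF EG that]] by argo
      show "\<pi> (a \<otimes>\<^bsub>SL n A\<^esub> b) \<in> derived ?Q (carrier ?Q)" if "a \<in> carrier (SL n A)" "b \<in> carrier (SL n A)"
        "\<pi> a \<in> derived ?Q (carrier ?Q)" "\<pi> b \<in> derived ?Q (carrier ?Q)" for a b
        using D.m_closed[OF that(3,4)] \<pi>.hom_mult[OF that(1,2)] by argo
      show "\<pi> \<one>\<^bsub>SL n A\<^esub> \<in> derived ?Q (carrier ?Q)" by (simp only: \<pi>.hom_one D.one_closed)
    qed (rule gens)
    then show "carrier ?Q \<subseteq> derived ?Q (carrier ?Q)" using Qc by auto
  qed
  moreover
  \<comment> \<open>The matrix of residues, as a list. One representative for each such list covers the quotient modulo its centre.\<close>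
  define \<psi> where "\<psi> M = map (\<lambda>(i, j). \<rho> (M $$ (i, j))) (List.product [0..<n] [0..<n])" for M
  define rep where "rep p = (SOME M. M \<in> carrier (SL n A) \<and> \<psi> M = p)" for p
  have rep: "rep (\<psi> M) \<in> carrier (SL n A) \<and> \<psi> (rep (\<psi> M)) = \<psi> M" if "M \<in> carrier (SL n A)" for M
    unfolding rep_def by (rule someI[of _ M]) (use that in simp)
  have fin\<psi>: "finite (\<psi> ` carrier (SL n A))"
  proof (rule finite_subset)
    show "\<psi> ` carrier (SL n A) \<subseteq> {xs. set xs \<subseteq> \<rho> ` A \<and> length xs = n * n}"
      by (auto simp: \<psi>_def SL_carrier)
    show "finite {xs. set xs \<subseteq> \<rho> ` A \<and> length xs = n * n}" by (rule finite_lists_length_eq[OF fin])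
  qed
  define T where "T = (\<lambda>p. \<pi> (rep p)) ` \<psi> ` carrier (SL n A)"
  have "finite T" using fin\<psi> by (simp add: T_def)
  moreover have "T \<subseteq> carrier ?Q" using rep Qc by (auto simp: T_def)
  moreover have "\<exists>\<tau>\<in>T. \<exists>z\<in>carrier ?Q. q = \<tau> \<otimes>\<^bsub>?Q\<^esub> z \<and> (\<forall>h\<in>carrier ?Q. z \<otimes>\<^bsub>?Q\<^esub> h = h \<otimes>\<^bsub>?Q\<^esub> z)"
    if "q \<in> carrier ?Q" for q
  proof -
    from that obtain M where M: "M \<in> carrier (SL n A)" "q = \<pi> M" using Qc by auto
    define R where "R = rep (\<psi> M)"
    have R: "R \<in> carrier (SL n A)" "\<psi> R = \<psi> M" using rep[OF M(1)] by (auto simp: R_def)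
    define h where "h = inv\<^bsub>SL n A\<^esub> R"
    have h: "h \<in> carrier (SL n A)" "h * R = 1\<^sub>m n" "R * h = 1\<^sub>m n"
      using R G.l_inv[OF R(1)] G.r_inv[OF R(1)] by (simp_all add: h_def)
    have hM: "h * M \<in> carrier (SL n A)" using G.m_closed[OF h(1) M(1)] by simp
    have cm: "h \<in> carrier_mat n n" "M \<in> carrier_mat n n" "R \<in> carrier_mat n n" using h M R by auto
    have "R * (h * M) = M"
    proof -
      have "R * (h * M) = (R * h) * M" by (rule assoc_mult_mat[symmetric]) (use cm in auto)
      then show ?thesis using h cm by simp
    qed
    then have "q = \<pi> R \<otimes>\<^bsub>?Q\<^esub> \<pi> (h * M)" using \<pi>m[OF R(1) hM] M by simp
    moreover have "\<exists>a\<in>A. (h * M) $$ (k, l) = of_bool (k = l) + s * a" if kl: "k < n" "l < n" for k l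
    proof -
      have "\<exists>a\<in>A. M $$ (m, l) = R $$ (m, l) + s * a" if "m < n" for m
      proof -
        have "\<rho> (M $$ (m, l)) = \<rho> (R $$ (m, l))" using R(2) that kl by (auto simp: \<psi>_def)
        moreover have "M $$ (m, l) \<in> A" "R $$ (m, l) \<in> A"
          using M R that kl by (auto simp: SL_carrier)
        ultimately obtain a where "a \<in> A" "M $$ (m, l) - R $$ (m, l) = t * t * a"
          using \<rho> by blast
        then show ?thesis by (intro bexI[of _ a]) (auto simp: s_def algebra_simps)
      qed
      then obtain a where a: "\<And>m. m < n \<Longrightarrow> a m \<in> A" "\<And>m. m < n \<Longrightarrow> M $$ (m, l) = R $$ (m, l) + s * a m"
        by metis
      have "(h * M) $$ (k, l) = (\<Sum>m = 0..<n. h $$ (k, m) * M $$ (m, l))"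
        by (rule mat_mult_index[OF cm(1,2) kl])
      also have "\<dots> = (\<Sum>m = 0..<n. h $$ (k, m) * R $$ (m, l)) + s * (\<Sum>m = 0..<n. h $$ (k, m) * a m)"
        by (simp add: a distrib_left sum.distrib sum_distrib_left mult_ac)
      also have "(\<Sum>m = 0..<n. h $$ (k, m) * R $$ (m, l)) = (h * R) $$ (k, l)"
        by (rule mat_mult_index[OF cm(1,3) kl, symmetric])
      also have "\<dots> = of_bool (k = l)" unfolding h(2) using kl by simp
      finally have "(h * M) $$ (k, l) = of_bool (k = l) + s * (\<Sum>m = 0..<n. h $$ (k, m) * a m)" .
      moreover have "(\<Sum>m = 0..<n. h $$ (k, m) * a m) \<in> A"
        using a h(1) kl by (intro sum_mem mult_mem) (auto simp: SL_carrier)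
      ultimately show ?thesis by blast
    qed
    ultimately show ?thesis
      using central[OF hM] M(1) \<pi>.hom_closed[OF hM]
      by (intro bexI[of _ "\<pi> R"] bexI[of _ "\<pi> (h * M)"] conjI) (auto simp: T_def R_def)
  qed
  ultimately have "finite (carrier ?Q)"
    by (rule Q.finite_if_perfect_and_centre_finite_index)
  then have "finite (\<pi> ` carrier (SL n A))" by (simp add: Qc)
  moreover have "x * inv\<^bsub>SL n UNIV\<^esub> y \<in> H"
    if xy: "x \<in> carrier (SL n A)" "y \<in> carrier (SL n A)" "\<pi> x = \<pi> y" for x y
  proof -
    have "x \<in> ?K #>\<^bsub>SL n A\<^esub> y"
      using xy G.rcos_self[OF xy(1) K.subgroup_axioms] by (simp add: \<pi>_def)
    then have "x \<otimes>\<^bsub>SL n A\<^esub> inv\<^bsub>SL n A\<^esub> y \<in> ?K"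
      by (rule K.rcos_module_imp[OF group_SL xy(2)])
    then show ?thesis
      using transvection_group_subset[OF n H t E] inv_SL_eq[OF xy(2)] by (auto simp: s_def)
  qed
  ultimately show ?thesis by blast
qed

end

section \<open>Elimination over Z[1/N]\<close>

lemma Z_invI: "of_int a / of_int N ^ k \<in> Z_inv N"
  by (auto simp: Z_inv_def)

lemma real_subring_Z_inv:
  assumes "N \<noteq> 0"
  shows "real_subring (Z_inv N)"
proof
  show "1 \<in> Z_inv N" using Z_invI[of 1 N 0] by simp
  fix x y assume "x \<in> Z_inv N" "y \<in> Z_inv N"
  then obtain a k b l where x: "x = of_int a / of_int N ^ k" and y: "y = of_int b / of_int N ^ l"
    by (auto simp: Z_inv_def)
  have "x + y = of_int (a * N ^ l + b * N ^ k) / of_int N ^ (k + l)"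
    using assms by (simp add: x y field_simps power_add)
  then show "x + y \<in> Z_inv N" by (metis Z_invI)
  have "x * y = of_int (a * b) / of_int N ^ (k + l)" by (simp add: x y power_add)
  then show "x * y \<in> Z_inv N" by (metis Z_invI)
next
  fix x assume "x \<in> Z_inv N"
  then obtain a k where "x = of_int a / of_int N ^ k" by (auto simp: Z_inv_def)
  then have "- x = of_int (- a) / of_int N ^ k" by simp
  then show "- x \<in> Z_inv N" by (metis Z_invI)
qed

lemma transvection_mult_mat_index:
  assumes "M \<in> carrier_mat n n" "k < n" "l < n"
  shows "(transvection n u v * M) $$ (k, l) = M $$ (k, l) + u k * dot n v (\<lambda>m. M $$ (m, l))"
proof -
  have "(transvection n u v * M) $$ (k, l) = (\<Sum>m = 0..<n. (of_bool (m = k) + u k * v m) * M $$ (m, l))"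
    using assms by (subst mat_mult_index[of _ n]) (auto simp: of_bool_def intro!: sum.cong)
  also have "\<dots> = dot n (unit_fun k) (\<lambda>m. M $$ (m, l)) + u k * dot n v (\<lambda>m. M $$ (m, l))"
    by (simp only: dot_def distrib_right sum.distrib sum_distrib_left mult.assoc)
  finally show ?thesis using assms by simp
qed

lemma elem_mat_mult_index:
  assumes "M \<in> carrier_mat n n" "i < n" "j < n" "k < n" "l < n"
  shows "(elem_mat n i j x * M) $$ (k, l) = M $$ (k, l) + of_bool (k = i) * (x * M $$ (j, l))"
  unfolding elem_mat_transvection(2)[OF assms(2,3)] transvection_mult_mat_index[OF assms(1,4,5)]
  using assms by simp

text \<open>The state of the elimination after \<open>c\<close> columns.\<close>

definition id_columns :: "nat \<Rightarrow> nat \<Rightarrow> real mat \<Rightarrow> bool" where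
  "id_columns n c M \<longleftrightarrow> (\<forall>l<c. \<forall>k<n. M $$ (k, l) = of_bool (k = l))"

context
  fixes N :: int and n :: nat
  assumes N: "N \<noteq> 0"
begin

interpretation Z: real_subring "Z_inv N" by (rule real_subring_Z_inv[OF N])

private abbreviation (input) "G \<equiv> SL n (Z_inv N)"
private abbreviation (input) "EL \<equiv> {elem_mat n i j a | i j a. i < n \<and> j < n \<and> i \<noteq> j \<and> a \<in> Z_inv N}"
private abbreviation (input) "E \<equiv> generate G EL"

interpretation G: group G by (rule Z.group_SL)

lemma EL_subset: "EL \<subseteq> carrier G" using Z.elem_mat_SL_ring by auto

lemma E_subgroup: "subgroup E G" by (rule G.generate_is_subgroup[OF EL_subset])

interpretation E: subgroup E G by (rule E_subgroup)

lemma elem_E: "i < n \<Longrightarrow> j < n \<Longrightarrow> i \<noteq> j \<Longrightarrow> a \<in> Z_inv N \<Longrightarrow> elem_mat n i j a \<in> E"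
  by (rule generate.incl) blast

lemma row_op:
  assumes M: "M \<in> carrier G" "id_columns n c M" and ij: "i < n" "j < n" "i \<noteq> j" "c \<le> j"
    and a: "a \<in> Z_inv N"
  shows "elem_mat n i j a * M \<in> carrier G" "id_columns n c (elem_mat n i j a * M)"
    "\<And>k l. k < n \<Longrightarrow> l < n \<Longrightarrow> (elem_mat n i j a * M) $$ (k, l) =
       M $$ (k, l) + of_bool (k = i) * (a * M $$ (j, l))"
proof -
  show "elem_mat n i j a * M \<in> carrier G" using G.m_closed[OF Z.elem_mat_SL_ring M(1)] ij a by simp
  have idx: "(elem_mat n i j a * M) $$ (k, l) = M $$ (k, l) + of_bool (k = i) * (a * M $$ (j, l))"
    if "k < n" "l < n" for k l
    by (rule elem_mat_mult_index) (use M ij that in auto)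
  then show "\<And>k l. k < n \<Longrightarrow> l < n \<Longrightarrow> (elem_mat n i j a * M) $$ (k, l) =
       M $$ (k, l) + of_bool (k = i) * (a * M $$ (j, l))" by blast
  have "c \<le> n" using ij by simp
  then show "id_columns n c (elem_mat n i j a * M)"
    using M(2) ij by (auto simp: id_columns_def idx simp del: index_mult_mat(1))
qed

lemma mult_E:
  assumes "e \<in> E" "f \<in> E" "M \<in> carrier G"
  shows "e * f \<in> E" "(e * f) * M = e * (f * M)"
proof -
  show "e * f \<in> E" using E.m_closed[OF assms(1,2)] by simp
  show "(e * f) * M = e * (f * M)"
    using G.m_assoc[of e f M] assms E.subset by auto
qed

lemma E_compose:
  assumes "e \<in> E" "f \<in> E" "M \<in> carrier G" "P (e * (f * M))"
  shows "\<exists>g\<in>E. P (g * M)"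
  using mult_E[OF assms(1-3)] assms(4) by (intro bexI[of _ "e * f"]) simp_all

text \<open>Row operations with integer factors do not change the common denominator of a column, so the subtractive Euclidean algorithm runs on the
  integers \<open>z\<^sub>k\<close>. It decreases the sum of their absolute values until at most one of them is nonzero.\<close>

lemma euclid_column:
  assumes "M \<in> carrier G" "id_columns n c M" "c < n"
    and "\<And>k. k < n \<Longrightarrow> of_int N ^ m * M $$ (k, c) = of_int (z k)"
  shows "\<exists>e\<in>E. e * M \<in> carrier G \<and> id_columns n c (e * M) \<and>
     (\<exists>k\<in>{c..<n}. \<forall>l\<in>{c..<n}. l \<noteq> k \<longrightarrow> (e * M) $$ (l, c) = 0)"
  using assms
proof (induction "\<Sum>k\<in>{c..<n}. nat \<bar>z k\<bar>" arbitrary: M z rule: less_induct)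
  case less
  show ?case
  proof (cases "\<exists>k\<in>{c..<n}. \<forall>l\<in>{c..<n}. l \<noteq> k \<longrightarrow> M $$ (l, c) = 0")
    case True
    have "1\<^sub>m n * M = M" using less.prems(1) by (metis SL_carrier_mat left_mult_one_mat)
    moreover have "1\<^sub>m n \<in> E" using E.one_closed by simp
    ultimately show ?thesis using True less.prems(1,2) by (intro bexI[of _ "1\<^sub>m n"]) simp_all
  next
    case False
    have nz: "of_int N ^ m \<noteq> (0::real)" using N by simp
    from False less.prems(3) obtain l where l: "l \<in> {c..<n}" "M $$ (l, c) \<noteq> 0" by (metis atLeastLessThan_iff order_refl)
    with False obtain k where k: "k \<in> {c..<n}" "k \<noteq> l" "M $$ (k, c) \<noteq> 0" by metis
    have zz: "z k \<noteq> 0" "z l \<noteq> 0"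
      using less.prems(4)[of k] less.prems(4)[of l] k l nz by auto
    have step: ?thesis
      if kl: "k \<in> {c..<n}" "l \<in> {c..<n}" "k \<noteq> l" "z k \<noteq> 0" "z l \<noteq> 0" "\<bar>z l\<bar> \<le> \<bar>z k\<bar>" for k l
    proof -
      define a where "a = - sgn (z k) * sgn (z l)"
      define M' where "M' = elem_mat n k l (of_int a) * M"
      define z' where "z' = z(k := z k + a * z l)"
      have aA: "of_int a \<in> Z_inv N" by (rule Z.of_int_mem)
      have elA: "elem_mat n k l (of_int a) \<in> E" using kl aA by (intro elem_E) auto
      note ro = row_op[OF less.prems(1,2) _ _ kl(3) _ aA, folded M'_def]
      have M': "M' \<in> carrier G" "id_columns n c M'"
        using ro(1,2) kl by auto
      have idx: "M' $$ (i, c) = M $$ (i, c) + of_bool (i = k) * (of_int a * M $$ (l, c))" if "i < n" for i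
        using ro(3)[of i c] kl that less.prems(3) by auto
      have z': "of_int N ^ m * M' $$ (i, c) = of_int (z' i)" if "i < n" for i
        using less.prems(4)[OF that] less.prems(4)[of l] kl idx[OF that]
        by (auto simp: z'_def distrib_left mult.left_commute)
      have "\<bar>z' k\<bar> < \<bar>z k\<bar>"
        using kl by (auto simp: z'_def a_def sgn_if abs_if split: if_splits)
      then have "(\<Sum>i\<in>{c..<n}. nat \<bar>z' i\<bar>) < (\<Sum>i\<in>{c..<n}. nat \<bar>z i\<bar>)"
        using kl by (intro sum_strict_mono_ex1 bexI[of _ k] ballI) (auto simp: z'_def)
      then obtain e where e: "e \<in> E" "e * M' \<in> carrier G" "id_columns n c (e * M')"
         "\<exists>k\<in>{c..<n}. \<forall>l\<in>{c..<n}. l \<noteq> k \<longrightarrow> (e * M') $$ (l, c) = 0"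
        using less.hyps[OF _ M' less.prems(3) z'] by blast
      then show ?thesis
        using E_compose[OF e(1) elA less.prems(1), of "\<lambda>X. X \<in> carrier G \<and> id_columns n c X \<and>
          (\<exists>k\<in>{c..<n}. \<forall>l\<in>{c..<n}. l \<noteq> k \<longrightarrow> X $$ (l, c) = 0)"] unfolding M'_def by blast
    qed
    show ?thesis using step[of k l] step[of l k] k l zz by linarith
  qed
qed

text \<open>In the last column the entry is \<open>1\<close> because the determinant is. Otherwise the single entry left by the Euclidean
  algorithm is a unit of \<open>\<int>[1/N]\<close>, because an entry of the inverse matrix inverts it, and a second row below the pivot allows to
  change the unit into \<open>1\<close>.\<close>

lemma pivot_one:
  assumes M: "M \<in> carrier G" "id_columns n c M" and c: "c < n"
  shows "\<exists>e\<in>E. e * M \<in> carrier G \<and> id_columns n c (e * M) \<and> (e * M) $$ (c, c) = 1"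
proof (cases "Suc c = n")
  case True
  have Mc: "M \<in> carrier_mat n n" "det M = 1" using M by (auto simp: SL_carrier)
  have "upper_triangular M" using M(2) Mc True by (auto simp: id_columns_def upper_triangular_def)
  then have "1 = prod_list (diag_mat M)" using det_upper_triangular[of M n] Mc by simp
  also have "diag_mat M = map (\<lambda>i. M $$ (i, i)) ([0..<c] @ [c])" using Mc True by (auto simp: diag_mat_def)
  finally have "1 = prod_list (map (\<lambda>i. M $$ (i, i)) [0..<c]) * M $$ (c, c)" by simp
  moreover have "map (\<lambda>i. M $$ (i, i)) [0..<c] = map (\<lambda>i. 1) [0..<c]"
    using M(2) True by (auto simp: id_columns_def)
  ultimately have "M $$ (c, c) = 1" by (simp add: map_replicate_const)
  moreover have "1\<^sub>m n * M = M" using Mc by simp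
  moreover have "1\<^sub>m n \<in> E" using E.one_closed by simp
  ultimately show ?thesis using M by (intro bexI[of _ "1\<^sub>m n"]) simp_all
next
  case False
  have "\<exists>a k. M $$ (i, c) = of_int a / of_int N ^ k" if "i < n" for i
    using M c that by (auto simp: SL_carrier Z_inv_def)
  then have "\<forall>i\<in>{..<n}. \<exists>p. M $$ (i, c) = of_int (fst p) / of_int N ^ (snd p)" by force
  then obtain p where p: "\<And>i. i < n \<Longrightarrow> M $$ (i, c) = of_int (fst (p i)) / of_int N ^ (snd (p i))"
    using bchoice[of "{..<n}"] by (metis lessThan_iff)
  define m where "m = (\<Sum>i<n. snd (p i))"
  have z: "of_int N ^ m * M $$ (k, c) = of_int (fst (p k) * N ^ (m - snd (p k)))" if k: "k < n" for k
  proof -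
    have "snd (p k) \<le> m" unfolding m_def using k by (intro member_le_sum) auto
    then have "m = (m - snd (p k)) + snd (p k)" by simp
    then have "of_int N ^ m = (of_int N ^ (m - snd (p k)) * of_int N ^ snd (p k) :: real)"
      by (metis power_add)
    then show ?thesis using p[OF k] N by simp
  qed
  obtain e k where e: "e \<in> E" "e * M \<in> carrier G" "id_columns n c (e * M)" "k \<in> {c..<n}"
      "\<And>l. l \<in> {c..<n} \<Longrightarrow> l \<noteq> k \<Longrightarrow> (e * M) $$ (l, c) = 0"
    using euclid_column[OF M c z] by blast
  define M1 where "M1 = e * M"
  have M1: "M1 \<in> carrier G" "id_columns n c M1" "\<And>l. l \<in> {c..<n} \<Longrightarrow> l \<noteq> k \<Longrightarrow> M1 $$ (l, c) = 0"
    using e by (auto simp: M1_def)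
  define h where "h = inv\<^bsub>G\<^esub> M1"
  have h: "h \<in> carrier G" "h * M1 = 1\<^sub>m n" using G.l_inv[OF M1(1)] M1 by (simp_all add: h_def)
  have hc: "h \<in> carrier_mat n n" "M1 \<in> carrier_mat n n" using h M1 by auto
  have h0: "h $$ (c, l) = 0" if l: "l < c" for l
  proof -
    have "(h * M1) $$ (c, l) = (\<Sum>m = 0..<n. h $$ (c, m) * M1 $$ (m, l))"
      using l c by (intro mat_mult_index[OF hc]) auto
    also have "\<dots> = dot n (\<lambda>m. h $$ (c, m)) (unit_fun l)"
      unfolding dot_def using M1(2) l by (intro sum.cong refl) (auto simp: id_columns_def)
    finally show ?thesis unfolding h(2) using l c by simp
  qed
  have "(h * M1) $$ (c, c) = (\<Sum>m = 0..<n. h $$ (c, m) * M1 $$ (m, c))"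
    using c by (intro mat_mult_index[OF hc]) auto
  also have "\<dots> = (\<Sum>m\<in>{k}. h $$ (c, m) * M1 $$ (m, c))"
    using e(4) h0 M1(3) by (intro sum.mono_neutral_right) (auto, metis not_le)
  finally have unit: "h $$ (c, k) * M1 $$ (k, c) = 1" unfolding h(2) using c by simp
  have hA: "h $$ (c, k) \<in> Z_inv N" using h c e(4) by (auto simp: SL_carrier)
  show ?thesis
  proof (cases "k = c")
    case False
    let ?X = "elem_mat n c k (h $$ (c, k))"
    have kc: "k < n" "c \<noteq> k" "c \<le> k" using e(4) False by auto
    note ro = row_op[OF M1(1,2) c kc(1,2,3) hA]
    have X: "?X \<in> E" by (rule elem_E[OF c kc(1,2) hA])
    have "(?X * M1) $$ (c, c) = 1" using ro(3)[OF c c] M1(3)[of c] unit kc c by simp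
    then show ?thesis
      using ro(1,2) E_compose[OF X e(1) M(1), of "\<lambda>Z. Z \<in> carrier G \<and> id_columns n c Z \<and> Z $$ (c, c) = 1"]
      unfolding M1_def by blast
  next
    case True
    \<comment> \<open>The unit stands in the pivot position: give a spare row below it the entry \<open>1\<close> in this column, and use it to correct the pivot.\<close>
    define k' where "k' = Suc c"
    have k': "k' < n" "k' \<noteq> c" "c \<noteq> k'" "c \<le> k'" using False c by (auto simp: k'_def)
    let ?X = "elem_mat n k' c (h $$ (c, k))"
    define M2 where "M2 = ?X * M1"
    have X: "?X \<in> E" by (rule elem_E[OF k'(1) c k'(2) hA])
    note ro = row_op[OF M1(1,2) k'(1) c k'(2) order_refl hA, folded M2_def]
    have M2k: "M2 $$ (k', c) = 1" "M2 $$ (c, c) = M1 $$ (c, c)"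
      using ro(3)[OF k'(1) c] ro(3)[OF c c] M1(3)[of k'] unit k' True by simp_all
    let ?b = "1 - M1 $$ (c, c)"
    have bA: "?b \<in> Z_inv N" using M1(1) c by (intro Z.diff_mem) (auto simp: SL_carrier)
    let ?Y = "elem_mat n c k' ?b"
    have Y: "?Y \<in> E" by (rule elem_E[OF c k'(1,3) bA])
    note ro2 = row_op[OF ro(1,2) c k'(1,3,4) bA]
    have "(?Y * M2) $$ (c, c) = 1" using ro2(3)[OF c c] M2k by simp
    moreover have "?Y * M2 = ?Y * ((?X * e) * M)"
      unfolding M2_def M1_def using mult_E(2)[OF X e(1) M(1)] by simp
    ultimately show ?thesis
      using ro2(1,2) E_compose[OF Y mult_E(1)[OF X e(1) M(1)] M(1),
        of "\<lambda>Z. Z \<in> carrier G \<and> id_columns n c Z \<and> Z $$ (c, c) = 1"] by simp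
  qed
qed

lemma clear_column:
  assumes M: "M \<in> carrier G" "id_columns n c M" and c: "c < n"
  shows "\<exists>e\<in>E. e * M \<in> carrier G \<and> id_columns n (Suc c) (e * M)"
proof -
  obtain e where e: "e \<in> E" "e * M \<in> carrier G" "id_columns n c (e * M)" "(e * M) $$ (c, c) = 1"
    using pivot_one[OF M c] by blast
  define M1 where "M1 = e * M"
  have M1: "M1 \<in> carrier G" "id_columns n c M1" "M1 $$ (c, c) = 1" using e by (auto simp: M1_def)
  have M1c: "M1 \<in> carrier_mat n n" using M1 by auto
  define u where "u = (\<lambda>k. if k = c then 0 else - M1 $$ (k, c))"
  have X: "transvection n u (unit_fun c) \<in> E"
  proof (rule col_transvection_mem[OF Z.subgroup_SL_UNIV[OF E_subgroup] c])
    fix l assume l: "l < n" "l \<noteq> c"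
    then have "u l \<in> Z_inv N" using M1(1) c by (auto simp: u_def SL_carrier intro: Z.minus_mem)
    then show "elem_mat n l c (u l) \<in> E" using l c by (intro elem_E)
  qed (simp add: u_def)
  have "transvection n u (unit_fun c) * M1 \<in> carrier G"
    using G.m_closed[OF E.mem_carrier[OF X] M1(1)] by simp
  moreover have "id_columns n (Suc c) (transvection n u (unit_fun c) * M1)"
    using M1(2,3) c unfolding id_columns_def
    by (auto simp: transvection_mult_mat_index[OF M1c] u_def less_Suc_eq simp del: index_mult_mat(1))
  ultimately show ?thesis
    using E_compose[OF X e(1) M(1), of "\<lambda>Z. Z \<in> carrier G \<and> id_columns n (Suc c) Z"]
    unfolding M1_def by blast
qed

lemma SL_Z_inv_elementary: "carrier G = E"
proof
  show "E \<subseteq> carrier G" by (rule E.subset)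
  show "carrier G \<subseteq> E"
  proof
    fix M assume M: "M \<in> carrier G"
    have "c \<le> n \<Longrightarrow> \<exists>e\<in>E. e * M \<in> carrier G \<and> id_columns n c (e * M)" for c
    proof (induction c)
      case 0
      have "1\<^sub>m n * M = M" using M by (metis SL_carrier_mat left_mult_one_mat)
      then show ?case using M E.one_closed by (intro bexI[of _ "1\<^sub>m n"]) (auto simp: id_columns_def)
    next
      case (Suc c)
      then obtain e where e: "e \<in> E" "e * M \<in> carrier G" "id_columns n c (e * M)" by auto
      obtain f where "f \<in> E" "f * (e * M) \<in> carrier G" "id_columns n (Suc c) (f * (e * M))"
        using clear_column[OF e(2,3)] Suc.prems by auto
      then show ?case using E_compose[OF _ e(1) M, of f "\<lambda>Z. Z \<in> carrier G \<and> id_columns n (Suc c) Z"] by blast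
    qed
    from this[of n] obtain e where e: "e \<in> E" "e * M \<in> carrier G" "id_columns n n (e * M)" by auto
    have "e * M = 1\<^sub>m n"
      by (rule eq_matI) (use e in \<open>auto simp: id_columns_def SL_carrier simp del: index_mult_mat(1)\<close>)
    then have "M = inv\<^bsub>G\<^esub> e"
      using G.inv_equality[of M e] M E.mem_carrier[OF e(1)] G.inv_comm[of e M] by simp
    then show "M \<in> E" using E.m_inv_closed[OF e(1)] by simp
  qed
qed

end

section \<open>Subgroups containing multiples of elementary matrices\<close>

text \<open>Modulo units of \<open>\<int>[1/N]\<close>, every nonzero integer is coprime to \<open>N\<close>, so that \<open>N\<close> becomes invertible modulo it.\<close>

lemma coprime_part:
  fixes t N :: int
  assumes "t \<noteq> 0"
  shows "\<exists>t' k. t' \<noteq> 0 \<and> coprime t' N \<and> t dvd t' * N ^ k"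
  using assms
proof (induction "nat \<bar>t\<bar>" arbitrary: t rule: less_induct)
  case less
  show ?case
  proof (cases "coprime t N")
    case True
    then show ?thesis using less.prems by (intro exI[of _ t] exI[of _ 0]) simp
  next
    case False
    define d where "d = gcd t N"
    have d: "d > 1" using False less.prems unfolding d_def
      by (metis coprime_iff_gcd_eq_1 gcd_eq_0_iff gcd_ge_0_int less_le zero_less_one_class.zero_le_one
          zless_imp_add1_zle add_0 order.order_iff_strict)
    obtain r where r: "t = d * r" unfolding d_def by (metis dvd_def gcd_dvd1)
    have "r \<noteq> 0" using r less.prems by auto
    moreover have "nat \<bar>r\<bar> < nat \<bar>t\<bar>" using r d \<open>r \<noteq> 0\<close> by (simp add: abs_mult)
    ultimately obtain t' k where t': "t' \<noteq> 0" "coprime t' N" "r dvd t' * N ^ k"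
      using less.hyps[of r] by blast
    have "d dvd N" by (simp add: d_def)
    then have "d * r dvd N * (t' * N ^ k)" using t'(3) by (rule mult_dvd_mono)
    then have "t dvd t' * N ^ Suc k" unfolding r by (simp add: mult_ac)
    then show ?thesis using t' by blast
  qed
qed

lemma Z_inv_residue:
  assumes N: "N \<noteq> 0" and m: "m > 0" "coprime m N" and x: "x \<in> Z_inv N"
  shows "\<exists>r\<in>{0..<m}. \<exists>a\<in>Z_inv N. x - of_int r = of_int m * a"
proof -
  obtain a k where xa: "x = of_int a / of_int N ^ k" using x by (auto simp: Z_inv_def)
  have "coprime (N ^ k) m" using m by (simp add: coprime_commute)
  then obtain w where w: "[N ^ k * w = 1] (mod m)" using cong_solve_coprime_int by blast
  define r where "r = (a * w) mod m"
  have "[r * N ^ k = a * w * N ^ k] (mod m)" by (simp add: r_def cong_def mod_mult_left_eq)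
  also have "a * w * N ^ k = a * (N ^ k * w)" by simp
  also have "[a * (N ^ k * w) = a * 1] (mod m)" by (rule cong_mult[OF cong_refl w])
  finally have "m dvd (a - r * N ^ k)" by (simp add: cong_iff_dvd_diff dvd_diff_commute)
  then obtain b where "a - r * N ^ k = m * b" by (auto simp: dvd_def)
  then have b: "of_int a = of_int r * of_int N ^ k + of_int m * (of_int b :: real)"
    by (metis add_diff_cancel_left' diff_add_cancel of_int_add of_int_mult of_int_power add.commute)
  have "x - of_int r = of_int m * (of_int b / of_int N ^ k)"
    using N by (simp add: xa b field_simps)
  moreover have "r \<in> {0..<m}" using m by (simp add: r_def)
  ultimately show ?thesis using Z_invI by blast
qed

theorem Z_inv_elementary_finite_index:
  assumes n: "n \<ge> 3" and N: "N \<noteq> 0" and t: "t \<noteq> 0"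
    and H: "subgroup H (SL n UNIV)"
    and E: "\<And>i j a. i < n \<Longrightarrow> j < n \<Longrightarrow> i \<noteq> j \<Longrightarrow> a \<in> Z_inv N \<Longrightarrow> elem_mat n i j (of_int t * a) \<in> H"
  shows "\<exists>\<phi> :: real mat \<Rightarrow> real mat set. finite (\<phi> ` carrier (SL n (Z_inv N))) \<and>
     (\<forall>x\<in>carrier (SL n (Z_inv N)). \<forall>y\<in>carrier (SL n (Z_inv N)). \<phi> x = \<phi> y \<longrightarrow> x * inv\<^bsub>SL n UNIV\<^esub> y \<in> H)"
proof -
  interpret Z: real_subring "Z_inv N" by (rule real_subring_Z_inv[OF N])
  obtain t' k where t': "t' \<noteq> 0" "coprime t' N" "t dvd t' * N ^ k" using coprime_part[OF t] by blast
  obtain q where q: "t' * N ^ k = t * q" using t'(3) by (auto simp: dvd_def)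
  define m where "m = t' * t'"
  have m: "m > 0" "coprime m N" using t' by (auto simp: m_def zero_less_mult_iff)
  define \<rho> where "\<rho> x = (SOME r. r \<in> {0..<m} \<and> (\<exists>a\<in>Z_inv N. x - of_int r = of_int m * a))" for x :: real
  have \<rho>: "\<rho> x \<in> {0..<m}" "\<exists>a\<in>Z_inv N. x - of_int (\<rho> x) = of_int m * a" if "x \<in> Z_inv N" for x
    using someI_ex[of "\<lambda>r. r \<in> {0..<m} \<and> (\<exists>a\<in>Z_inv N. x - of_int r = of_int m * a)"]
      Z_inv_residue[OF N m that] unfolding \<rho>_def by blast+
  show ?thesis
  proof (rule Z.elementary_subgroup_finite_index[OF n _ SL_Z_inv_elementary[OF N] _ _ H])
    show "of_int t' \<in> Z_inv N" by (rule Z.of_int_mem)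
    show "finite (\<rho> ` Z_inv N)" by (rule finite_subset[of _ "{0..<m}"]) (use \<rho> in auto)
    fix x y assume xy: "x \<in> Z_inv N" "y \<in> Z_inv N" "\<rho> x = \<rho> y"
    obtain a b where "a \<in> Z_inv N" "b \<in> Z_inv N" "x - of_int (\<rho> x) = of_int m * a" "y - of_int (\<rho> x) = of_int m * b"
      using \<rho>(2)[OF xy(1)] \<rho>(2)[OF xy(2)] xy(3) by auto
    then show "\<exists>a\<in>Z_inv N. x - y = of_int t' * of_int t' * a"
      by (intro bexI[of _ "a - b"]) (auto simp: m_def algebra_simps intro: Z.diff_mem)
  next
    fix i j a assume ija: "i < n" "j < n" "i \<noteq> j" "a \<in> Z_inv N"
    have "of_int q * a / of_int N ^ k \<in> Z_inv N"
      using Z.mult_mem[OF ija(4) Z_invI[of q N k]] by (simp add: mult.commute)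
    moreover have "of_int t' * a = of_int t * (of_int q * a / of_int N ^ k)"
    proof -
      have "of_int t' * of_int N ^ k = of_int t * (of_int q :: real)" using q by (metis of_int_mult of_int_power)
      then show ?thesis using N by (simp add: field_simps)
    qed
    ultimately show "elem_mat n i j (of_int t' * a) \<in> H" using E[OF ija(1-3)] by metis
  qed
qed

section \<open>Bad primes and potentials\<close>

lemma padic_val_quotient:
  fixes a b :: int
  assumes p: "prime p" and ab: "a \<noteq> 0" "b \<noteq> 0"
  shows "padic_val p (of_int a / of_int b) = int (multiplicity (int p) a) - int (multiplicity (int p) b)"
proof -
  define x :: rat where "x = of_int a / of_int b"
  obtain c d where cd: "quotient_of x = (c, d)" by (cases "quotient_of x") auto
  have d: "d > 0" and x: "x = of_int c / of_int d"
    using cd quotient_of_denom_pos quotient_of_div by auto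
  have "x \<noteq> 0" using ab by (simp add: x_def)
  then have c: "c \<noteq> 0" using x by auto
  have "(of_int (c * b) :: rat) = of_int (a * d)"
    using x x_def ab d by (simp add: field_simps)
  then have eq: "c * b = a * d" by (simp only: of_int_eq_iff)
  have pe: "prime_elem (int p)" using p by simp
  have "multiplicity (int p) c + multiplicity (int p) b = multiplicity (int p) a + multiplicity (int p) d"
    using prime_elem_multiplicity_mult_distrib[OF pe c ab(2)]
      prime_elem_multiplicity_mult_distrib[OF pe ab(1), of d] d eq by simp
  then show ?thesis unfolding x_def[symmetric] padic_val_def cd by simp
qed

lemma padic_val_mult:
  assumes p: "prime p" and "x \<noteq> 0" "y \<noteq> 0"
  shows "padic_val p (x * y) = padic_val p x + padic_val p y"
proof -
  obtain a b where x: "x = of_int a / of_int b" "b > 0" by (metis quotient_of_div quotient_of_denom_pos surj_pair)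
  obtain c d where y: "y = of_int c / of_int d" "d > 0" by (metis quotient_of_div quotient_of_denom_pos surj_pair)
  have nz: "a \<noteq> 0" "c \<noteq> 0" "b \<noteq> 0" "d \<noteq> 0" using assms x y by auto
  have "x * y = of_int (a * c) / of_int (b * d)" by (simp add: x y)
  then show ?thesis
    using nz p padic_val_quotient[OF p, of "a * c" "b * d"]
      padic_val_quotient[OF p, of a b] padic_val_quotient[OF p, of c d]
    by (simp add: x(1) y(1) prime_elem_multiplicity_mult_distrib)
qed

lemma padic_val_divide:
  assumes p: "prime p" and "x \<noteq> 0" "y \<noteq> 0"
  shows "padic_val p (x / y) = padic_val p x - padic_val p y"
  using padic_val_mult[OF p, of "x / y" y] assms by simp

lemma padic_val_of_nat:
  assumes "prime p" "m > 0"
  shows "padic_val p (of_nat m) = int (multiplicity p m)"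
proof -
  have "multiplicity (int p) (int m) = multiplicity p m"
  proof (rule multiplicity_eqI)
    have iff: "int p ^ k dvd int m \<longleftrightarrow> p ^ k dvd m" for k
      by (metis of_nat_dvd_iff of_nat_power)
    have "\<not> is_unit p" "m \<noteq> 0" using assms by auto
    then show "int p ^ multiplicity p m dvd int m" "\<not> int p ^ Suc (multiplicity p m) dvd int m"
      unfolding iff using power_dvd_iff_le_multiplicity[of m p] by (auto simp del: power_Suc)
  qed
  then show ?thesis
    using padic_val_quotient[OF assms(1), of "int m" 1] assms(2) by simp
qed

text \<open>The positions \<open>(i, j)\<close> at which elements of \<open>\<Gamma>(Q)\<close> are elementary: \<open>I i j\<close> stands for the set of all \<open>x\<close> with
  \<open>E\<^sub>i\<^sub>j(x) \<in> \<Gamma>(Q)\<close>, and \<open>mult\<close> is the commutator relation.\<close>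

locale rat_net =
  fixes n :: nat and I :: "nat \<Rightarrow> nat \<Rightarrow> rat set" and Q :: "nat \<Rightarrow> nat \<Rightarrow> rat"
  assumes n: "n \<ge> 3"
    and diff: "i < n \<Longrightarrow> j < n \<Longrightarrow> i \<noteq> j \<Longrightarrow> x \<in> I i j \<Longrightarrow> y \<in> I i j \<Longrightarrow> x - y \<in> I i j"
    and mult: "i < n \<Longrightarrow> j < n \<Longrightarrow> k < n \<Longrightarrow> i \<noteq> j \<Longrightarrow> j \<noteq> k \<Longrightarrow> i \<noteq> k \<Longrightarrow>
      x \<in> I i j \<Longrightarrow> y \<in> I j k \<Longrightarrow> x * y \<in> I i k"
    and Q: "i < n \<Longrightarrow> j < n \<Longrightarrow> i \<noteq> j \<Longrightarrow> Q i j \<in> I i j"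
    and Q_nz: "i < n \<Longrightarrow> j < n \<Longrightarrow> i \<noteq> j \<Longrightarrow> Q i j \<noteq> 0"
begin

lemma I_add:
  assumes "i < n" "j < n" "i \<noteq> j" "x \<in> I i j" "y \<in> I i j"
  shows "x + y \<in> I i j"
proof -
  have "0 - y \<in> I i j" using diff[OF assms(1-3,5,5)] diff[OF assms(1-3) _ assms(5), of 0] by simp
  then show ?thesis using diff[OF assms(1-4), of "- y"] by simp
qed

lemma I_int_mult:
  assumes ij: "i < n" "j < n" "i \<noteq> j" and x: "x \<in> I i j"
  shows "of_int m * x \<in> I i j"
proof -
  have z: "0 \<in> I i j" using diff[OF ij x x] by simp
  have nat: "of_nat k * x \<in> I i j" for k
  proof (induction k)
    case (Suc k)
    then show ?case using I_add[OF ij x Suc] by (simp add: algebra_simps)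
  qed (simp add: z)
  show ?thesis
  proof (cases m)
    case (nonneg k)
    then show ?thesis using nat by simp
  next
    case (neg k)
    then show ?thesis using diff[OF ij z nat[of "Suc k"]] by (simp del: of_nat_Suc)
  qed
qed

definition unbounded :: "nat \<Rightarrow> nat \<Rightarrow> nat \<Rightarrow> bool" where
  "unbounded p i j \<longleftrightarrow> (\<forall>B. \<exists>x\<in>I i j. x \<noteq> 0 \<and> padic_val p x < B)"

lemma unbounded_right:
  assumes p: "prime p" and ij: "i < n" "j < n" "i \<noteq> j" "k < n" "k \<noteq> i" "k \<noteq> j" and u: "unbounded p i j"
  shows "unbounded p i k"
  unfolding unbounded_def
proof
  fix B
  obtain x where x: "x \<in> I i j" "x \<noteq> 0" "padic_val p x < B - padic_val p (Q j k)"
    using u unfolding unbounded_def by blast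
  have "x * Q j k \<in> I i k" using mult[of i j k] ij x Q by auto
  moreover have "padic_val p (x * Q j k) < B" "x * Q j k \<noteq> 0"
    using x Q_nz[of j k] ij by (simp_all add: padic_val_mult[OF p])
  ultimately show "\<exists>x\<in>I i k. x \<noteq> 0 \<and> padic_val p x < B" by blast
qed

lemma unbounded_left:
  assumes p: "prime p" and ij: "i < n" "j < n" "i \<noteq> j" "k < n" "k \<noteq> i" "k \<noteq> j" and u: "unbounded p i j"
  shows "unbounded p k j"
  unfolding unbounded_def
proof
  fix B
  obtain x where x: "x \<in> I i j" "x \<noteq> 0" "padic_val p x < B - padic_val p (Q k i)"
    using u unfolding unbounded_def by blast
  have "Q k i * x \<in> I k j" using mult[of k i j] ij x Q by auto
  moreover have "padic_val p (Q k i * x) < B" "Q k i * x \<noteq> 0"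
    using x Q_nz[of k i] ij by (simp_all add: padic_val_mult[OF p])
  ultimately show "\<exists>x\<in>I k j. x \<noteq> 0 \<and> padic_val p x < B" by blast
qed

lemma unbounded_everywhere:
  assumes p: "prime p" and ab: "a < n" "b < n" "a \<noteq> b" and ij: "i < n" "j < n" "i \<noteq> j"
    and u: "unbounded p a b"
  shows "unbounded p i j"
proof -
  have L: "unbounded p i b" if "unbounded p a b" "a < n" "b < n" "a \<noteq> b" "i < n" "i \<noteq> b" for a b i
    using unbounded_left[OF p that(2-4), of i] that by (cases "i = a") auto
  have R: "unbounded p a j" if "unbounded p a b" "a < n" "b < n" "a \<noteq> b" "j < n" "j \<noteq> a" for a b j
    using unbounded_right[OF p that(2-4), of j] that by (cases "j = b") auto
  show ?thesis
  proof (cases "i = b")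
    case False
    then show ?thesis using L[OF u ab, of i] R[of i b j] ab ij by auto
  next
    case True
    obtain c where c: "c < n" "c \<noteq> a" "c \<noteq> b" using third_index[OF n] by blast
    then show ?thesis using R[OF u ab, of c] L[of a c i] R[of i c j] ab ij True by auto
  qed
qed

text \<open>An element with \<open>p\<^sup>k\<close> in the denominator may have other prime factors, in its denominator and its numerator. The former
  are removed by an integer multiple, and the latter by Bezout with an integer of \<open>I i j\<close>; the
  numerator that remains does not depend on \<open>k\<close>.\<close>

lemma unbounded_divisible:
  assumes p: "prime p" and ij: "i < n" "j < n" "i \<noteq> j" and u: "unbounded p i j"
    and r: "of_int r \<in> I i j"
  shows "of_int r / of_nat p ^ k \<in> I i j"
proof -
  obtain x where x: "x \<in> I i j" "x \<noteq> 0" "padic_val p x < - int k"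
    using u unfolding unbounded_def by blast
  obtain a b where ab: "quotient_of x = (a, b)" by (cases "quotient_of x") auto
  have xab: "x = of_int a / of_int b" "b > 0" "coprime a b"
    using ab quotient_of_div quotient_of_denom_pos quotient_of_coprime by auto
  have "multiplicity (int p) a < multiplicity (int p) b" and k: "k \<le> multiplicity (int p) b"
    using x(3) by (auto simp: padic_val_def ab)
  then have "int p dvd b" by (metis multiplicity_eq_zero_iff not_dvd_imp_multiplicity_0 not_less0)
  then have "\<not> int p dvd a"
    using xab(3) p by (metis coprime_common_divisor not_prime_unit prime_nat_int_transfer)
  then have "coprime (int p ^ k) a"
    using p by (simp add: prime_imp_coprime)
  then have "coprime a (int p ^ k)" by (simp add: coprime_commute)
  then obtain y z where yz: "y * a + z * int p ^ k = 1"
    using bezout_int[of a "int p ^ k"] by (auto simp: coprime_iff_gcd_eq_1)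
  have "int p ^ k dvd b" using k by (rule multiplicity_dvd')
  then obtain b' where b': "b = int p ^ k * b'" by (auto simp: dvd_def)
  have nz: "(of_nat p :: rat) ^ k \<noteq> 0" "b' \<noteq> 0" using p b' xab(2) by auto
  have "of_int (r * y * b') * x \<in> I i j" by (rule I_int_mult[OF ij x(1)])
  moreover have "of_int z * of_int r \<in> I i j" by (rule I_int_mult[OF ij r])
  moreover have "of_int r / of_nat p ^ k = of_int (r * y * b') * x + of_int z * of_int r"
  proof -
    have "(of_int y * of_int a + of_int z * of_nat p ^ k :: rat) = 1"
      using arg_cong[OF yz, of "of_int :: int \<Rightarrow> rat"] by simp
    then have "of_int r = of_int r * (of_int y * of_int a + of_int z * of_nat p ^ k :: rat)" by simp
    then have "of_int r / of_nat p ^ k = of_int r * (of_int y * of_int a + of_int z * of_nat p ^ k) / (of_nat p ^ k :: rat)"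
      by simp
    also have "\<dots> = of_int (r * y * b') * x + of_int z * of_int r"
      using nz unfolding xab(1) b' by (simp add: field_simps)
    finally show ?thesis .
  qed
  ultimately show ?thesis using I_add[OF ij] by simp
qed

lemma common_integer: "\<exists>r. r \<noteq> 0 \<and> (\<forall>i<n. \<forall>j<n. i \<noteq> j \<longrightarrow> (of_int r :: rat) \<in> I i j)"
proof -
  define num where "num i j = fst (quotient_of (Q i j))" for i j
  define r where "r = (\<Prod>(i, j)\<in>{(i, j). i < n \<and> j < n \<and> i \<noteq> j}. num i j)"
  have fin: "finite {(i, j). i < n \<and> j < n \<and> i \<noteq> j}"
    by (rule finite_subset[of _ "{..<n} \<times> {..<n}"]) auto
  have num: "num i j \<noteq> 0 \<and> of_int (num i j) \<in> I i j" if ij: "i < n" "j < n" "i \<noteq> j" for i j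
  proof -
    obtain a b where ab: "quotient_of (Q i j) = (a, b)" by (cases "quotient_of (Q i j)") auto
    then have q: "Q i j = of_int a / of_int b" "b > 0" using quotient_of_div quotient_of_denom_pos by auto
    then have "of_int a = of_int b * Q i j" by simp
    moreover have "a \<noteq> 0" using q Q_nz[OF ij] by auto
    ultimately show ?thesis using I_int_mult[OF ij Q[OF ij], of b] Q_nz[OF ij] q(2) by (auto simp: num_def ab)
  qed
  have "r \<noteq> 0" using fin num by (auto simp: r_def)
  moreover have "(of_int r :: rat) \<in> I i j" if ij: "i < n" "j < n" "i \<noteq> j" for i j
  proof -
    have "num i j dvd r"
      using dvd_prod_eqI[OF fin, of "(i, j)" "num i j" "\<lambda>(i, j). num i j"] ij unfolding r_def by auto
    then obtain m where "r = m * num i j" by (auto simp: dvd_def mult.commute)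
    then show ?thesis using I_int_mult[OF ij, of "of_int (num i j)" m] num[OF ij] by simp
  qed
  ultimately show ?thesis by blast
qed

text \<open>Denominators for different primes are combined through a third index: \<open>I i l \<cdot> I l j \<subseteq> I i j\<close>.\<close>

lemma divisible_by_bad_primes:
  assumes "finite F" "\<And>p. p \<in> F \<Longrightarrow> prime p \<and> unbounded p 0 1"
  shows "\<exists>t. t \<noteq> 0 \<and> (\<forall>i<n. \<forall>j<n. i \<noteq> j \<longrightarrow> (\<forall>k. of_int t / of_nat (\<Prod>F) ^ k \<in> I i j))"
  using assms
proof (induction F rule: finite_induct)
  case empty
  then show ?case using common_integer by simp
next
  case (insert p F)
  then obtain t where t: "t \<noteq> 0" "\<And>i j k. i < n \<Longrightarrow> j < n \<Longrightarrow> i \<noteq> j \<Longrightarrow> of_int t / of_nat (\<Prod>F) ^ k \<in> I i j"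
    by auto
  obtain r where r: "r \<noteq> 0" "\<And>i j. i < n \<Longrightarrow> j < n \<Longrightarrow> i \<noteq> j \<Longrightarrow> (of_int r :: rat) \<in> I i j"
    using common_integer by blast
  have p: "prime p" "unbounded p 0 1" using insert.prems by auto
  have "of_int (t * r) / of_nat (\<Prod>(insert p F)) ^ k \<in> I i j" if ij: "i < n" "j < n" "i \<noteq> j" for i j k
  proof -
    obtain l where l: "l < n" "l \<noteq> i" "l \<noteq> j" using third_index[OF n] by blast
    have "unbounded p l j" using unbounded_everywhere[OF p(1) _ _ _ l(1) ij(2) l(3) p(2)] n by simp
    then have "of_int r / of_nat p ^ k \<in> I l j" using unbounded_divisible[OF p(1) l(1) ij(2) l(3)] r l ij by simp
    then have "of_int t / of_nat (\<Prod>F) ^ k * (of_int r / of_nat p ^ k) \<in> I i j"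
      by (intro mult[of i l j] t(2)) (use l ij in auto)
    moreover have "of_int t / of_nat (\<Prod>F) ^ k * (of_int r / of_nat p ^ k) =
        of_int (t * r) / (of_nat (\<Prod>(insert p F)) ^ k :: rat)"
      using insert.hyps by (simp add: power_mult_distrib mult_ac)
    ultimately show ?thesis by metis
  qed
  then show ?case using t(1) r(1) by (intro exI[of _ "t * r"]) auto
qed

text \<open>The potential of \<open>j\<close> is the least valuation on \<open>I 0 j\<close>, that is, the length of a shortest path from \<open>0\<close> to \<open>j\<close> for the edge
  lengths \<open>v\<^sub>p(Q i j)\<close>. The bounds by the two edges between \<open>0\<close> and \<open>j\<close> make the potentials computable. The lower bound is the
  absence of negative cycles: multiplication by an element of \<open>I 0 j \<cdot> I j 0\<close> maps \<open>I 0 k\<close> into itself, and so cannot lower the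
  minimum there.\<close>

lemma potential_exists:
  assumes p: "prime p" and bounded: "\<not> unbounded p 0 1"
  shows "\<exists>u. (\<forall>i<n. \<forall>j<n. i \<noteq> j \<longrightarrow> u j \<le> u i + padic_val p (Q i j)) \<and> u 0 = 0 \<and>
     (\<forall>j<n. j \<noteq> 0 \<longrightarrow> - padic_val p (Q j 0) \<le> u j \<and> u j \<le> padic_val p (Q 0 j))"
proof -
  have least: "\<exists>x\<in>I 0 j. x \<noteq> 0 \<and> (\<forall>y\<in>I 0 j. y \<noteq> 0 \<longrightarrow> padic_val p x \<le> padic_val p y)"
    if j: "j < n" "j \<noteq> 0" for j
  proof -
    have "\<not> unbounded p 0 j" using unbounded_everywhere[OF p _ j(1) _ _ _ _ , of 0 0 1] j n bounded by auto
    then obtain B where B: "\<And>x. x \<in> I 0 j \<Longrightarrow> x \<noteq> 0 \<Longrightarrow> B \<le> padic_val p x"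
      unfolding unbounded_def by (meson not_le)
    have "Q 0 j \<in> I 0 j \<and> Q 0 j \<noteq> 0" using Q[of 0 j] Q_nz[of 0 j] j by auto
    then obtain x where "x \<in> I 0 j \<and> x \<noteq> 0"
      "\<And>y. y \<in> I 0 j \<and> y \<noteq> 0 \<Longrightarrow> nat (padic_val p x - B) \<le> nat (padic_val p y - B)"
      using ex_has_least_nat[of "\<lambda>x. x \<in> I 0 j \<and> x \<noteq> 0" _ "\<lambda>x. nat (padic_val p x - B)"] by blast
    then show ?thesis using B by (intro bexI[of _ x]) fastforce+
  qed
  define x where "x j = (SOME x. x \<in> I 0 j \<and> x \<noteq> 0 \<and> (\<forall>y\<in>I 0 j. y \<noteq> 0 \<longrightarrow> padic_val p x \<le> padic_val p y))" for j
  have x: "x j \<in> I 0 j" "x j \<noteq> 0" "\<And>y. y \<in> I 0 j \<Longrightarrow> y \<noteq> 0 \<Longrightarrow> padic_val p (x j) \<le> padic_val p y"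
    if j: "j < n" "j \<noteq> 0" for j
    using someI_ex[of "\<lambda>x. x \<in> I 0 j \<and> x \<noteq> 0 \<and> (\<forall>y\<in>I 0 j. y \<noteq> 0 \<longrightarrow> padic_val p x \<le> padic_val p y)"]
      least[OF j] unfolding x_def by blast+
  define u where "u j = (if j = 0 then 0 else padic_val p (x j))" for j
  have up: "u j \<le> padic_val p (Q 0 j)" if "j < n" "j \<noteq> 0" for j
    using x(3)[OF that, of "Q 0 j"] Q[of 0 j] Q_nz[of 0 j] that by (auto simp: u_def)
  have low: "- padic_val p (Q j 0) \<le> u j" if j: "j < n" "j \<noteq> 0" for j
  proof -
    obtain k where k: "k < n" "k \<noteq> 0" "k \<noteq> j" using third_index[OF n] by blast
    have "Q j 0 * x k \<in> I j k" using mult[of j 0 k] Q[of j 0] x(1)[OF k(1,2)] j k by auto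
    then have "x j * (Q j 0 * x k) \<in> I 0 k" using mult[of 0 j k] x(1)[OF j] j k by auto
    moreover have nz: "Q j 0 \<noteq> 0" "x k \<noteq> 0" "x j \<noteq> 0" using Q_nz[of j 0] x(2) j k by auto
    ultimately have "padic_val p (x k) \<le> padic_val p (x j * (Q j 0 * x k))"
      using x(3)[OF k(1,2)] by simp
    then show ?thesis using nz j by (simp add: padic_val_mult[OF p] u_def)
  qed
  have "u j \<le> u i + padic_val p (Q i j)" if ij: "i < n" "j < n" "i \<noteq> j" for i j
  proof (cases "i = 0 \<or> j = 0")
    case True
    then show ?thesis using up[of j] low[of i] ij by (auto simp: u_def)
  next
    case False
    then have "x i * Q i j \<in> I 0 j" using mult[of 0 i j] x(1)[of i] Q ij by auto
    then show ?thesis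
      using x(3)[of j "x i * Q i j"] x(2)[of i] Q_nz[OF ij] ij False
      by (simp add: u_def padic_val_mult[OF p])
  qed
  then show ?thesis using up low by (intro exI[of _ u]) (auto simp: u_def)
qed

end

text \<open>For \<open>q\<^sub>i\<^sub>j = \<plusminus>a\<^sub>i\<^sub>j / b\<^sub>i\<^sub>j\<close> this says that all \<open>d\<^sub>i q\<^sub>i\<^sub>j / d\<^sub>j\<close> lie in \<open>\<int>[1/N]\<close>. The exponent is an explicit number that
  is large enough for \<open>d\<^sub>j b\<^sub>i\<^sub>j\<close> to divide the power of \<open>N\<close> as far as the prime divisors of \<open>N\<close> are concerned, so
  that no unbounded search for an exponent is needed.\<close>

definition integral_scaling :: "nat \<Rightarrow> (nat \<Rightarrow> nat \<Rightarrow> nat) \<Rightarrow> (nat \<Rightarrow> nat \<Rightarrow> nat) \<Rightarrow> nat \<Rightarrow> (nat \<Rightarrow> nat) \<Rightarrow> bool" where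
  "integral_scaling n a b N d \<longleftrightarrow>
     (\<forall>i<n. \<forall>j<n. i \<noteq> j \<longrightarrow> d j * b i j dvd d i * a i j * N ^ (d j * b i j))"

lemma multiplicity_le_self: "(m :: nat) > 0 \<Longrightarrow> prime p \<Longrightarrow> multiplicity p m \<le> m"
proof -
  assume m: "m > 0" and p: "prime p"
  have "p ^ multiplicity p m \<le> m" using m by (intro dvd_imp_le multiplicity_dvd) auto
  moreover have "multiplicity p m < 2 ^ multiplicity p m" by simp
  moreover have "(2 :: nat) ^ multiplicity p m \<le> p ^ multiplicity p m"
    using p by (intro power_mono prime_ge_2_nat) auto
  ultimately show ?thesis by linarith
qed

context rat_net
begin

definition bad_primes :: "nat set" where
  "bad_primes = {p. prime p \<and> unbounded p 0 1}"

text \<open>At a good prime \<open>d\<^sub>j\<close> has the valuation prescribed by the potential, shifted by \<open>v\<^sub>p(P)\<close> to become nonnegative; as the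
  potential is at most \<open>v\<^sub>p(P)\<close>, this gives a divisor of \<open>P\<^sup>2\<close> and thus an explicit bound for the search. Good
  primes that do not divide \<open>P\<close> divide no \<open>a\<^sub>i\<^sub>j\<close> and no \<open>b\<^sub>i\<^sub>j\<close>, and at the bad primes the power of \<open>N\<close> dominates.\<close>

lemma bad_primes_scaling:
  fixes a b :: "nat \<Rightarrow> nat \<Rightarrow> nat" and P :: nat
  assumes ab: "\<And>i j. i < n \<Longrightarrow> j < n \<Longrightarrow> i \<noteq> j \<Longrightarrow> a i j > 0 \<and> b i j > 0 \<and>
      \<bar>Q i j\<bar> = of_nat (a i j) / of_nat (b i j) \<and> a i j dvd P \<and> b i j dvd P"
    and P: "P > 0" and fin: "finite bad_primes"
  shows "\<exists>d. (\<forall>j. 0 < d j \<and> d j \<le> P * P) \<and> integral_scaling n a b (\<Prod>bad_primes) d"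
proof -
  have v: "padic_val p (Q i j) = int (multiplicity p (a i j)) - int (multiplicity p (b i j))"
    if p: "prime p" and ij: "i < n" "j < n" "i \<noteq> j" for p i j
  proof -
    have abs: "padic_val p (Q i j) = padic_val p \<bar>Q i j\<bar>"
    proof (cases "Q i j \<ge> 0")
      case False
      have "padic_val p (-1) = 0" using padic_val_quotient[OF p, of "-1" 1] multiplicity_unit_right[of "-1 :: int" "int p"] by simp
      then have "padic_val p ((-1) * Q i j) = padic_val p (Q i j)"
        using padic_val_mult[OF p, of "-1" "Q i j"] Q_nz[OF ij] by simp
      then show ?thesis using False by simp
    qed simp
    have "padic_val p \<bar>Q i j\<bar> = padic_val p (of_nat (a i j) / of_nat (b i j))"
      using ab[OF ij] by simp
    then show ?thesis unfolding abs
      using ab[OF ij] p by (simp add: padic_val_divide padic_val_of_nat)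
  qed
  have mP: "multiplicity p (a i j) \<le> multiplicity p P" "multiplicity p (b i j) \<le> multiplicity p P"
    if "i < n" "j < n" "i \<noteq> j" for p i j
    using ab[OF that] P by (auto intro!: dvd_imp_multiplicity_le)
  define u where "u p = (SOME u. (\<forall>i<n. \<forall>j<n. i \<noteq> j \<longrightarrow> u j \<le> u i + padic_val p (Q i j)) \<and> u 0 = 0 \<and>
     (\<forall>j<n. j \<noteq> 0 \<longrightarrow> - padic_val p (Q j 0) \<le> u j \<and> u j \<le> padic_val p (Q 0 j)))" for p
  have u: "(\<forall>i<n. \<forall>j<n. i \<noteq> j \<longrightarrow> u p j \<le> u p i + padic_val p (Q i j)) \<and> u p 0 = 0 \<and>
     (\<forall>j<n. j \<noteq> 0 \<longrightarrow> - padic_val p (Q j 0) \<le> u p j \<and> u p j \<le> padic_val p (Q 0 j))"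
    if "prime p" "p \<notin> bad_primes" for p
    unfolding u_def by (rule someI_ex[OF potential_exists]) (use that in \<open>auto simp: bad_primes_def\<close>)
  define G where "G = prime_factors P - bad_primes"
  define e where "e j p = (if j < n then nat (u p j + int (multiplicity p P)) else 0)" for j p
  define d where "d j = (\<Prod>p\<in>G. p ^ e j p)" for j
  have Gp: "prime p" if "p \<in> G" for p using that by (auto simp: G_def)
  have finG: "finite G" by (simp add: G_def)
  have dpos: "d j > 0" for j unfolding d_def by (intro prod_pos) (use Gp prime_gt_0_nat in auto)
  have md: "multiplicity p (d j) = (if p \<in> G then e j p else 0)" if "prime p" for p j
    unfolding d_def using multiplicity_prod_prime_powers[OF finG, of p "e j"] Gp that by auto
  have ubound: "\<bar>u p j\<bar> \<le> int (multiplicity p P)" if "prime p" "p \<notin> bad_primes" "j < n" for p j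
  proof (cases "j = 0")
    case True
    then show ?thesis using u[OF that(1,2)] by simp
  next
    case False
    have n0: "0 < n" using n by simp
    have "- padic_val p (Q j 0) \<le> u p j" "u p j \<le> padic_val p (Q 0 j)"
      using u[OF that(1,2)] that(3) False by blast+
    then show ?thesis
      using v[OF that(1) that(3) n0 False] v[OF that(1) n0 that(3)] False
        mP[OF n0 that(3), of p] mP[OF that(3) n0 False, of p] by linarith
  qed
  have "d j dvd P * P" for j
  proof (rule multiplicity_le_imp_dvd)
    fix p :: nat assume p: "prime p"
    have "multiplicity p (P * P) = 2 * multiplicity p P"
      using p P by (simp add: prime_elem_multiplicity_mult_distrib)
    moreover have "e j p \<le> 2 * multiplicity p P" if "p \<in> G"
      using ubound[OF p, of j] that by (auto simp: e_def G_def)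
    ultimately show "multiplicity p (d j) \<le> multiplicity p (P * P)" using md[OF p] by simp
  qed (use dpos in auto)
  then have dle: "d j \<le> P * P" for j using P by (intro dvd_imp_le) auto
  have "integral_scaling n a b (\<Prod>bad_primes) d"
    unfolding integral_scaling_def
  proof (intro allI impI multiplicity_le_imp_dvd)
    fix i j p assume ij: "i < n" "j < n" "i \<noteq> j" and p: "prime (p :: nat)"
    let ?N = "\<Prod>bad_primes" and ?x = "d j * b i j"
    have N: "?N > 0" by (intro prod_pos) (use prime_gt_0_nat in \<open>auto simp: bad_primes_def\<close>)
    have pos: "a i j > 0" "b i j > 0" "d i > 0" "d j > 0" using ab[OF ij] dpos by auto
    have mult: "multiplicity p (d i * a i j * ?N ^ ?x) =
        multiplicity p (d i) + multiplicity p (a i j) + ?x * multiplicity p ?N"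
      using p pos N by (simp add: prime_elem_multiplicity_mult_distrib prime_elem_multiplicity_power_distrib)
    have mx: "multiplicity p ?x = multiplicity p (d j) + multiplicity p (b i j)"
      using p pos by (simp add: prime_elem_multiplicity_mult_distrib)
    show "multiplicity p ?x \<le> multiplicity p (d i * a i j * ?N ^ ?x)"
    proof (cases "p \<in> bad_primes")
      case True
      then have "p dvd ?N" using dvd_prodI[OF fin True, of "\<lambda>x. x"] by simp
      then have "multiplicity p ?N \<ge> 1" using N p
        by (metis One_nat_def Suc_leI not_prime_unit multiplicity_gt_zero_iff less_numeral_extra(3))
      then have "?x \<le> ?x * multiplicity p ?N" by simp
      moreover have "multiplicity p ?x \<le> ?x" using pos p by (intro multiplicity_le_self) auto
      ultimately show ?thesis unfolding mult by linarith
    next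
      case good: False
      show ?thesis
      proof (cases "p dvd P")
        case True
        then have pG: "p \<in> G" using good p P by (auto simp: G_def prime_factors_dvd)
        have "u p j \<le> u p i + padic_val p (Q i j)" using u[OF p good] ij by blast
        then show ?thesis unfolding mult mx
          using md[OF p] pG ubound[OF p good ij(1)] ubound[OF p good ij(2)] v[OF p ij] ij
          by (simp add: e_def)
      next
        case False
        then have "multiplicity p P = 0" by (rule not_dvd_imp_multiplicity_0)
        moreover have "p \<notin> G" using False by (auto simp: G_def prime_factors_dvd)
        ultimately show ?thesis unfolding mx using md[OF p] mP[OF ij, of p] by simp
      qed
    qed
  qed (use ab dpos in \<open>auto\<close>)
  then show ?thesis using dpos dle by blast
qed

text \<open>If \<open>d\<close> conjugates \<open>\<Gamma>(Q)\<close> into \<open>SL(n, \<int>[1/N])\<close>, then the valuation at a prime not dividing \<open>N\<close> is bounded below on \<open>I 0 1\<close>.\<close>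

lemma bad_prime_dvd:
  fixes N :: nat and d :: "nat \<Rightarrow> nat"
  assumes N: "N > 0" and d: "d 0 > 0" "d 1 > 0"
    and int: "\<And>x. x \<in> I 0 1 \<Longrightarrow> \<exists>c k. of_nat (d 0) * x / of_nat (d 1) = of_int c / of_nat N ^ k"
    and p: "p \<in> bad_primes"
  shows "p dvd N"
proof (rule ccontr)
  assume pN: "\<not> p dvd N"
  have pp: "prime p" "unbounded p 0 1" using p by (auto simp: bad_primes_def)
  obtain x where x: "x \<in> I 0 1" "x \<noteq> 0" "padic_val p x < int (multiplicity p (d 1)) - int (multiplicity p (d 0))"
    using pp(2) unfolding unbounded_def by blast
  obtain c k where ck: "of_nat (d 0) * x / of_nat (d 1) = of_int c / of_nat N ^ k" using int[OF x(1)] by blast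
  have "of_nat (d 0) * x / of_nat (d 1) \<noteq> 0" using x d by simp
  then have c: "c \<noteq> 0" using ck by auto
  have "padic_val p (of_nat (d 0) * x / of_nat (d 1)) =
      int (multiplicity p (d 0)) + padic_val p x - int (multiplicity p (d 1))"
    using x d pp by (simp add: padic_val_divide padic_val_mult padic_val_of_nat)
  moreover have "padic_val p (of_int c / of_nat N ^ k) =
      int (multiplicity (int p) c) - int (multiplicity p (N ^ k))"
    using padic_val_divide[OF pp(1), of "of_int c" "of_nat (N ^ k)"] c N
      padic_val_quotient[OF pp(1) c, of 1] padic_val_of_nat[OF pp(1), of "N ^ k"] by simp
  moreover have "multiplicity p (N ^ k) = 0"
    using pN pp(1) by (intro not_dvd_imp_multiplicity_0) (use prime_dvd_power in blast)
  ultimately show False using x(3) unfolding ck by simp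
qed

end

section \<open>Closure properties of recursive functions\<close>

abbreviation "pi1 x \<equiv> fst (prod_decode x)"
abbreviation "pi2 x \<equiv> snd (prod_decode x)"

text \<open>Functions are always viewed as functions of a single variable, the environment. A binder pairs the environment with the
  bound variable; the rules collected here therefore build recursive functions by recursion on the term.\<close>

named_theorems rf

lemma rf_id [rf]: "recursive_fun (\<lambda>x. x)"
  using recursive_fun.pair[OF recursive_fun.left recursive_fun.right] by simp

lemma rf_const [rf]: "recursive_fun (\<lambda>x. c)"
proof (induction c)
  case (Suc c)
  then show ?case using recursive_fun.comp[OF recursive_fun.suc Suc] by simp
qed (rule recursive_fun.zero)

lemma rf_Suc [rf]: "recursive_fun f \<Longrightarrow> recursive_fun (\<lambda>x. Suc (f x))"
  using recursive_fun.comp[OF recursive_fun.suc] .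

lemma rf_pi [rf]:
  "recursive_fun f \<Longrightarrow> recursive_fun (\<lambda>x. pi1 (f x))"
  "recursive_fun f \<Longrightarrow> recursive_fun (\<lambda>x. pi2 (f x))"
  using recursive_fun.comp[OF recursive_fun.left] recursive_fun.comp[OF recursive_fun.right] by auto

lemma rf_rec_nat [rf]:
  assumes f: "recursive_fun f" and g: "recursive_fun (\<lambda>z. g (pi1 z) (pi1 (pi2 z)) (pi2 (pi2 z)))"
    and k: "recursive_fun k"
  shows "recursive_fun (\<lambda>x. rec_nat (f x) (\<lambda>m r. g x m r) (k x))"
proof -
  have "recursive_fun (\<lambda>x. case prod_decode (prod_encode (x, k x)) of (x, k) \<Rightarrow>
      rec_nat (f x) (\<lambda>m r. g (pi1 (prod_encode (x, prod_encode (m, r))))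
        (pi1 (pi2 (prod_encode (x, prod_encode (m, r))))) (pi2 (pi2 (prod_encode (x, prod_encode (m, r)))))) k)"
    by (rule recursive_fun.comp[OF recursive_fun.prim_rec[OF f g] recursive_fun.pair[OF rf_id k]])
  then show ?thesis by simp
qed

lemma rf_pred: "recursive_fun f \<Longrightarrow> recursive_fun (\<lambda>x. f x - 1)"
proof -
  assume f: "recursive_fun f"
  have "recursive_fun (\<lambda>x. rec_nat 0 (\<lambda>m r. m) (f x))" by (intro rf f)
  moreover have "rec_nat 0 (\<lambda>m r. m) k = k - 1" for k :: nat by (cases k) auto
  ultimately show ?thesis by simp
qed

lemma rf_add [rf]:
  assumes "recursive_fun f" "recursive_fun g"
  shows "recursive_fun (\<lambda>x. f x + g x)"
proof -
  have "recursive_fun (\<lambda>x. rec_nat (f x) (\<lambda>m r. Suc r) (g x))" by (intro rf assms)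
  moreover have "rec_nat a (\<lambda>m r. Suc r) k = a + k" for a k :: nat by (induction k) auto
  ultimately show ?thesis by simp
qed

lemma rf_diff [rf]:
  assumes "recursive_fun f" "recursive_fun g"
  shows "recursive_fun (\<lambda>x. f x - g x)"
proof -
  have "recursive_fun (\<lambda>x. rec_nat (f x) (\<lambda>m r. r - 1) (g x))" by (intro rf rf_pred assms)
  moreover have "rec_nat a (\<lambda>m r. r - 1) k = a - k" for a k :: nat by (induction k) auto
  ultimately show ?thesis by simp
qed

lemma rf_mult [rf]:
  assumes "recursive_fun f" "recursive_fun g"
  shows "recursive_fun (\<lambda>x. f x * g x)"
proof -
  have "recursive_fun (\<lambda>x. rec_nat 0 (\<lambda>m r. r + f x) (g x))"
    by (intro rf assms recursive_fun.comp[OF assms(1)])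
  moreover have "rec_nat 0 (\<lambda>m r. r + a) k = a * k" for a k :: nat by (induction k) auto
  ultimately show ?thesis by simp
qed

lemma rf_power [rf]:
  assumes "recursive_fun f" "recursive_fun g"
  shows "recursive_fun (\<lambda>x. f x ^ g x)"
proof -
  have "recursive_fun (\<lambda>x. rec_nat 1 (\<lambda>m r. f x * r) (g x))"
    by (intro rf assms recursive_fun.comp[OF assms(1)])
  moreover have "rec_nat 1 (\<lambda>m r. a * r) k = a ^ k" for a k :: nat by (induction k) auto
  ultimately show ?thesis by simp
qed

definition decidable :: "(nat \<Rightarrow> bool) \<Rightarrow> bool" where
  "decidable P \<longleftrightarrow> recursive_fun (\<lambda>x. of_bool (P x))"

lemma decidable_not [rf]: "decidable P \<Longrightarrow> decidable (\<lambda>x. \<not> P x)"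
proof -
  assume "decidable P"
  then have "recursive_fun (\<lambda>x. 1 - of_bool (P x))" unfolding decidable_def by (intro rf)
  moreover have "1 - of_bool b = (of_bool (\<not> b) :: nat)" for b by (cases b) auto
  ultimately show ?thesis by (simp only: decidable_def)
qed

lemma decidable_conj [rf]: "decidable P \<Longrightarrow> decidable Q \<Longrightarrow> decidable (\<lambda>x. P x \<and> Q x)"
  using rf_mult[of "\<lambda>x. of_bool (P x)" "\<lambda>x. of_bool (Q x)"] by (simp add: decidable_def of_bool_conj)

lemma decidable_disj [rf]: "decidable P \<Longrightarrow> decidable Q \<Longrightarrow> decidable (\<lambda>x. P x \<or> Q x)"
  using decidable_not[OF decidable_conj[OF decidable_not decidable_not], of P Q] by simp

lemma decidable_imp [rf]: "decidable P \<Longrightarrow> decidable Q \<Longrightarrow> decidable (\<lambda>x. P x \<longrightarrow> Q x)"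
  unfolding imp_conv_disj by (intro rf)

lemma decidable_le [rf]:
  assumes "recursive_fun f" "recursive_fun g"
  shows "decidable (\<lambda>x. f x \<le> g x)"
proof -
  have "recursive_fun (\<lambda>x. 1 - (f x - g x))" by (intro rf assms)
  moreover have "1 - (a - b) = of_bool (a \<le> b)" for a b :: nat by auto
  ultimately show ?thesis by (simp add: decidable_def)
qed

lemma decidable_less [rf]:
  assumes "recursive_fun f" "recursive_fun g"
  shows "decidable (\<lambda>x. f x < g x)"
  using decidable_not[OF decidable_le[OF assms(2,1)]] by (simp add: not_le)

lemma decidable_eq [rf]:
  assumes "recursive_fun f" "recursive_fun g"
  shows "decidable (\<lambda>x. f x = g x)"
  using decidable_conj[OF decidable_le[OF assms] decidable_le[OF assms(2,1)]]
  by (simp add: order_eq_iff)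

lemma decidable_comp:
  assumes "decidable P" "recursive_fun f"
  shows "decidable (\<lambda>x. P (f x))"
  using recursive_fun.comp[OF assms(1)[unfolded decidable_def] assms(2)] by (simp add: decidable_def)

lemma decidable_all [rf]:
  assumes P: "decidable (\<lambda>z. P (pi1 z) (pi2 z))" and f: "recursive_fun f"
  shows "decidable (\<lambda>x. \<forall>i<f x. P x i)"
proof -
  have "recursive_fun (\<lambda>x. rec_nat 1 (\<lambda>m r. of_bool (P x m) * r) (f x))"
  proof (intro rf_rec_nat rf_mult rf_const f)
    show "recursive_fun (\<lambda>z. of_bool (P (pi1 z) (pi1 (pi2 z))))"
      using decidable_comp[OF P recursive_fun.pair[OF recursive_fun.left recursive_fun.comp[OF recursive_fun.left recursive_fun.right]]]
      by (simp add: decidable_def)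
  qed (intro rf)
  moreover have "rec_nat 1 (\<lambda>m r. of_bool (P x m) * r) k = (of_bool (\<forall>i<k. P x i) :: nat)" for x k
    by (induction k) (auto simp: less_Suc_eq)
  ultimately show ?thesis by (simp add: decidable_def)
qed

lemma decidable_ex [rf]:
  assumes P: "decidable (\<lambda>z. P (pi1 z) (pi2 z))" and f: "recursive_fun f"
  shows "decidable (\<lambda>x. \<exists>i<f x. P x i)"
  using decidable_not[OF decidable_all[OF decidable_not[OF P] f]] by simp

lemma decidable_dvd [rf]:
  assumes f: "recursive_fun f" and g: "recursive_fun g"
  shows "decidable (\<lambda>x. f x dvd g x)"
proof -
  have "decidable (\<lambda>x. \<exists>i<Suc (g x). g x = f x * i)"
    by (intro rf f g recursive_fun.comp[OF f] recursive_fun.comp[OF g])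
  moreover have "(\<exists>i<Suc b. b = a * i) \<longleftrightarrow> a dvd b" for a b :: nat
  proof
    assume "a dvd b"
    then obtain i where i: "b = a * i" by (auto simp: dvd_def)
    show "\<exists>i<Suc b. b = a * i"
    proof (cases "a = 0")
      case True
      then show ?thesis using i by auto
    next
      case False
      then have "i < Suc b" using i by (cases a) auto
      then show ?thesis using i by blast
    qed
  qed auto
  ultimately show ?thesis by simp
qed

lemma rf_Least [rf]:
  assumes P: "decidable (\<lambda>z. P (pi1 z) (pi2 z))" and ex: "\<And>x. \<exists>k. P x k"
  shows "recursive_fun (\<lambda>x. LEAST k. P x k)"
proof -
  have "recursive_fun (\<lambda>x. LEAST k. (\<lambda>z. of_bool (\<not> P (pi1 z) (pi2 z))) (prod_encode (x, k)) = (0 :: nat))"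
    using decidable_not[OF P] ex by (intro recursive_fun.minimise) (auto simp: decidable_def)
  then show ?thesis by simp
qed

lemma rf_div2 [rf]:
  assumes "recursive_fun f"
  shows "recursive_fun (\<lambda>x. f x div 2)"
proof -
  have "recursive_fun (\<lambda>x. LEAST k. f x < 2 * k + 2)"
  proof (intro rf recursive_fun.comp[OF assms])
    show "\<exists>k. f x < 2 * k + 2" for x by (intro exI[of _ "f x"]) simp
  qed
  moreover have "(LEAST k. a < 2 * k + 2) = a div 2" for a :: nat
    by (rule Least_equality) linarith+
  ultimately show ?thesis by simp
qed

text \<open>Total versions of the list operations on codes, iterating the decoding of \<open>Cons\<close>. Beyond the end of the list they yield
  unspecified but harmless numbers.\<close>

definition code_drop :: "nat \<Rightarrow> nat \<Rightarrow> nat" where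
  "code_drop c i = rec_nat c (\<lambda>m r. pi2 (r - 1)) i"

definition code_nth :: "nat \<Rightarrow> nat \<Rightarrow> nat" where
  "code_nth c i = pi1 (code_drop c i - 1)"

lemma code_drop: "i \<le> length xs \<Longrightarrow> code_drop (list_encode xs) i = list_encode (drop i xs)"
proof (induction i)
  case (Suc i)
  have "drop (Suc i) xs = tl (drop i xs)" by (simp add: drop_Suc tl_drop)
  then show ?case using Suc by (cases "drop i xs") (auto simp: code_drop_def)
qed (simp add: code_drop_def)

lemma code_nth: "i < length xs \<Longrightarrow> code_nth (list_encode xs) i = xs ! i"
  using code_drop[of i xs] by (simp add: code_nth_def Cons_nth_drop_Suc[symmetric])

text \<open>Quantifies over positions only, so that it is decidable by the closure properties.\<close>

lemma code_length:
  "length xs = n \<longleftrightarrow> code_drop (list_encode xs) n = 0 \<and> (\<forall>i<n. code_drop (list_encode xs) i \<noteq> 0)"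
proof
  assume "length xs = n"
  then show "code_drop (list_encode xs) n = 0 \<and> (\<forall>i<n. code_drop (list_encode xs) i \<noteq> 0)"
    by (auto simp: code_drop Cons_nth_drop_Suc[symmetric])
next
  assume a: "code_drop (list_encode xs) n = 0 \<and> (\<forall>i<n. code_drop (list_encode xs) i \<noteq> 0)"
  have "n \<le> length xs"
  proof (rule ccontr)
    assume "\<not> ?thesis"
    then have "code_drop (list_encode xs) (length xs) \<noteq> 0" using a by simp
    then show False by (simp add: code_drop)
  qed
  then have "list_encode (drop n xs) = list_encode []" using a by (simp add: code_drop)
  then have "drop n xs = []" by (simp only: list_encode_eq)
  then show "length xs = n" using \<open>n \<le> length xs\<close> by simp
qed

lemma rf_code_drop [rf]:
  "recursive_fun f \<Longrightarrow> recursive_fun g \<Longrightarrow> recursive_fun (\<lambda>x. code_drop (f x) (g x))"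
  unfolding code_drop_def by (intro rf)

lemma rf_code_nth [rf]:
  "recursive_fun f \<Longrightarrow> recursive_fun g \<Longrightarrow> recursive_fun (\<lambda>x. code_nth (f x) (g x))"
  unfolding code_nth_def by (intro rf)

lemma triangle_mono: "a \<le> b \<Longrightarrow> triangle a \<le> triangle b"
  by (induction b) (auto simp: le_Suc_eq)

lemma prod_encode_mono: "a \<le> a' \<Longrightarrow> b \<le> b' \<Longrightarrow> prod_encode (a, b) \<le> prod_encode (a', b')"
  using triangle_mono[of "a + b" "a' + b'"] by (simp add: prod_encode_def)

lemma list_encode_mono: "list_all2 (\<le>) xs ys \<Longrightarrow> list_encode xs \<le> list_encode ys"
  by (induction rule: list_all2_induct) (auto intro: prod_encode_mono)

section \<open>The algorithm\<close>

text \<open>The diagonal is skipped in each row; the truncated subtraction shifts the columns to the right of the diagonal by one.\<close>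

definition entry_index :: "nat \<Rightarrow> nat \<Rightarrow> nat \<Rightarrow> nat" where
  "entry_index n i j = i * (n - 1) + (j - (1 - (Suc i - j)))"

definition entry :: "nat \<Rightarrow> nat \<Rightarrow> nat \<Rightarrow> nat" where
  "entry x i j = code_nth (pi2 x) (entry_index (pi1 x) i j)"

text \<open>The numerator and denominator of the absolute value of an entry. On numbers that encode no input they may vanish, and
  are then replaced by \<open>1\<close>: this makes every natural number a solvable input, as minimisation demands.\<close>

definition entry_num :: "nat \<Rightarrow> nat \<Rightarrow> nat \<Rightarrow> nat" where
  "entry_num x i j = (pi1 (entry x i j) + 1) div 2 + (1 - (pi1 (entry x i j) + 1) div 2)"

definition entry_den :: "nat \<Rightarrow> nat \<Rightarrow> nat \<Rightarrow> nat" where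
  "entry_den x i j = (pi2 (entry x i j) + 1) div 2 + (1 - (pi2 (entry x i j) + 1) div 2)"

definition diag_entry :: "nat \<Rightarrow> nat \<Rightarrow> nat" where
  "diag_entry L j = pi1 (code_nth L j) div 2"

text \<open>Codes of diagonals with positive integers \<open>d\<^sub>i\<close> on them. As a rational number \<open>d\<^sub>i\<close> has the code
  \<open>prod_encode (2 * d\<^sub>i, 2)\<close>.\<close>

definition diag_code :: "nat \<Rightarrow> nat \<Rightarrow> bool" where
  "diag_code n L \<longleftrightarrow> code_drop L n = 0 \<and>
     (\<forall>i<n. code_drop L i \<noteq> 0 \<and> code_nth L i = prod_encode (2 * diag_entry L i, 2) \<and> 0 < diag_entry L i)"

definition common_multiple :: "nat \<Rightarrow> nat" where
  "common_multiple x = Suc (LEAST k. \<forall>i<pi1 x. \<forall>j<pi1 x. entry_num x i j dvd Suc k \<and> entry_den x i j dvd Suc k)"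

text \<open>The code of the diagonal with the largest admissible entries. It bounds the codes of all admissible diagonals, because
  the encoding of lists is monotone in each entry.\<close>

definition code_bound :: "nat \<Rightarrow> nat" where
  "code_bound x = rec_nat 0
     (\<lambda>m r. Suc (prod_encode (prod_encode (2 * (common_multiple x * common_multiple x), 2), r))) (pi1 x)"

definition solution :: "nat \<Rightarrow> nat \<Rightarrow> nat \<Rightarrow> bool" where
  "solution x N L \<longleftrightarrow> diag_code (pi1 x) L \<and>
     integral_scaling (pi1 x) (entry_num x) (entry_den x) N (diag_entry L)"

text \<open>The bound on \<open>L\<close> makes the condition on \<open>N\<close> decidable. On encoded inputs it does not change the minimum, since the bound admits a diagonal
  for the product of the bad primes, which divides every other solution.\<close>

definition denominator :: "nat \<Rightarrow> nat" where
  "denominator x = Suc (LEAST k. \<exists>L<Suc (code_bound x). solution x (Suc k) L)"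

definition diagonal :: "nat \<Rightarrow> nat" where
  "diagonal x = (LEAST L. solution x (denominator x) L)"

definition algorithm :: "nat \<Rightarrow> nat" where
  "algorithm x = prod_encode (2 * denominator x, diagonal x)"

lemma rf_pair [rf]: "recursive_fun f \<Longrightarrow> recursive_fun g \<Longrightarrow> recursive_fun (\<lambda>x. prod_encode (f x, g x))"
  by (rule recursive_fun.pair)

lemma entry_num_den_pos [simp]: "0 < entry_num x i j" "0 < entry_den x i j"
  by (auto simp: entry_num_def entry_den_def)

definition encode_diag :: "nat \<Rightarrow> (nat \<Rightarrow> nat) \<Rightarrow> nat" where
  "encode_diag n d = list_encode (map (\<lambda>j. prod_encode (2 * d j, 2)) [0..<n])"

lemma code_nth_encode_diag: "j < n \<Longrightarrow> code_nth (encode_diag n d) j = prod_encode (2 * d j, 2)"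
  by (simp add: encode_diag_def code_nth)

lemma diag_entry_encode_diag: "j < n \<Longrightarrow> diag_entry (encode_diag n d) j = d j"
  by (simp add: diag_entry_def code_nth_encode_diag)

lemma diag_code_encode_diag:
  assumes "\<And>j. j < n \<Longrightarrow> 0 < d j"
  shows "diag_code n (encode_diag n d)"
  using code_length[of "map (\<lambda>j. prod_encode (2 * d j, 2)) [0..<n]" n] assms
  unfolding diag_code_def
  by (simp add: code_nth_encode_diag diag_entry_encode_diag) (simp add: encode_diag_def)

lemma diag_codeD:
  assumes "diag_code n L"
  shows "L = encode_diag n (diag_entry L)" "\<And>j. j < n \<Longrightarrow> 0 < diag_entry L j"
proof -
  define xs where "xs = list_decode L"
  have L: "L = list_encode xs" by (simp add: xs_def)
  have len: "length xs = n" unfolding code_length using assms by (auto simp: diag_code_def L)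
  have "xs = map (\<lambda>j. prod_encode (2 * diag_entry L j, 2)) [0..<n]"
  proof (rule nth_equalityI)
    fix i assume "i < length xs"
    then show "xs ! i = map (\<lambda>j. prod_encode (2 * diag_entry L j, 2)) [0..<n] ! i"
      using assms code_nth[of i xs] len by (simp add: diag_code_def L)
  qed (simp add: len)
  then show "L = encode_diag n (diag_entry L)" using L by (simp add: encode_diag_def)
qed (use assms in \<open>simp add: diag_code_def\<close>)

lemma integral_scaling_cong:
  assumes "\<And>j. j < n \<Longrightarrow> d j = d' j"
  shows "integral_scaling n a b N d = integral_scaling n a b N d'"
  using assms by (simp add: integral_scaling_def)

lemma solution_encode_diag:
  assumes "\<And>j. j < pi1 x \<Longrightarrow> 0 < d j"
  shows "solution x N (encode_diag (pi1 x) d) = integral_scaling (pi1 x) (entry_num x) (entry_den x) N d"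
  unfolding solution_def using diag_code_encode_diag[of "pi1 x" d] assms
    integral_scaling_cong[of "pi1 x" "diag_entry (encode_diag (pi1 x) d)" d]
  by (simp add: diag_entry_encode_diag)

lemma code_bound_eq:
  "code_bound x = list_encode (replicate (pi1 x) (prod_encode (2 * (common_multiple x * common_multiple x), 2)))"
proof -
  have "rec_nat 0 (\<lambda>m r. Suc (prod_encode (c, r))) k = list_encode (replicate k c)" for c k
    by (induction k) auto
  then show ?thesis by (simp add: code_bound_def)
qed

lemma encode_diag_le_code_bound:
  assumes "\<And>j. j < pi1 x \<Longrightarrow> d j \<le> common_multiple x * common_multiple x"
  shows "encode_diag (pi1 x) d < Suc (code_bound x)"
  unfolding code_bound_eq encode_diag_def less_Suc_eq_le
  using assms by (intro list_encode_mono) (auto simp: list_all2_conv_all_nth intro!: prod_encode_mono)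

lemma common_multiple_exists: "\<exists>k. \<forall>i<pi1 x. \<forall>j<pi1 x. entry_num x i j dvd Suc k \<and> entry_den x i j dvd Suc k"
proof -
  define P where "P = (\<Prod>(i, j)\<in>{..<pi1 x} \<times> {..<pi1 x}. entry_num x i j * entry_den x i j)"
  have "entry_num x i j * entry_den x i j dvd P" if "i < pi1 x" "j < pi1 x" for i j
    unfolding P_def
    using dvd_prodI[of "{..<pi1 x} \<times> {..<pi1 x}" "(i, j)" "\<lambda>(i, j). entry_num x i j * entry_den x i j"] that by auto
  moreover have "P > 0" unfolding P_def by (intro prod_pos) auto
  ultimately show ?thesis
    by (intro exI[of _ "P - 1"]) (auto dest: dvd_mult_left dvd_mult_right)
qed

lemma common_multiple:
  "0 < common_multiple x"
  "i < pi1 x \<Longrightarrow> j < pi1 x \<Longrightarrow> entry_num x i j dvd common_multiple x \<and> entry_den x i j dvd common_multiple x"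
  using LeastI_ex[OF common_multiple_exists[of x]] by (auto simp: common_multiple_def)

lemma bounded_solution_exists: "\<exists>k. \<exists>L<Suc (code_bound x). solution x (Suc k) L"
proof -
  have "entry_den x i j dvd entry_num x i j * common_multiple x ^ entry_den x i j" if "i < pi1 x" "j < pi1 x" for i j
  proof -
    have "entry_den x i j dvd common_multiple x" using common_multiple(2)[OF that] by simp
    also have "common_multiple x dvd common_multiple x ^ entry_den x i j" by (rule dvd_power) simp
    finally show ?thesis by simp
  qed
  then have "solution x (common_multiple x) (encode_diag (pi1 x) (\<lambda>j. 1))"
    by (subst solution_encode_diag) (auto simp: integral_scaling_def)
  moreover have "encode_diag (pi1 x) (\<lambda>j. 1) < Suc (code_bound x)"
    using common_multiple(1)[of x] by (intro encode_diag_le_code_bound) auto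
  ultimately show ?thesis using common_multiple(1)[of x] by (metis Suc_pred)
qed

lemma denominator_solution:
  "0 < denominator x" "solution x (denominator x) (diagonal x)"
proof -
  show "0 < denominator x" by (simp add: denominator_def)
  have "\<exists>L. solution x (denominator x) L"
    using LeastI_ex[OF bounded_solution_exists[of x]] unfolding denominator_def by blast
  then show "solution x (denominator x) (diagonal x)" unfolding diagonal_def by (rule LeastI_ex)
qed

lemma denominator_le:
  assumes "0 < N" "\<And>j. 0 < d j \<and> d j \<le> common_multiple x * common_multiple x"
    "integral_scaling (pi1 x) (entry_num x) (entry_den x) N d"
  shows "denominator x \<le> N"
proof -
  have "\<exists>L<Suc (code_bound x). solution x (Suc (N - 1)) L"
    using assms encode_diag_le_code_bound[of x d] solution_encode_diag[of x d N]
    by (intro exI[of _ "encode_diag (pi1 x) d"]) auto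
  then have "(LEAST k. \<exists>L<Suc (code_bound x). solution x (Suc k) L) \<le> N - 1" by (rule Least_le)
  then show ?thesis using assms(1) by (simp add: denominator_def)
qed

lemma rf_entry [rf]:
  assumes "recursive_fun f" "recursive_fun g" "recursive_fun h"
  shows "recursive_fun (\<lambda>z. entry (f z) (g z) (h z))"
  unfolding entry_def entry_index_def by (intro rf assms)

lemma rf_num [rf]:
  assumes "recursive_fun f" "recursive_fun g" "recursive_fun h"
  shows "recursive_fun (\<lambda>z. entry_num (f z) (g z) (h z))"
  unfolding entry_num_def by (intro rf assms)

lemma rf_den [rf]:
  assumes "recursive_fun f" "recursive_fun g" "recursive_fun h"
  shows "recursive_fun (\<lambda>z. entry_den (f z) (g z) (h z))"
  unfolding entry_den_def by (intro rf assms)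

lemma rf_diag_entry [rf]:
  assumes "recursive_fun f" "recursive_fun g"
  shows "recursive_fun (\<lambda>z. diag_entry (f z) (g z))"
  unfolding diag_entry_def by (intro rf assms)

lemma decidable_solution [rf]:
  assumes "recursive_fun f" "recursive_fun g" "recursive_fun h"
  shows "decidable (\<lambda>z. solution (f z) (g z) (h z))"
  unfolding solution_def diag_code_def integral_scaling_def
  by (intro rf assms recursive_fun.comp[OF assms(1)] recursive_fun.comp[OF assms(2)] recursive_fun.comp[OF assms(3)])

lemma rf_common_multiple: "recursive_fun common_multiple"
  unfolding common_multiple_def by (intro rf common_multiple_exists)

lemma rf_code_bound: "recursive_fun code_bound"
  unfolding code_bound_def by (intro rf rf_common_multiple recursive_fun.comp[OF rf_common_multiple])

lemma rf_denominator: "recursive_fun denominator"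
  unfolding denominator_def
  by (intro rf bounded_solution_exists recursive_fun.comp[OF rf_code_bound])

lemma rf_diagonal: "recursive_fun diagonal"
  unfolding diagonal_def
proof (intro rf recursive_fun.comp[OF rf_denominator])
  show "\<exists>L. solution x (denominator x) L" for x using denominator_solution(2) by blast
qed

lemma rf_algorithm: "recursive_fun algorithm"
  unfolding algorithm_def by (intro rf rf_denominator rf_diagonal)

lemma nth_concat_uniform:
  assumes "\<And>ys. ys \<in> set xss \<Longrightarrow> length ys = m" "i < length xss" "j < m"
  shows "i * m + j < length (concat xss)" "concat xss ! (i * m + j) = xss ! i ! j"
  using assms
proof (induction xss arbitrary: i)
  case (Cons ys xss)
  {
    case 1
    then show ?case using Cons.IH(1)[of "i - 1"] by (cases i) auto
  next
    case 2
    then show ?case using Cons.IH(2)[of "i - 1"] by (cases i) (auto simp: nth_append)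
  }
qed auto

lemma code_nth_input:
  assumes ij: "i < n" "j < n" "i \<noteq> j"
  shows "entry (encode_input n Q) i j = encode_rat (Q i j)"
proof -
  define row where "row i = concat (map (\<lambda>j. if i \<noteq> j then [encode_rat (Q i j)] else []) [0..<n])" for i
  have row: "row i = map (\<lambda>j. encode_rat (Q i j)) ([0..<i] @ [Suc i..<n])" if i: "i < n" for i
  proof -
    have "[0..<n] = [0..<i] @ i # [Suc i..<n]"
      using i by (metis upt_add_eq_append upt_conv_Cons le_add_diff_inverse less_imp_le zero_le)
    moreover have "concat (map (\<lambda>j. if i \<noteq> j then [encode_rat (Q i j)] else []) xs) = map (\<lambda>j. encode_rat (Q i j)) xs"
      if "i \<notin> set xs" for xs using that by (induction xs) auto
    ultimately show ?thesis by (simp add: row_def)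
  qed
  have len: "length (row i) = n - 1" if "i < n" for i using that by (simp add: row)
  define k where "k = j - (1 - (Suc i - j))"
  have k: "k < n - 1" using ij by (auto simp: k_def)
  have rk: "row i ! k = encode_rat (Q i j)"
  proof (cases "j < i")
    case True
    then show ?thesis using ij by (simp add: row k_def nth_append)
  next
    case False
    then have "k = j - 1" "i \<le> k" using ij by (auto simp: k_def)
    then show ?thesis using ij False by (simp add: row nth_append)
  qed
  have "concat (map row [0..<n]) ! (i * (n - 1) + k) = map row [0..<n] ! i ! k"
    and "i * (n - 1) + k < length (concat (map row [0..<n]))"
    by (rule nth_concat_uniform; use len k ij in auto)+
  then have "code_nth (list_encode (concat (map row [0..<n]))) (i * (n - 1) + k) = encode_rat (Q i j)"
    using rk ij by (simp add: code_nth)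
  then show ?thesis
    by (simp add: entry_def entry_index_def encode_input_def row_def[abs_def] k_def)
qed

lemma int_encode_abs: "(int_encode a + 1) div 2 = nat \<bar>a\<bar>"
  by (auto simp: int_encode_def sum_encode_def)

lemma input_num_den:
  assumes ij: "i < n" "j < n" "i \<noteq> j" and Q: "Q i j \<noteq> 0"
  shows "\<bar>Q i j\<bar> = of_nat (entry_num (encode_input n Q) i j) / of_nat (entry_den (encode_input n Q) i j)"
proof -
  obtain a b where ab: "quotient_of (Q i j) = (a, b)" by (cases "quotient_of (Q i j)") auto
  have q: "Q i j = of_int a / of_int b" "b > 0" using ab quotient_of_div quotient_of_denom_pos by auto
  have "a \<noteq> 0" using Q q by auto
  moreover have "encode_rat (Q i j) = prod_encode (int_encode a, int_encode b)"
    by (simp add: encode_rat_def ab)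
  ultimately have "entry_num (encode_input n Q) i j = nat \<bar>a\<bar>" "entry_den (encode_input n Q) i j = nat \<bar>b\<bar>"
    using q(2) by (simp_all add: entry_num_def entry_den_def code_nth_input[OF ij] int_encode_abs[unfolded Suc_eq_plus1[symmetric]])
  then show ?thesis using q by (simp add: abs_divide)
qed

text \<open>Connects the numerical output with the prescribed encoding: nonnegative integers \<open>m\<close> are encoded by \<open>2 m\<close>.\<close>

lemma encode_output_diag:
  assumes "\<And>i. i < n \<Longrightarrow> g $$ (i, i) = of_nat (d i)" "g \<in> carrier_mat n n"
  shows "encode_output (int N) g = prod_encode (2 * N, encode_diag n d)"
proof -
  have nat: "int_encode (int m) = 2 * m" for m by (simp add: int_encode_def sum_encode_def)
  have "encode_rat (of_nat m) = prod_encode (2 * m, 2)" for m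
    using nat[of m] nat[of 1] by (simp add: encode_rat_def quotient_of_int[of "int m", simplified])
  then have "map encode_rat (diag_mat g) = map (\<lambda>j. prod_encode (2 * d j, 2)) [0..<n]"
    using assms by (simp add: diag_mat_def)
  then show ?thesis
    using nat[of N] by (simp add: encode_output_def encode_diag_def)
qed

section \<open>Conjugation by diagonal matrices\<close>

definition diagonal_matrix :: "nat \<Rightarrow> (nat \<Rightarrow> 'a :: field) \<Rightarrow> 'a mat" where
  "diagonal_matrix n f = mat n n (\<lambda>(i, j). if i = j then f i else 0)"

lemma diagonal_matrix_simps [simp]:
  "diagonal_matrix n f \<in> carrier_mat n n"
  "dim_row (diagonal_matrix n f) = n" "dim_col (diagonal_matrix n f) = n"
  "i < n \<Longrightarrow> j < n \<Longrightarrow> diagonal_matrix n f $$ (i, j) = (if i = j then f i else 0)"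
  by (simp_all add: diagonal_matrix_def)

lemma diagonal_matrix_mult_index:
  assumes M: "M \<in> carrier_mat n n" and ij: "i < n" "j < n"
  shows "(diagonal_matrix n f * M) $$ (i, j) = f i * M $$ (i, j)"
    "(M * diagonal_matrix n f) $$ (i, j) = M $$ (i, j) * f j"
proof -
  have "(diagonal_matrix n f * M) $$ (i, j) = (\<Sum>k = 0..<n. diagonal_matrix n f $$ (i, k) * M $$ (k, j))"
    by (rule mat_mult_index) (use M ij in auto)
  also have "\<dots> = (\<Sum>k = 0..<n. if k = i then f k * M $$ (k, j) else 0)"
    by (rule sum.cong) (use ij in auto)
  finally show "(diagonal_matrix n f * M) $$ (i, j) = f i * M $$ (i, j)" using ij by simp
  have "(M * diagonal_matrix n f) $$ (i, j) = (\<Sum>k = 0..<n. M $$ (i, k) * diagonal_matrix n f $$ (k, j))"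
    by (rule mat_mult_index) (use M ij in auto)
  also have "\<dots> = (\<Sum>k = 0..<n. if k = j then M $$ (i, k) * f k else 0)"
    by (rule sum.cong) (use ij in auto)
  finally show "(M * diagonal_matrix n f) $$ (i, j) = M $$ (i, j) * f j" using ij by simp
qed

lemma diagonal_matrix_mult: "diagonal_matrix n f * diagonal_matrix n h = diagonal_matrix n (\<lambda>i. f i * h i)"
  by (rule eq_matI) (auto simp: diagonal_matrix_mult_index(1)[OF diagonal_matrix_simps(1)] simp del: index_mult_mat(1))

lemma diagonal_matrix_inverse:
  assumes "\<forall>i<n. f i \<noteq> 0"
  shows "diagonal_matrix n f * diagonal_matrix n (\<lambda>i. inverse (f i)) = 1\<^sub>m n"
    "diagonal_matrix n (\<lambda>i. inverse (f i)) * diagonal_matrix n f = 1\<^sub>m n"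
  unfolding diagonal_matrix_mult by (rule eq_matI; use assms in simp)+

lemma diagonal_matrix_GL:
  assumes "\<forall>i<n. f i \<noteq> 0"
  shows "diagonal_matrix n f \<in> carrier (GL n)"
  using diagonal_matrix_inverse[OF assms]
  by (auto simp: GL_def invertible_mat_def inverts_mat_def square_mat.simps
      intro!: exI[of _ "diagonal_matrix n (\<lambda>i. inverse (f i))"])

lemma inv_GL_diagonal_matrix:
  assumes f: "\<forall>i<n. f i \<noteq> 0"
  shows "inv\<^bsub>GL n\<^esub> diagonal_matrix n f = diagonal_matrix n (\<lambda>i. inverse (f i))"
    (is "_ = ?D'")
  unfolding m_inv_def
proof (rule the_equality)
  let ?D = "diagonal_matrix n f"
  have "?D' \<in> carrier (GL n)" by (rule diagonal_matrix_GL) (use f in auto)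
  then show "?D' \<in> carrier (GL n) \<and> ?D \<otimes>\<^bsub>GL n\<^esub> ?D' = \<one>\<^bsub>GL n\<^esub> \<and> ?D' \<otimes>\<^bsub>GL n\<^esub> ?D = \<one>\<^bsub>GL n\<^esub>"
    using diagonal_matrix_inverse[OF f] by (simp add: GL_def)
  fix y assume "y \<in> carrier (GL n) \<and> ?D \<otimes>\<^bsub>GL n\<^esub> y = \<one>\<^bsub>GL n\<^esub> \<and> y \<otimes>\<^bsub>GL n\<^esub> ?D = \<one>\<^bsub>GL n\<^esub>"
  then have y: "y \<in> carrier_mat n n" "?D * y = 1\<^sub>m n" by (auto simp: GL_def)
  have "?D' * 1\<^sub>m n = ?D'" by (rule right_mult_one_mat[OF diagonal_matrix_simps(1)])
  moreover have "(?D' * ?D) * y = ?D' * (?D * y)"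
    by (rule assoc_mult_mat[OF diagonal_matrix_simps(1) diagonal_matrix_simps(1) y(1)])
  moreover have "1\<^sub>m n * y = y" using y by simp
  ultimately show "y = ?D'" unfolding y diagonal_matrix_inverse(2)[OF f] by simp
qed

definition diag_conj :: "nat \<Rightarrow> (nat \<Rightarrow> real) \<Rightarrow> real mat \<Rightarrow> real mat" where
  "diag_conj n f M = diagonal_matrix n f * M * diagonal_matrix n (\<lambda>i. inverse (f i))"

lemma diag_conj_carrier [simp]:
  "diag_conj n f M \<in> carrier_mat n n" "dim_row (diag_conj n f M) = n" "dim_col (diag_conj n f M) = n"
  by (auto simp: diag_conj_def intro: carrier_matI)

lemma diag_conj_index:
  assumes "M \<in> carrier_mat n n" "i < n" "j < n"
  shows "diag_conj n f M $$ (i, j) = f i * M $$ (i, j) / f j"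
proof -
  have "diagonal_matrix n f * M \<in> carrier_mat n n" using assms by (simp add: mult_carrier_mat[of _ n n])
  then show ?thesis
    using assms by (simp add: diag_conj_def diagonal_matrix_mult_index divide_inverse del: index_mult_mat(1))
qed

lemma diag_conj_elem_mat:
  assumes "i < n" "j < n" "i \<noteq> j" "\<forall>k<n. f k \<noteq> 0"
  shows "diag_conj n f (elem_mat n i j t) = elem_mat n i j (f i * t / f j)"
  unfolding elem_mat_transvection(1)[OF assms(1,2)]
  by (rule eq_matI) (use assms in \<open>auto simp: diag_conj_index\<close>)

lemma diag_conj_hom:
  assumes f: "\<forall>i<n. f i \<noteq> 0"
  shows "group_hom (SL n UNIV) (SL n UNIV) (diag_conj n f)"
proof -
  let ?D = "diagonal_matrix n f" and ?D' = "diagonal_matrix n (\<lambda>i. inverse (f i))"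
  have det: "det ?D * det ?D' = 1"
    using det_mult[of ?D n ?D'] diagonal_matrix_inverse(1)[OF f] by simp
  have "diag_conj n f \<in> hom (SL n UNIV) (SL n UNIV)"
  proof (rule homI)
    fix M assume M: "M \<in> carrier (SL n UNIV)"
    then have Mc: "M \<in> carrier_mat n n" by auto
    have "det (diag_conj n f M) = det ?D * det M * det ?D'"
      unfolding diag_conj_def using Mc
      by (simp add: det_mult[of _ n] mult_carrier_mat[of _ n n])
    then show "diag_conj n f M \<in> carrier (SL n UNIV)" using M det Mc by (simp add: SL_carrier)
    fix M' assume M': "M' \<in> carrier (SL n UNIV)"
    then have M'c: "M' \<in> carrier_mat n n" by auto
    show "diag_conj n f (M \<otimes>\<^bsub>SL n UNIV\<^esub> M') = diag_conj n f M \<otimes>\<^bsub>SL n UNIV\<^esub> diag_conj n f M'"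
    proof (rule eq_matI)
      fix i j assume "i < dim_row (diag_conj n f M \<otimes>\<^bsub>SL n UNIV\<^esub> diag_conj n f M')"
        "j < dim_col (diag_conj n f M \<otimes>\<^bsub>SL n UNIV\<^esub> diag_conj n f M')"
      then have ij: "i < n" "j < n" by (simp_all add: diag_conj_def diagonal_matrix_def)
      have "diag_conj n f (M * M') $$ (i, j) = (\<Sum>k = 0..<n. f i * (M $$ (i, k) * M' $$ (k, j)) / f j)"
        using ij Mc M'c mat_mult_index[OF Mc M'c ij] mult_carrier_mat[OF Mc M'c]
        by (simp add: diag_conj_index sum_distrib_left sum_divide_distrib del: index_mult_mat(1))
      also have "\<dots> = (\<Sum>k = 0..<n. diag_conj n f M $$ (i, k) * diag_conj n f M' $$ (k, j))"
        by (rule sum.cong) (use ij Mc M'c f in \<open>auto simp: diag_conj_index\<close>)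
      also have "\<dots> = (diag_conj n f M * diag_conj n f M') $$ (i, j)"
        using mat_mult_index[OF diag_conj_carrier(1) diag_conj_carrier(1) ij] by simp
      finally show "diag_conj n f (M \<otimes>\<^bsub>SL n UNIV\<^esub> M') $$ (i, j) =
          (diag_conj n f M \<otimes>\<^bsub>SL n UNIV\<^esub> diag_conj n f M') $$ (i, j)" by simp
    qed (simp_all add: diag_conj_def diagonal_matrix_def)
  qed
  then show ?thesis by (intro group_hom.intro group_hom_axioms.intro SL_UNIV_group)
qed

lemma diag_conj_inj:
  assumes f: "\<forall>i<n. f i \<noteq> 0" and M: "M \<in> carrier_mat n n" "M' \<in> carrier_mat n n"
    and eq: "diag_conj n f M = diag_conj n f M'"
  shows "M = M'"
proof (rule eq_matI)
  fix i j assume "i < dim_row M'" "j < dim_col M'"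
  then have ij: "i < n" "j < n" using M by auto
  have "f i * M $$ (i, j) / f j = f i * M' $$ (i, j) / f j"
    using diag_conj_index[OF M(1) ij] diag_conj_index[OF M(2) ij] eq by metis
  then show "M $$ (i, j) = M' $$ (i, j)" using f ij by simp
qed (use M in auto)

section \<open>S-integers\<close>

lemma dvd_power_if_prime_divisors:
  fixes d N :: nat
  assumes "d > 0" "N > 0" "\<And>p. prime p \<Longrightarrow> p dvd d \<Longrightarrow> p dvd N"
  shows "d dvd N ^ d"
proof (rule multiplicity_le_imp_dvd)
  fix p :: nat assume p: "prime p"
  show "multiplicity p d \<le> multiplicity p (N ^ d)"
  proof (cases "p dvd d")
    case True
    then have "multiplicity p N \<ge> 1" using assms p
      by (metis One_nat_def Suc_leI not_prime_unit multiplicity_gt_zero_iff less_numeral_extra(3))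
    then have "d \<le> multiplicity p (N ^ d)"
      using p assms by (simp add: prime_elem_multiplicity_power_distrib)
    then show ?thesis using multiplicity_le_self[OF assms(1) p] by simp
  qed (simp add: not_dvd_imp_multiplicity_0)
qed (use assms in simp)

lemma S_integers_eq_Z_inv:
  fixes N :: nat
  assumes N: "N > 0"
  shows "S_integers (insert Archimedean (Finite ` {p. prime p \<and> p dvd N})) = Z_inv (int N)"
proof -
  have S: "S_integers (insert Archimedean (Finite ` {p. prime p \<and> p dvd N})) =
      of_rat ` {x. x = 0 \<or> (\<forall>p. prime p \<and> \<not> p dvd N \<longrightarrow> padic_val p x \<ge> 0)}"
    unfolding S_integers_def by (auto intro!: arg_cong[of _ _ "(`) of_rat"])
  show ?thesis
  proof
    show "S_integers (insert Archimedean (Finite ` {p. prime p \<and> p dvd N})) \<subseteq> Z_inv (int N)"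
      unfolding S
    proof safe
      show "of_rat 0 \<in> Z_inv (int N)" using Z_invI[of 0 "int N" 0] by simp
    next
      fix x :: rat assume x: "\<forall>p. prime p \<and> \<not> p dvd N \<longrightarrow> padic_val p x \<ge> 0"
      obtain c d where cd: "quotient_of x = (c, d)" by (cases "quotient_of x") auto
      have xcd: "x = of_int c / of_int d" "d > 0" "coprime c d"
        using cd quotient_of_div quotient_of_denom_pos quotient_of_coprime by auto
      have "nat d dvd N ^ nat d"
      proof (rule dvd_power_if_prime_divisors)
        fix p assume p: "prime p" "p dvd nat d"
        have pd: "int p dvd d" using p(2) xcd(2) by (simp add: nat_dvd_iff int_dvd_int_iff[symmetric])
        then have "\<not> int p dvd c"
          using xcd(3) p(1) by (metis coprime_common_divisor not_prime_unit prime_nat_int_transfer)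
        then have "multiplicity (int p) c = 0" by (rule not_dvd_imp_multiplicity_0)
        moreover have "multiplicity (int p) d > 0"
        proof -
          have "\<not> int p dvd 1" using p(1) by (metis not_prime_unit prime_nat_int_transfer)
          then show ?thesis using multiplicity_gt_zero_iff[of d "int p"] pd xcd(2) by simp
        qed
        ultimately have "padic_val p x < 0" by (simp add: padic_val_def cd)
        then show "p dvd N" using x p(1) by (meson not_le)
      qed (use xcd N in auto)
      then obtain m where m: "N ^ nat d = nat d * m" by (auto simp: dvd_def)
      have "(of_nat N :: rat) ^ nat d = of_int d * of_nat m"
        using arg_cong[OF m, of "of_nat :: nat \<Rightarrow> rat"] xcd(2) by simp
      moreover have "m \<noteq> 0" using m N by (cases "m = 0") auto
      ultimately have "x = of_int (c * int m) / of_int (int N) ^ nat d"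
        using xcd(1,2) N by (simp add: field_simps)
      then have "of_rat x = (of_int (c * int m) / of_int (int N) ^ nat d :: real)"
        by (simp add: of_rat_divide of_rat_mult of_rat_power)
      then show "of_rat x \<in> Z_inv (int N)" by (metis Z_invI)
    qed
    show "Z_inv (int N) \<subseteq> S_integers (insert Archimedean (Finite ` {p. prime p \<and> p dvd N}))"
    proof
      fix y assume "y \<in> Z_inv (int N)"
      then obtain a k where y: "y = of_int a / of_int (int N) ^ k" by (auto simp: Z_inv_def)
      define x :: rat where "x = of_int a / of_int (int N ^ k)"
      have "y = of_rat x" by (simp add: x_def y of_rat_divide of_rat_power)
      moreover have "padic_val p x \<ge> 0" if "prime p" "\<not> p dvd N" "x \<noteq> 0" for p
      proof -
        have "\<not> int p dvd int N ^ k" using that by (metis int_dvd_int_iff prime_dvd_power prime_nat_int_transfer)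
        then have "multiplicity (int p) (int N ^ k) = 0" by (rule not_dvd_imp_multiplicity_0)
        moreover have "a \<noteq> 0" using that by (auto simp: x_def)
        ultimately show ?thesis
          using padic_val_quotient[OF that(1), of a "int N ^ k"] N by (simp add: x_def)
      qed
      ultimately show "y \<in> S_integers (insert Archimedean (Finite ` {p. prime p \<and> p dvd N}))"
        unfolding S by blast
    qed
  qed
qed

section \<open>Arithmeticity of the group\<close>

lemma prod_primes_dvd:
  fixes N :: nat
  assumes "finite F" "\<And>p. p \<in> F \<Longrightarrow> prime p \<and> p dvd N"
  shows "\<Prod>F dvd N"
  using assms
proof (induction F rule: finite_induct)
  case (insert p F)
  have "coprime p (\<Prod>F)"
    using insert by (intro prod_coprime_right) (metis insertCI primes_coprime)
  then show ?case using insert by (simp add: divides_mult)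
qed simp

lemma elem_mat_zero: "elem_mat n i j 0 = 1\<^sub>m n"
  by (rule eq_matI) (auto simp: elem_mat_def matrix_unit_def)

lemma inv_elem_mat:
  assumes "i < n" "j < n" "i \<noteq> j"
  shows "inv\<^bsub>SL n UNIV\<^esub> elem_mat n i j t = elem_mat n i j (- t)"
  by (rule group.inv_equality[OF SL_UNIV_group])
     (use elem_mat_mult[OF assms, of "- t" t] elem_mat_SL[OF assms] in \<open>simp_all add: elem_mat_zero\<close>)

lemma Gamma_subgroup: "subgroup (Gamma n Q) (SL n UNIV)"
  unfolding Gamma_def by (rule group.generate_is_subgroup[OF SL_UNIV_group]) (use elem_mat_SL in auto)

lemma Gamma_rat_net:
  assumes n: "n \<ge> 3" and Q: "\<forall>i<n. \<forall>j<n. i \<noteq> j \<longrightarrow> Q i j \<noteq> 0"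
  shows "rat_net n (\<lambda>i j. {x. elem_mat n i j (of_rat x) \<in> Gamma n Q}) Q"
proof -
  interpret \<Gamma>: subgroup "Gamma n Q" "SL n UNIV" by (rule Gamma_subgroup)
  show ?thesis
  proof
    fix i j x y assume ij: "i < n" "j < n" "i \<noteq> j" and "x \<in> {x. elem_mat n i j (of_rat x) \<in> Gamma n Q}"
      "y \<in> {x. elem_mat n i j (of_rat x) \<in> Gamma n Q}"
    then have "elem_mat n i j (of_rat x) \<in> Gamma n Q" "elem_mat n i j (- of_rat y) \<in> Gamma n Q"
      using \<Gamma>.m_inv_closed[of "elem_mat n i j (of_rat y)"] inv_elem_mat[OF ij] by auto
    then have "elem_mat n i j (of_rat x) * elem_mat n i j (- of_rat y) \<in> Gamma n Q"
      using \<Gamma>.m_closed by simp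
    then show "x - y \<in> {x. elem_mat n i j (of_rat x) \<in> Gamma n Q}"
      using elem_mat_mult[OF ij] by (simp add: of_rat_diff)
  next
    fix i j k x y assume ijk: "i < n" "j < n" "k < n" "i \<noteq> j" "j \<noteq> k" "i \<noteq> k" and
      "x \<in> {x. elem_mat n i j (of_rat x) \<in> Gamma n Q}" "y \<in> {x. elem_mat n j k (of_rat x) \<in> Gamma n Q}"
    then have "elem_mat n i j (of_rat x) \<in> Gamma n Q" "elem_mat n j k (of_rat y) \<in> Gamma n Q" by auto
    then have "elem_mat n i k (of_rat x * of_rat y) \<in> Gamma n Q"
      by (rule SL_commutator_mem[OF Gamma_subgroup])
         (use ijk elem_mat_commutator[of i n k j "of_rat x" "of_rat y"] in \<open>auto simp: elem_mat_transvection\<close>)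
    then show "x * y \<in> {x. elem_mat n i k (of_rat x) \<in> Gamma n Q}" by (simp add: of_rat_mult)
  next
    fix i j assume "i < n" "j < n" "i \<noteq> j"
    then show "Q i j \<in> {x. elem_mat n i j (of_rat x) \<in> Gamma n Q}"
      unfolding Gamma_def by (auto intro!: generate.incl)
  qed (use n Q in auto)
qed

lemma integral_scaling_Z_inv:
  assumes d: "d i > 0" "d j > 0" and ab: "a i j > 0" "b i j > 0" "\<bar>q\<bar> = of_nat (a i j) / of_nat (b i j)"
    and N: "N > 0" and ij: "i < n" "j < n" "i \<noteq> j" and sc: "integral_scaling n a b N d"
  shows "of_nat (d i) * of_rat q / of_nat (d j) \<in> Z_inv (int N)"
proof -
  interpret Z: real_subring "Z_inv (int N)" by (rule real_subring_Z_inv) (use N in simp)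
  define e where "e = d j * b i j"
  obtain m where m: "d i * a i j * N ^ e = e * m"
    using sc ij unfolding integral_scaling_def e_def by (metis dvd_def)
  have eq: "real (d i) * real (a i j) * real N ^ e = real (d j) * real (b i j) * real m"
    using arg_cong[OF m, of real] by (simp add: e_def)
  have "\<bar>of_rat q\<bar> = real (a i j) / real (b i j)"
  proof -
    have "\<bar>of_rat q :: real\<bar> = of_rat \<bar>q\<bar>" by (cases "q \<ge> 0") (simp_all add: of_rat_minus)
    then show ?thesis unfolding ab(3) by (simp add: of_rat_divide)
  qed
  moreover have "real (d i) * (real (a i j) / real (b i j)) / real (d j) = real_of_int (int m) / real_of_int (int N) ^ e"
    using eq d ab(1,2) N by (simp add: field_simps)
  ultimately have "real (d i) * \<bar>of_rat q\<bar> / real (d j) = real_of_int (int m) / real_of_int (int N) ^ e"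
    by metis
  then have mem: "real (d i) * \<bar>of_rat q\<bar> / real (d j) \<in> Z_inv (int N)" using Z_invI by metis
  show ?thesis
  proof (cases "(of_rat q :: real) \<ge> 0")
    case False
    then show ?thesis using Z.minus_mem[OF mem] by (simp add: of_rat_minus)
  qed (use mem in simp)
qed

lemma diag_conj_Gamma_subset:
  assumes N: "N \<noteq> 0" and f: "\<forall>i<n. f i \<noteq> 0"
    and integral: "\<And>i j. i < n \<Longrightarrow> j < n \<Longrightarrow> i \<noteq> j \<Longrightarrow> f i * of_rat (Q i j) / f j \<in> Z_inv N"
  shows "diag_conj n f ` Gamma n Q \<subseteq> carrier (SL n (Z_inv N))"
proof -
  let ?E = "{elem_mat n i j (of_rat (Q i j)) | i j. i < n \<and> j < n \<and> i \<noteq> j}"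
  interpret Z: real_subring "Z_inv N" by (rule real_subring_Z_inv[OF N])
  interpret U: group "SL n UNIV" by (rule SL_UNIV_group)
  interpret c: group_hom "SL n UNIV" "SL n UNIV" "diag_conj n f" by (rule diag_conj_hom[OF f])
  have EU: "?E \<subseteq> carrier (SL n UNIV)" using elem_mat_SL by auto
  have "diag_conj n f ` ?E \<subseteq> carrier (SL n (Z_inv N))"
  proof safe
    fix i j assume ij: "i < n" "j < n" "i \<noteq> j"
    show "diag_conj n f (elem_mat n i j (of_rat (Q i j))) \<in> carrier (SL n (Z_inv N))"
      unfolding diag_conj_elem_mat[OF ij f] by (rule Z.elem_mat_SL_ring[OF ij integral[OF ij]])
  qed
  then have "generate (SL n UNIV) (diag_conj n f ` ?E) \<subseteq> carrier (SL n (Z_inv N))"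
    by (rule U.generate_subgroup_incl[OF _ Z.SL_subgroup])
  then show ?thesis
    unfolding Gamma_def using c.generate_img[OF EU] by simp
qed

text \<open>Both halves of commensurability reduce to the finite index theorem. In \<open>SL(n, A)\<close> it applies to \<open>\<Gamma> \<inter> SL(n, A)\<close>. In
  \<open>\<Gamma>\<close> it is applied after conjugation, since \<open>g \<Gamma> g\<^sup>-\<^sup>1 \<subseteq> SL(n, A)\<close>; there the multiples of \<open>t\<close> are replaced by multiples of
  \<open>t d\<^sub>1 ... d\<^sub>n\<close>, which absorbs the factors \<open>d\<^sub>i / d\<^sub>j\<close>.\<close>

theorem Gamma_arithmetic:
  fixes N :: nat and d :: "nat \<Rightarrow> nat"
  assumes n: "n \<ge> 3" and N: "N > 0" and d: "\<And>j. j < n \<Longrightarrow> d j > 0" and t: "t \<noteq> 0"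
    and integral: "\<And>i j. i < n \<Longrightarrow> j < n \<Longrightarrow> i \<noteq> j \<Longrightarrow> of_nat (d i) * of_rat (Q i j) / of_nat (d j) \<in> Z_inv (int N)"
    and divisible: "\<And>i j a. i < n \<Longrightarrow> j < n \<Longrightarrow> i \<noteq> j \<Longrightarrow> a \<in> Z_inv (int N) \<Longrightarrow> elem_mat n i j (of_int t * a) \<in> Gamma n Q"
  shows "finite_index_subgroup (diag_conj n (\<lambda>i. of_nat (d i)) ` Gamma n Q) (SL n (Z_inv (int N)))"
    "S_arithmetic n (insert Archimedean (Finite ` {p. prime p \<and> p dvd N})) (Gamma n Q)"
proof -
  let ?A = "Z_inv (int N)" and ?U = "SL n (UNIV :: real set)" and ?\<Gamma> = "Gamma n Q"
  let ?c = "diag_conj n (\<lambda>i. of_nat (d i))"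
  let ?E = "{elem_mat n i j (of_rat (Q i j)) | i j. i < n \<and> j < n \<and> i \<noteq> j}"
  have N0: "int N \<noteq> 0" using N by simp
  have dnz: "\<forall>i<n. real (d i) \<noteq> 0" using d by fastforce
  interpret Z: real_subring ?A by (rule real_subring_Z_inv[OF N0])
  interpret U: group ?U by (rule SL_UNIV_group)
  interpret S: group "SL n ?A" by (rule Z.group_SL)
  interpret c: group_hom ?U ?U ?c by (rule diag_conj_hom[OF dnz])
  interpret \<Gamma>: subgroup ?\<Gamma> ?U by (rule Gamma_subgroup)
  have c\<Gamma>: "?c ` ?\<Gamma> \<subseteq> carrier (SL n ?A)"
    by (rule diag_conj_Gamma_subset[OF N0 dnz integral])
  have sub_c: "subgroup (?c ` H) ?U" if "subgroup H ?U" for H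
    using c.subgroup_img_is_subgroup[OF that] .
  define L where "L = ?\<Gamma> \<inter> carrier (SL n ?A)"
  have L: "subgroup L ?U" unfolding L_def by (rule U.subgroups_Inter_pair[OF Gamma_subgroup Z.SL_subgroup])
  have elemL: "elem_mat n i j (of_int t * a) \<in> L" if "i < n" "j < n" "i \<noteq> j" "a \<in> ?A" for i j a
    using divisible[OF that] Z.elem_mat_SL_ring[OF that(1-3) Z.mult_mem[OF Z.of_int_mem that(4)]]
    by (simp add: L_def)
  define t' where "t' = t * int (\<Prod>k<n. d k)"
  have t': "t' \<noteq> 0" using t d by (auto simp: t'_def)
  have elemcL: "elem_mat n i j (of_int t' * a) \<in> ?c ` L" if ij: "i < n" "j < n" "i \<noteq> j" and a: "a \<in> ?A" for i j a
  proof -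
    have prod: "(\<Prod>k<n. d k) = d i * (\<Prod>k\<in>{..<n} - {i}. d k)"
      using ij by (intro prod.remove) auto
    define s where "s = of_int (int ((\<Prod>k\<in>{..<n} - {i}. d k) * d j)) * a"
    have s: "s \<in> ?A" unfolding s_def by (rule Z.mult_mem[OF Z.of_int_mem a])
    have "real (d i) * (of_int t * s) / real (d j) = of_int t' * a"
      using d[OF ij(1)] d[OF ij(2)] by (simp add: s_def t'_def prod)
    then have "?c (elem_mat n i j (of_int t * s)) = elem_mat n i j (of_int t' * a)"
      unfolding diag_conj_elem_mat[OF ij dnz] by simp
    then show ?thesis using elemL[OF ij s] by (metis imageI)
  qed
  obtain \<phi> where \<phi>: "finite (\<phi> ` carrier (SL n ?A))"
    "\<And>x y. x \<in> carrier (SL n ?A) \<Longrightarrow> y \<in> carrier (SL n ?A) \<Longrightarrow> (\<phi> x :: real mat set) = \<phi> y \<Longrightarrow> x * inv\<^bsub>?U\<^esub> y \<in> ?c ` L"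
    using Z_inv_elementary_finite_index[OF n N0 t' sub_c[OF L] elemcL] by blast
  obtain \<psi> where \<psi>: "finite (\<psi> ` carrier (SL n ?A))"
    "\<And>x y. x \<in> carrier (SL n ?A) \<Longrightarrow> y \<in> carrier (SL n ?A) \<Longrightarrow> (\<psi> x :: real mat set) = \<psi> y \<Longrightarrow> x * inv\<^bsub>?U\<^esub> y \<in> L"
    using Z_inv_elementary_finite_index[OF n N0 t L elemL] by blast
  have SU: "SL n ?A = ?U\<lparr>carrier := carrier (SL n ?A)\<rparr>" by (rule SL_carrier_update)
  show "finite_index_subgroup (?c ` ?\<Gamma>) (SL n ?A)"
    unfolding finite_index_subgroup_def
  proof
    show sg: "subgroup (?c ` ?\<Gamma>) (SL n ?A)"
      using U.subgroup_incl[OF sub_c[OF Gamma_subgroup] Z.SL_subgroup c\<Gamma>] SU by metis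
    show "finite (rcosets\<^bsub>SL n ?A\<^esub> (?c ` ?\<Gamma>))"
    proof (rule S.finite_rcosetsI[OF sg \<phi>(1)])
      fix x y assume "x \<in> carrier (SL n ?A)" "y \<in> carrier (SL n ?A)" "\<phi> x = \<phi> y"
      then show "x \<otimes>\<^bsub>SL n ?A\<^esub> inv\<^bsub>SL n ?A\<^esub> y \<in> ?c ` ?\<Gamma>"
        using \<phi>(2)[of x y] Z.inv_SL_eq[of y n] by (auto simp: L_def)
    qed
  qed
  have LS: "finite_index_subgroup L (SL n ?A)"
    unfolding finite_index_subgroup_def
  proof
    show sg: "subgroup L (SL n ?A)"
      using U.subgroup_incl[OF L Z.SL_subgroup] SU by (metis L_def Int_lower2)
    show "finite (rcosets\<^bsub>SL n ?A\<^esub> L)"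
    proof (rule S.finite_rcosetsI[OF sg \<psi>(1)])
      fix x y assume "x \<in> carrier (SL n ?A)" "y \<in> carrier (SL n ?A)" "\<psi> x = \<psi> y"
      then show "x \<otimes>\<^bsub>SL n ?A\<^esub> inv\<^bsub>SL n ?A\<^esub> y \<in> L"
        using \<psi>(2)[of x y] Z.inv_SL_eq[of y n] by simp
    qed
  qed
  interpret G: group "?U\<lparr>carrier := ?\<Gamma>\<rparr>" by (rule \<Gamma>.subgroup_is_group[OF U.is_group])
  have LG: "finite_index_subgroup L (?U\<lparr>carrier := ?\<Gamma>\<rparr>)"
    unfolding finite_index_subgroup_def
  proof
    show sg: "subgroup L (?U\<lparr>carrier := ?\<Gamma>\<rparr>)"
      using U.subgroup_incl[OF L Gamma_subgroup] by (simp add: L_def)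
    show "finite (rcosets\<^bsub>?U\<lparr>carrier := ?\<Gamma>\<rparr>\<^esub> L)"
    proof (rule G.finite_rcosetsI[OF sg, of "\<lambda>x. \<phi> (?c x)"])
      show "finite ((\<lambda>x. \<phi> (?c x)) ` carrier (?U\<lparr>carrier := ?\<Gamma>\<rparr>))"
        by (rule finite_subset[OF _ \<phi>(1)]) (use c\<Gamma> in auto)
      fix x y assume "x \<in> carrier (?U\<lparr>carrier := ?\<Gamma>\<rparr>)" "y \<in> carrier (?U\<lparr>carrier := ?\<Gamma>\<rparr>)"
        and eq: "\<phi> (?c x) = \<phi> (?c y)"
      then have xy: "x \<in> ?\<Gamma>" "y \<in> ?\<Gamma>" by auto
      have iy: "inv\<^bsub>?U\<^esub> y \<in> carrier ?U" using xy by (intro U.inv_closed) (rule \<Gamma>.mem_carrier)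
      have "?c x * inv\<^bsub>?U\<^esub> (?c y) \<in> ?c ` L"
        by (rule \<phi>(2)[OF _ _ eq]) (use xy c\<Gamma> in blast)+
      then have "?c (x \<otimes>\<^bsub>?U\<^esub> inv\<^bsub>?U\<^esub> y) \<in> ?c ` L"
        using c.hom_mult[OF \<Gamma>.mem_carrier[OF xy(1)] iy] c.hom_inv[OF \<Gamma>.mem_carrier[OF xy(2)]] by simp
      then obtain z where z: "z \<in> L" "?c (x \<otimes>\<^bsub>?U\<^esub> inv\<^bsub>?U\<^esub> y) = ?c z" by auto
      have "x \<otimes>\<^bsub>?U\<^esub> inv\<^bsub>?U\<^esub> y \<in> carrier_mat n n"
        using U.m_closed[OF \<Gamma>.mem_carrier[OF xy(1)] iy] by (rule SL_carrier_mat)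
      moreover have "z \<in> carrier_mat n n" using z(1) by (auto simp: L_def)
      ultimately have "x \<otimes>\<^bsub>?U\<^esub> inv\<^bsub>?U\<^esub> y = z" using diag_conj_inj[OF dnz _ _ z(2)] by blast
      moreover have "inv\<^bsub>?U\<lparr>carrier := ?\<Gamma>\<rparr>\<^esub> y = inv\<^bsub>?U\<^esub> y"
        by (rule U.m_inv_consistent[OF Gamma_subgroup xy(2)])
      ultimately show "x \<otimes>\<^bsub>?U\<lparr>carrier := ?\<Gamma>\<rparr>\<^esub> inv\<^bsub>?U\<lparr>carrier := ?\<Gamma>\<rparr>\<^esub> y \<in> L" using z(1) by simp
    qed
  qed
  interpret R: real_subring "\<rat>" by unfold_locales auto
  have "?E \<subseteq> carrier (SL n \<rat>)" using R.elem_mat_SL_ring by auto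
  then have "?\<Gamma> \<subseteq> carrier (SL n \<rat>)"
    unfolding Gamma_def by (rule U.generate_subgroup_incl[OF _ R.SL_subgroup])
  then have "subgroup ?\<Gamma> (SL n \<rat>)"
    using U.subgroup_incl[OF Gamma_subgroup R.SL_subgroup] SL_carrier_update[of n "\<rat>"] by metis
  moreover have "(SL n \<rat>)\<lparr>carrier := ?\<Gamma>\<rparr> = ?U\<lparr>carrier := ?\<Gamma>\<rparr>" by (simp add: SL_def)
  ultimately show "S_arithmetic n (insert Archimedean (Finite ` {p. prime p \<and> p dvd N})) ?\<Gamma>"
    unfolding S_arithmetic_def S_integers_eq_Z_inv[OF N] using LS LG by (simp add: L_def)
qed

theorem theorem1:
  shows "\<exists>alg. recursive_fun alg \<and>
    (\<forall>(n::nat) (Q :: nat \<Rightarrow> nat \<Rightarrow> rat).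
       n \<ge> 3 \<longrightarrow> (\<forall>i<n. \<forall>j<n. i \<noteq> j \<longrightarrow> Q i j \<noteq> 0) \<longrightarrow>
       (\<exists>(N::int) (g :: rat mat).
          alg (encode_input n Q) = encode_output N g \<and>
          N \<noteq> 0 \<and> g \<in> carrier (GL n) \<and> diagonal_mat g \<and>
          finite_index_subgroup
            (conjugate_set (GL n) (map_mat of_rat g) (Gamma n Q)) (SL n (Z_inv N))) \<and>
       (\<exists>S. S \<subseteq> rat_places \<and> finite S \<and> Archimedean \<in> S \<and> S_arithmetic n S (Gamma n Q)))"
proof (intro exI[of _ algorithm] conjI rf_algorithm allI impI)
  fix n :: nat and Q :: "nat \<Rightarrow> nat \<Rightarrow> rat"
  assume n: "n \<ge> 3" and Q: "\<forall>i<n. \<forall>j<n. i \<noteq> j \<longrightarrow> Q i j \<noteq> 0"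
  define x where "x = encode_input n Q"
  have [simp]: "pi1 x = n" by (simp add: x_def encode_input_def)
  define N where "N = denominator x"
  define d where "d = diag_entry (diagonal x)"
  let ?I = "\<lambda>i j. {x. elem_mat n i j (of_rat x) \<in> Gamma n Q}"
  interpret I: rat_net n ?I Q by (rule Gamma_rat_net[OF n Q])
  have N: "N > 0" and sol: "solution x N (diagonal x)"
    using denominator_solution[of x] by (simp_all add: N_def)
  have diag: "diag_code n (diagonal x)" and sc: "integral_scaling n (entry_num x) (entry_den x) N d"
    using sol by (simp_all add: solution_def d_def)
  have d: "d j > 0" if "j < n" for j using diag_codeD(2)[OF diag that] by (simp add: d_def)
  have Qab: "\<bar>Q i j\<bar> = of_nat (entry_num x i j) / of_nat (entry_den x i j)" if "i < n" "j < n" "i \<noteq> j" for i j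
    unfolding x_def by (rule input_num_den[OF that]) (use Q that in blast)
  have integral: "of_nat (d i) * of_rat (Q i j) / of_nat (d j) \<in> Z_inv (int N)" if "i < n" "j < n" "i \<noteq> j" for i j
    by (rule integral_scaling_Z_inv[OF d[OF that(1)] d[OF that(2)] _ _ Qab[OF that] N that sc]) auto
  let ?c = "diag_conj n (\<lambda>i. of_nat (d i))"
  have dnz: "\<forall>i<n. real (d i) \<noteq> 0" using d by fastforce
  have c\<Gamma>: "?c ` Gamma n Q \<subseteq> carrier (SL n (Z_inv (int N)))"
    by (rule diag_conj_Gamma_subset) (use N dnz integral in auto)
  have bad_dvd: "p dvd N" if "p \<in> I.bad_primes" for p
  proof (rule I.bad_prime_dvd[OF N _ _ _ that])
    show "d 0 > 0" "d 1 > 0" using d n by auto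
    fix q assume "q \<in> ?I 0 1"
    then have "elem_mat n 0 1 (of_rat q) \<in> Gamma n Q" by simp
    then have "?c (elem_mat n 0 1 (of_rat q)) \<in> carrier (SL n (Z_inv (int N)))" using c\<Gamma> by blast
    moreover have "?c (elem_mat n 0 1 (of_rat q)) = elem_mat n 0 1 (real (d 0) * of_rat q / real (d 1))"
      by (rule diag_conj_elem_mat) (use n dnz in auto)
    moreover have "elem_mat n 0 1 y $$ (0, 1) = y" for y
      using n by (simp add: elem_mat_def matrix_unit_def)
    ultimately have "real (d 0) * of_rat q / real (d 1) \<in> Z_inv (int N)"
      using n unfolding SL_carrier by (metis Suc_le_lessD numeral_3_eq_3 One_nat_def Suc_lessD)
    then obtain m k where "real (d 0) * of_rat q / real (d 1) = of_int m / of_int (int N) ^ k"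
      by (auto simp: Z_inv_def)
    then have "(of_rat (of_nat (d 0) * q / of_nat (d 1)) :: real) = of_rat (of_int m / of_nat N ^ k)"
      by (simp add: of_rat_divide of_rat_mult of_rat_power)
    then show "\<exists>m k. of_nat (d 0) * q / of_nat (d 1) = of_int m / of_nat N ^ k"
      by (simp only: of_rat_eq_iff) blast
  qed
  have fin: "finite I.bad_primes"
    by (rule finite_subset[of _ "{..N}"]) (use bad_dvd N in \<open>auto dest: dvd_imp_le\<close>)
  have "\<exists>d'. (\<forall>j. 0 < d' j \<and> d' j \<le> common_multiple x * common_multiple x) \<and>
    integral_scaling n (entry_num x) (entry_den x) (\<Prod>I.bad_primes) d'"
  proof (rule I.bad_primes_scaling[OF _ common_multiple(1) fin])
    fix i j assume "i < n" "j < n" "i \<noteq> j"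
    then show "0 < entry_num x i j \<and> 0 < entry_den x i j \<and> \<bar>Q i j\<bar> = of_nat (entry_num x i j) / of_nat (entry_den x i j) \<and>
        entry_num x i j dvd common_multiple x \<and> entry_den x i j dvd common_multiple x"
      using Qab common_multiple(2)[of i x j] by simp
  qed
  then obtain d' where "\<And>j. 0 < d' j \<and> d' j \<le> common_multiple x * common_multiple x"
    "integral_scaling n (entry_num x) (entry_den x) (\<Prod>I.bad_primes) d'" by blast
  moreover have pos: "0 < \<Prod>I.bad_primes"
    by (intro prod_pos) (use prime_gt_0_nat in \<open>auto simp: I.bad_primes_def\<close>)
  \<comment> \<open>The computed \<open>N\<close> is the least solution, and every solution is a multiple of this product.\<close>
  ultimately have "N \<le> \<Prod>I.bad_primes" unfolding N_def by (intro denominator_le[of _ d']) auto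
  moreover have "\<Prod>I.bad_primes dvd N"
    by (rule prod_primes_dvd[OF fin]) (use bad_dvd in \<open>auto simp: I.bad_primes_def\<close>)
  ultimately have N_eq: "N = \<Prod>I.bad_primes" using N by (meson dvd_imp_le le_antisym)
  obtain t where t: "t \<noteq> 0" "\<And>i j k. i < n \<Longrightarrow> j < n \<Longrightarrow> i \<noteq> j \<Longrightarrow> of_int t / of_nat N ^ k \<in> ?I i j"
    using I.divisible_by_bad_primes[OF fin] unfolding N_eq I.bad_primes_def by blast
  have divisible: "elem_mat n i j (of_int t * a) \<in> Gamma n Q"
    if ij: "i < n" "j < n" "i \<noteq> j" and a: "a \<in> Z_inv (int N)" for i j a
  proof -
    obtain m k where mk: "a = of_int m / of_int (int N) ^ k" using a by (auto simp: Z_inv_def)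
    have "of_int m * (of_int t / of_nat N ^ k) \<in> ?I i j" by (rule I.I_int_mult[OF ij t(2)[OF ij]])
    moreover have "of_rat (of_int m * (of_int t / of_nat N ^ k)) = of_int t * a"
      by (simp add: mk of_rat_divide of_rat_mult of_rat_power)
    ultimately show ?thesis by simp
  qed
  note arith = Gamma_arithmetic[OF n N d t(1) integral divisible]
  show "\<exists>S. S \<subseteq> rat_places \<and> finite S \<and> Archimedean \<in> S \<and> S_arithmetic n S (Gamma n Q)"
  proof (intro exI conjI)
    show "S_arithmetic n (insert Archimedean (Finite ` {p. prime p \<and> p dvd N})) (Gamma n Q)"
      by (rule arith(2))
    have "{p. prime p \<and> p dvd N} \<subseteq> {..N}" using N by (auto dest: dvd_imp_le)
    then show "finite (insert Archimedean (Finite ` {p. prime p \<and> p dvd N}))"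
      using finite_subset by blast
  qed (auto simp: rat_places_def)
  define g :: "rat mat" where "g = diagonal_matrix n (\<lambda>i. of_nat (d i))"
  have g: "map_mat of_rat g = diagonal_matrix n (\<lambda>i. real (d i))"
    by (rule eq_matI) (auto simp: g_def diagonal_matrix_def)
  show "\<exists>(N::int) (g :: rat mat).
          algorithm (encode_input n Q) = encode_output N g \<and>
          N \<noteq> 0 \<and> g \<in> carrier (GL n) \<and> diagonal_mat g \<and>
          finite_index_subgroup
            (conjugate_set (GL n) (map_mat of_rat g) (Gamma n Q)) (SL n (Z_inv N))"
  proof (intro exI[of _ "int N"] exI[of _ g] conjI)
    have "encode_output (int N) g = prod_encode (2 * N, encode_diag n d)"
      by (rule encode_output_diag) (auto simp: g_def diagonal_matrix_def)
    also have "encode_diag n d = diagonal x" using diag_codeD(1)[OF diag] by (simp add: d_def)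
    finally show "algorithm (encode_input n Q) = encode_output (int N) g"
      by (simp add: algorithm_def N_def x_def)
    show "g \<in> carrier (GL n)" unfolding g_def by (rule diagonal_matrix_GL) (use d in auto)
    show "diagonal_mat g" by (auto simp: diagonal_mat_def g_def diagonal_matrix_def)
    have "conjugate_set (GL n) (map_mat of_rat g) (Gamma n Q) = ?c ` Gamma n Q"
      unfolding conjugate_set_def g inv_GL_diagonal_matrix[OF dnz] diag_conj_def by (simp add: GL_def)
    then show "finite_index_subgroup (conjugate_set (GL n) (map_mat of_rat g) (Gamma n Q)) (SL n (Z_inv (int N)))"
      using arith(1) by simp
  qed (use N in simp)
qed

end
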